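(* Let $(\Gamma,K)$ be a non-tubular canonical bilinear lattice with associated reflection group $W$, set of reflections $T$ and Coxeter element $c$. Then the Hurwitz action on $\mathrm{Red}_T(c)$ is transitive.
   Context: Symbol: integers $t\ge0$, $\varepsilon\in\{1,2\}$, $p_1,\dots,p_t\ge2$, $d_i,f_i\ge1$ with $f_i\mid d_i$; put $e_i=d_i/f_i$, $n=\sum_{i=1}^t(p_i-1)+2$. Non-tubular means $\delta=\sum_{i=1}^t\varepsilon d_i(1-\frac1{p_i})-2\ne0$. The canonical bilinear lattice $(\Gamma,K)$ is the free abelian group with ordered basis $$R=(\alpha_{(t,p_t-1)},\dots,\alpha_{(t,1)},\dots,\alpha_{(1,p_1-1)},\dots,\alpha_{(1,1)},\alpha_0,\alpha_{0^*})$$ with bilinear form $K=\langle-,-\rangle$ given, for some $\kappa\in\mathbb{N}$, $\kappa\ge1$, with all $\frac{\kappa\varepsilon f_i}{e_i}\in\mathbb{N}$, by $\langle\alpha_{(i,j)},\alpha_{(i,j)}\rangle=\frac{\kappa\varepsilon f_i}{e_i}$ $(1\le j\le p_i-1)$; $\langle\alpha_{(i,j)},\alpha_{(i,j-1)}\rangle=-\frac{\kappa\varepsilon f_i}{e_i}$ for $2\le j\le p_i-1$; $\langle\alpha_{(i,1)},\alpha_0\rangle=-\kappa\varepsilon f_i$; $\langle\alpha_{(i,1)},\alpha_{0^*}\rangle=-\kappa\varepsilon^2f_i$; $\langle\alpha_0,\alpha_0\rangle=\kappa$, $\langle\alpha_0,\alpha_{0^*}\rangle=2\kappa\varepsilon$,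 $\langle\alpha_{0^*},\alpha_{0^*}\rangle=\kappa\varepsilon^2$; all other values on basis pairs are $0$. $B=(-,-)$ is the symmetrization $(\alpha,\beta)=\langle\alpha,\beta\rangle+\langle\beta,\alpha\rangle$. For $\alpha\in R$, $s_\alpha(\gamma)=\gamma-2\frac{(\gamma,\alpha)}{(\alpha,\alpha)}\alpha$. $W$ is the subgroup of the isometry group of $(\Gamma,B)$ generated by $S=\{s_\alpha\mid\alpha\in R\}$; $T$ is the set of $W$-conjugates of elements of $S$; the Coxeter element $c$ is the product of the $s_\alpha$, $\alpha\in R$, in the order of $R$. $\ell_T(c)$ is the minimal $r$ such that $c$ is a product of $r$ elements of $T$; $\mathrm{Red}_T(c)=\{(t_1,\dots,t_r)\in T^r\mid r=\ell_T(c),\ t_1\cdots t_r=c\}$. The braid group $B_r$ (generators $\sigma_1,\dots,\sigma_{r-1}$) acts on it by the Hurwitz action $\sigma_i(t_1,\dots,t_r)=(t_1,\dots,t_{i-1},t_{i+1},t_{i+1}^{-1}t_it_{i+1},t_{i+2},\dots,t_r)$. *)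

theory Defs
  imports "HOL-Algebra.Algebra"
begin

section \<open>Canonical bilinear lattices\<close>

text \<open>Arms are indexed by \<open>1, \<dots>, t\<close>; the functions \<open>sym_p\<close>, \<open>sym_d\<close>, \<open>sym_f\<close> are only relevant there.\<close>

record canonical_symbol =
  sym_t :: nat
  sym_eps :: nat
  sym_p :: "nat \<Rightarrow> nat"
  sym_d :: "nat \<Rightarrow> nat"
  sym_f :: "nat \<Rightarrow> nat"

definition is_symbol :: "canonical_symbol \<Rightarrow> bool" where
  "is_symbol C \<longleftrightarrow> sym_eps C \<in> {1, 2} \<and>
     (\<forall>i\<in>{1..sym_t C}. 2 \<le> sym_p C i \<and> 1 \<le> sym_d C i \<and> 1 \<le> sym_f C i \<and> sym_f C i dvd sym_d C i)"

definition sym_e :: "canonical_symbol \<Rightarrow> nat \<Rightarrow> nat" where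
  "sym_e C i = sym_d C i div sym_f C i"

definition sym_delta :: "canonical_symbol \<Rightarrow> rat" where
  "sym_delta C =
     (\<Sum>i=1..sym_t C. of_nat (sym_eps C * sym_d C i) * (1 - 1 / of_nat (sym_p C i))) - 2"

definition non_tubular :: "canonical_symbol \<Rightarrow> bool" where
  "non_tubular C \<longleftrightarrow> sym_delta C \<noteq> 0"

definition admissible_scale :: "canonical_symbol \<Rightarrow> nat \<Rightarrow> bool" where
  "admissible_scale C \<kappa> \<longleftrightarrow> 1 \<le> \<kappa> \<and>
     (\<forall>i\<in>{1..sym_t C}. sym_e C i dvd \<kappa> * sym_eps C * sym_f C i)"

text \<open>\<open>Arm i j\<close> labels \<open>\<alpha>\<^bsub>(i,j)\<^esub>\<close>; \<open>Zero\<close> and \<open>ZeroStar\<close> label \<open>\<alpha>\<^sub>0\<close> and \<open>\<alpha>\<^bsub>0*\<^esub>\<close>.\<close>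

datatype vertex = Arm nat nat | Zero | ZeroStar

definition basis_list :: "canonical_symbol \<Rightarrow> vertex list" where
  "basis_list C =
     concat (map (\<lambda>i. map (Arm i) (rev [1..<sym_p C i])) (rev [1..<Suc (sym_t C)])) @ [Zero, ZeroStar]"

definition can_lattice :: "canonical_symbol \<Rightarrow> (vertex \<Rightarrow>\<^sub>0 int) monoid" where
  "can_lattice C = free_Abelian_group (set (basis_list C))"

text \<open>The division is exact for an admissible \<open>\<kappa>\<close>.\<close>

definition arm_value :: "canonical_symbol \<Rightarrow> nat \<Rightarrow> nat \<Rightarrow> int" where
  "arm_value C \<kappa> i = int (\<kappa> * sym_eps C * sym_f C i div sym_e C i)"

fun basis_form :: "canonical_symbol \<Rightarrow> nat \<Rightarrow> vertex \<Rightarrow> vertex \<Rightarrow> int" where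
  "basis_form C \<kappa> (Arm i j) (Arm i' j') =
     (if i' = i \<and> j' = j then arm_value C \<kappa> i
      else if i' = i \<and> j = j' + 1 then - arm_value C \<kappa> i
      else 0)"
| "basis_form C \<kappa> (Arm i j) Zero = (if j = 1 then - int (\<kappa> * sym_eps C * sym_f C i) else 0)"
| "basis_form C \<kappa> (Arm i j) ZeroStar = (if j = 1 then - int (\<kappa> * (sym_eps C)\<^sup>2 * sym_f C i) else 0)"
| "basis_form C \<kappa> Zero Zero = int \<kappa>"
| "basis_form C \<kappa> Zero ZeroStar = int (2 * \<kappa> * sym_eps C)"
| "basis_form C \<kappa> ZeroStar ZeroStar = int (\<kappa> * (sym_eps C)\<^sup>2)"
| "basis_form C \<kappa> Zero (Arm i j) = 0"
| "basis_form C \<kappa> ZeroStar (Arm i j) = 0"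
| "basis_form C \<kappa> ZeroStar Zero = 0"

definition euler_form ::
  "canonical_symbol \<Rightarrow> nat \<Rightarrow> (vertex \<Rightarrow>\<^sub>0 int) \<Rightarrow> (vertex \<Rightarrow>\<^sub>0 int) \<Rightarrow> int" where
  "euler_form C \<kappa> x y =
     (\<Sum>a\<in>Poly_Mapping.keys x. \<Sum>b\<in>Poly_Mapping.keys y.
        Poly_Mapping.lookup x a * Poly_Mapping.lookup y b * basis_form C \<kappa> a b)"

definition sym_form ::
  "canonical_symbol \<Rightarrow> nat \<Rightarrow> (vertex \<Rightarrow>\<^sub>0 int) \<Rightarrow> (vertex \<Rightarrow>\<^sub>0 int) \<Rightarrow> int" where
  "sym_form C \<kappa> x y = euler_form C \<kappa> x y + euler_form C \<kappa> y x"

section \<open>The reflection group\<close>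

definition isometry_group :: "canonical_symbol \<Rightarrow> nat \<Rightarrow> ((vertex \<Rightarrow>\<^sub>0 int) \<Rightarrow> (vertex \<Rightarrow>\<^sub>0 int)) monoid" where
  "isometry_group C \<kappa> = (AutoGroup (can_lattice C))
     \<lparr>carrier := {g \<in> auto (can_lattice C).
        \<forall>x\<in>carrier (can_lattice C). \<forall>y\<in>carrier (can_lattice C).
          sym_form C \<kappa> (g x) (g y) = sym_form C \<kappa> x y}\<rparr>"

text \<open>For basis elements of a lattice with admissible \<open>\<kappa>\<close> the integer division is exact,
  see \<open>sym_form_integral\<close> below.\<close>

definition simple_reflection ::
  "canonical_symbol \<Rightarrow> nat \<Rightarrow> vertex \<Rightarrow> (vertex \<Rightarrow>\<^sub>0 int) \<Rightarrow> (vertex \<Rightarrow>\<^sub>0 int)" where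
  "simple_reflection C \<kappa> a = (\<lambda>x\<in>carrier (can_lattice C).
     x - frag_cmul (2 * sym_form C \<kappa> x (frag_of a) div sym_form C \<kappa> (frag_of a) (frag_of a)) (frag_of a))"

definition reflection_group :: "canonical_symbol \<Rightarrow> nat \<Rightarrow> ((vertex \<Rightarrow>\<^sub>0 int) \<Rightarrow> (vertex \<Rightarrow>\<^sub>0 int)) monoid" where
  "reflection_group C \<kappa> =
     subgroup_generated (isometry_group C \<kappa>) (simple_reflection C \<kappa> ` set (basis_list C))"

definition reflections :: "canonical_symbol \<Rightarrow> nat \<Rightarrow> ((vertex \<Rightarrow>\<^sub>0 int) \<Rightarrow> (vertex \<Rightarrow>\<^sub>0 int)) set" where
  "reflections C \<kappa> =
     {w \<otimes>\<^bsub>reflection_group C \<kappa>\<^esub> simple_reflection C \<kappa> a \<otimes>\<^bsub>reflection_group C \<kappa>\<^esub> inv\<^bsub>reflection_group C \<kappa>\<^esub> w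
        | w a. w \<in> carrier (reflection_group C \<kappa>) \<and> a \<in> set (basis_list C)}"

definition list_prod :: "('a, 'b) monoid_scheme \<Rightarrow> 'a list \<Rightarrow> 'a" where
  "list_prod G ts = foldr (monoid.mult G) ts \<one>\<^bsub>G\<^esub>"

definition coxeter_element :: "canonical_symbol \<Rightarrow> nat \<Rightarrow> (vertex \<Rightarrow>\<^sub>0 int) \<Rightarrow> (vertex \<Rightarrow>\<^sub>0 int)" where
  "coxeter_element C \<kappa> =
     list_prod (reflection_group C \<kappa>) (map (simple_reflection C \<kappa>) (basis_list C))"

definition factorizations :: "('a, 'b) monoid_scheme \<Rightarrow> 'a set \<Rightarrow> nat \<Rightarrow> 'a \<Rightarrow> 'a list set" where
  "factorizations G T r g = {ts. length ts = r \<and> set ts \<subseteq> T \<and> list_prod G ts = g}"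

definition factor_length :: "('a, 'b) monoid_scheme \<Rightarrow> 'a set \<Rightarrow> 'a \<Rightarrow> nat" where
  "factor_length G T g = (LEAST r. factorizations G T r g \<noteq> {})"

definition reduced_factorizations :: "('a, 'b) monoid_scheme \<Rightarrow> 'a set \<Rightarrow> 'a \<Rightarrow> 'a list set" where
  "reduced_factorizations G T g = factorizations G T (factor_length G T g) g"

section \<open>The braid group and its Hurwitz action\<close>

text \<open>The letter \<open>(i, True)\<close> stands for \<open>\<sigma>\<^sub>i\<close> and \<open>(i, False)\<close> for its inverse; the braid group on
  \<open>r\<close> strands is the set of words in these letters modulo the congruence generated by the
  Artin relations.\<close>

definition braid_words :: "nat \<Rightarrow> (nat \<times> bool) list set" where
  "braid_words r = lists ({1..<r} \<times> UNIV)"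

inductive braid_equiv :: "nat \<Rightarrow> (nat \<times> bool) list \<Rightarrow> (nat \<times> bool) list \<Rightarrow> bool" for r where
  refl: "w \<in> braid_words r \<Longrightarrow> braid_equiv r w w"
| sym: "braid_equiv r v w \<Longrightarrow> braid_equiv r w v"
| trans: "braid_equiv r u v \<Longrightarrow> braid_equiv r v w \<Longrightarrow> braid_equiv r u w"
| cancel: "u \<in> braid_words r \<Longrightarrow> v \<in> braid_words r \<Longrightarrow> i \<in> {1..<r} \<Longrightarrow>
    braid_equiv r (u @ [(i, b), (i, \<not> b)] @ v) (u @ v)"
| far: "u \<in> braid_words r \<Longrightarrow> v \<in> braid_words r \<Longrightarrow> i \<in> {1..<r} \<Longrightarrow> j \<in> {1..<r} \<Longrightarrow> i + 2 \<le> j \<Longrightarrow>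
    braid_equiv r (u @ [(i, True), (j, True)] @ v) (u @ [(j, True), (i, True)] @ v)"
| braid: "u \<in> braid_words r \<Longrightarrow> v \<in> braid_words r \<Longrightarrow> i \<in> {1..<r} \<Longrightarrow> i + 1 \<in> {1..<r} \<Longrightarrow>
    braid_equiv r (u @ [(i, True), (i + 1, True), (i, True)] @ v)
                  (u @ [(i + 1, True), (i, True), (i + 1, True)] @ v)"

definition braid_rel :: "nat \<Rightarrow> ((nat \<times> bool) list \<times> (nat \<times> bool) list) set" where
  "braid_rel r = {(v, w). braid_equiv r v w}"

definition braid_group :: "nat \<Rightarrow> (nat \<times> bool) list set monoid" where
  "braid_group r =
     \<lparr>carrier = braid_words r // braid_rel r,
      monoid.mult = (\<lambda>A B. \<Union>v\<in>A. \<Union>w\<in>B. braid_rel r `` {v @ w}),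
      one = braid_rel r `` {[]}\<rparr>"

text \<open>Lists are indexed from \<open>0\<close>, so \<open>t\<^sub>i\<close> is \<open>ts ! (i - 1)\<close>.\<close>

fun hurwitz_letter :: "('a, 'b) monoid_scheme \<Rightarrow> nat \<times> bool \<Rightarrow> 'a list \<Rightarrow> 'a list" where
  "hurwitz_letter G (i, True) ts =
     take (i - 1) ts @ [ts ! i, inv\<^bsub>G\<^esub> (ts ! i) \<otimes>\<^bsub>G\<^esub> ts ! (i - 1) \<otimes>\<^bsub>G\<^esub> ts ! i] @ drop (i + 1) ts"
| "hurwitz_letter G (i, False) ts =
     take (i - 1) ts @ [ts ! (i - 1) \<otimes>\<^bsub>G\<^esub> ts ! i \<otimes>\<^bsub>G\<^esub> inv\<^bsub>G\<^esub> (ts ! (i - 1)), ts ! (i - 1)] @ drop (i + 1) ts"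

definition hurwitz_word :: "('a, 'b) monoid_scheme \<Rightarrow> (nat \<times> bool) list \<Rightarrow> 'a list \<Rightarrow> 'a list" where
  "hurwitz_word G w = foldr (hurwitz_letter G) w"

text \<open>All words in a class act in the same way, see \<open>hurwitz_action_class\<close> below.\<close>

definition hurwitz_action ::
  "('a, 'b) monoid_scheme \<Rightarrow> 'a list set \<Rightarrow> (nat \<times> bool) list set \<Rightarrow> 'a list \<Rightarrow> 'a list" where
  "hurwitz_action G E A = (\<lambda>ts\<in>E. the_elem ((\<lambda>w. hurwitz_word G w ts) ` A))"

subsection \<open>The braid group is a group\<close>

lemma braid_words_append [simp]:
  "u @ v \<in> braid_words r \<longleftrightarrow> u \<in> braid_words r \<and> v \<in> braid_words r"
  by (auto simp: braid_words_def)

lemma braid_words_Nil [simp]: "[] \<in> braid_words r"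
  by (simp add: braid_words_def)

lemma braid_words_Cons [simp]:
  "x # v \<in> braid_words r \<longleftrightarrow> fst x \<in> {1..<r} \<and> v \<in> braid_words r"
  by (cases x) (auto simp: braid_words_def)

lemma braid_equiv_words:
  "braid_equiv r v w \<Longrightarrow> v \<in> braid_words r \<and> w \<in> braid_words r"
  by (induction rule: braid_equiv.induct) auto

lemma braid_equiv_context:
  "braid_equiv r v w \<Longrightarrow> x \<in> braid_words r \<Longrightarrow> y \<in> braid_words r \<Longrightarrow> braid_equiv r (x @ v @ y) (x @ w @ y)"
proof (induction rule: braid_equiv.induct)
  case (refl w)
  then show ?case by (simp add: braid_equiv.refl)
next
  case (sym v w)
  then show ?case by (simp add: braid_equiv.sym)
next
  case (trans u v w)
  show ?case by (rule braid_equiv.trans[OF trans.IH(1)[OF trans.prems] trans.IH(2)[OF trans.prems]])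
next
  case (cancel u v i b)
  then show ?case using braid_equiv.cancel[of "x @ u" r "v @ y" i b] by simp
next
  case (far u v i j)
  then show ?case using braid_equiv.far[of "x @ u" r "v @ y" i j] by simp
next
  case (braid u v i)
  then show ?case using braid_equiv.braid[of "x @ u" r "v @ y" i] by simp
qed

lemma braid_equiv_append:
  assumes "braid_equiv r v v'" "braid_equiv r w w'"
  shows "braid_equiv r (v @ w) (v' @ w')"
proof -
  have "braid_equiv r (v @ w) (v' @ w)"
    using braid_equiv_context[OF assms(1), of "[]" w] braid_equiv_words[OF assms(2)] by simp
  moreover have "braid_equiv r (v' @ w) (v' @ w')"
    using braid_equiv_context[OF assms(2), of v' "[]"] braid_equiv_words[OF assms(1)] by simp
  ultimately show ?thesis by (rule braid_equiv.trans)
qed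

lemma equiv_braid_rel: "equiv (braid_words r) (braid_rel r)"
proof (rule equivI)
  show "braid_rel r \<subseteq> braid_words r \<times> braid_words r"
    by (auto simp: braid_rel_def dest: braid_equiv_words)
  show "refl_on (braid_words r) (braid_rel r)"
    by (auto simp: refl_on_def braid_rel_def intro: braid_equiv.refl)
  show "Relation.sym (braid_rel r)"
    unfolding Relation.sym_def braid_rel_def using braid_equiv.sym by blast
  show "Relation.trans (braid_rel r)"
    unfolding Relation.trans_def braid_rel_def using braid_equiv.trans by blast
qed

lemma braid_class_eq:
  "v \<in> braid_words r \<Longrightarrow> w \<in> braid_words r \<Longrightarrow>
     braid_rel r `` {v} = braid_rel r `` {w} \<longleftrightarrow> braid_equiv r v w"
  using eq_equiv_class_iff[OF equiv_braid_rel] by (simp add: braid_rel_def)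

lemma braid_mult_class:
  assumes "v \<in> braid_words r" "w \<in> braid_words r"
  shows "(braid_rel r `` {v}) \<otimes>\<^bsub>braid_group r\<^esub> (braid_rel r `` {w}) = braid_rel r `` {v @ w}"
proof -
  have eq: "braid_rel r `` {v' @ w'} = braid_rel r `` {v @ w}"
    if "v' \<in> braid_rel r `` {v}" "w' \<in> braid_rel r `` {w}" for v' w'
  proof -
    have "braid_equiv r v v'" "braid_equiv r w w'" using that by (auto simp: braid_rel_def)
    then have "braid_equiv r (v' @ w') (v @ w)" using braid_equiv_append braid_equiv.sym by metis
    then show ?thesis using braid_class_eq braid_equiv_words by blast
  qed
  have ne: "v \<in> braid_rel r `` {v}" "w \<in> braid_rel r `` {w}"
    using assms by (auto simp: braid_rel_def intro: braid_equiv.refl)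
  have UN: "(\<Union>v\<in>A. \<Union>w\<in>B. F v w) = D"
    if "\<And>v w. v \<in> A \<Longrightarrow> w \<in> B \<Longrightarrow> F v w = D" "v \<in> A" "w \<in> B"
    for A B and F :: "_ \<Rightarrow> _ \<Rightarrow> (nat \<times> bool) list set" and D and v w :: "(nat \<times> bool) list"
    using that by auto
  show ?thesis unfolding braid_group_def monoid.simps by (rule UN[OF eq ne])
qed

lemma carrier_braid_group:
  "A \<in> carrier (braid_group r) \<longleftrightarrow> (\<exists>w\<in>braid_words r. A = braid_rel r `` {w})"
  by (auto simp: braid_group_def quotient_def)

definition braid_word_inv :: "(nat \<times> bool) list \<Rightarrow> (nat \<times> bool) list" where
  "braid_word_inv w = rev (map (\<lambda>(i, b). (i, \<not> b)) w)"

lemma braid_word_inv: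
  "w \<in> braid_words r \<Longrightarrow> braid_word_inv w \<in> braid_words r \<and> braid_equiv r (braid_word_inv w @ w) []"
proof (induction w)
  case Nil
  then show ?case by (simp add: braid_word_inv_def braid_equiv.refl)
next
  case (Cons x w)
  obtain i b where x: "x = (i, b)" by fastforce
  with Cons have w: "i \<in> {1..<r}" "w \<in> braid_words r" "braid_word_inv w \<in> braid_words r" by auto
  have "braid_equiv r (braid_word_inv w @ [(i, \<not> b), (i, \<not> \<not> b)] @ w) (braid_word_inv w @ w)"
    using w by (intro braid_equiv.cancel)
  moreover have "braid_equiv r (braid_word_inv w @ w) []" using Cons w by simp
  ultimately have "braid_equiv r (braid_word_inv w @ [(i, \<not> b), (i, \<not> \<not> b)] @ w) []"
    by (rule braid_equiv.trans)
  then show ?case using w by (simp add: braid_word_inv_def x)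
qed

lemma group_braid_group: "group (braid_group r)"
proof (rule groupI)
  show "\<one>\<^bsub>braid_group r\<^esub> \<in> carrier (braid_group r)"
    unfolding carrier_braid_group by (auto simp: braid_group_def)
  fix x y assume "x \<in> carrier (braid_group r)" "y \<in> carrier (braid_group r)"
  then obtain v w where vw: "v \<in> braid_words r" "w \<in> braid_words r"
    and x: "x = braid_rel r `` {v}" and y: "y = braid_rel r `` {w}"
    by (auto simp: carrier_braid_group)
  show "x \<otimes>\<^bsub>braid_group r\<^esub> y \<in> carrier (braid_group r)"
    unfolding x y braid_mult_class[OF vw] carrier_braid_group using vw by auto
  have one: "\<one>\<^bsub>braid_group r\<^esub> = braid_rel r `` {[]}" by (simp add: braid_group_def)
  show "\<one>\<^bsub>braid_group r\<^esub> \<otimes>\<^bsub>braid_group r\<^esub> x = x"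
    unfolding x one using braid_mult_class[of "[]" r v] vw by simp
  show "\<exists>z\<in>carrier (braid_group r). z \<otimes>\<^bsub>braid_group r\<^esub> x = \<one>\<^bsub>braid_group r\<^esub>"
    unfolding x one using braid_word_inv[OF vw(1)] vw(1)
    by (intro bexI[of _ "braid_rel r `` {braid_word_inv v}"])
       (simp_all add: braid_mult_class braid_class_eq carrier_braid_group, blast intro: braid_equiv.refl)
  fix z assume "z \<in> carrier (braid_group r)"
  then obtain u where "u \<in> braid_words r" "z = braid_rel r `` {u}"
    by (auto simp: carrier_braid_group)
  then show "x \<otimes>\<^bsub>braid_group r\<^esub> y \<otimes>\<^bsub>braid_group r\<^esub> z = x \<otimes>\<^bsub>braid_group r\<^esub> (y \<otimes>\<^bsub>braid_group r\<^esub> z)"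
    unfolding x y using vw by (simp add: braid_mult_class)
qed

subsection \<open>The Hurwitz action is well defined\<close>

lemma hurwitz_letter_split:
  "i = length xs + 1 \<Longrightarrow>
     hurwitz_letter G (i, True) (xs @ a # b # ys) = xs @ b # (inv\<^bsub>G\<^esub> b \<otimes>\<^bsub>G\<^esub> a \<otimes>\<^bsub>G\<^esub> b) # ys"
  "i = length xs + 1 \<Longrightarrow>
     hurwitz_letter G (i, False) (xs @ a # b # ys) = xs @ (a \<otimes>\<^bsub>G\<^esub> b \<otimes>\<^bsub>G\<^esub> inv\<^bsub>G\<^esub> a) # a # ys"
  by (simp_all add: nth_append)

lemma split_at2:
  assumes "i \<in> {1..<length ts}"
  obtains xs a b ys where "ts = xs @ a # b # ys" "i = length xs + 1"
proof -
  have "ts = take (i - 1) ts @ ts ! (i - 1) # ts ! i # drop (i + 1) ts"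
    using assms id_take_nth_drop[of "i-1" ts] Cons_nth_drop_Suc[of i ts] by (cases i) auto
  then show ?thesis using that[of "take (i - 1) ts"] assms by force
qed

lemma list_prod_Nil [simp]: "list_prod G [] = \<one>\<^bsub>G\<^esub>"
  and list_prod_Cons [simp]: "list_prod G (x # xs) = x \<otimes>\<^bsub>G\<^esub> list_prod G xs"
  by (simp_all add: list_prod_def)

context group begin

lemma list_prod_closed [simp]: "set ts \<subseteq> carrier G \<Longrightarrow> list_prod G ts \<in> carrier G"
  by (induction ts) auto

lemma list_prod_append:
  "set xs \<subseteq> carrier G \<Longrightarrow> set ys \<subseteq> carrier G \<Longrightarrow> list_prod G (xs @ ys) = list_prod G xs \<otimes> list_prod G ys"
  by (induction xs) (auto simp: m_assoc)

lemma inv_mult_cancel: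
  "x \<in> carrier G \<Longrightarrow> y \<in> carrier G \<Longrightarrow> inv x \<otimes> (x \<otimes> y) = y"
  "x \<in> carrier G \<Longrightarrow> y \<in> carrier G \<Longrightarrow> x \<otimes> (inv x \<otimes> y) = y"
  by (simp_all add: m_assoc[symmetric])

lemma hurwitz_letter_closed:
  assumes T: "T \<subseteq> carrier G" "\<And>x y. x \<in> T \<Longrightarrow> y \<in> T \<Longrightarrow> inv y \<otimes> x \<otimes> y \<in> T"
      "\<And>x y. x \<in> T \<Longrightarrow> y \<in> T \<Longrightarrow> y \<otimes> x \<otimes> inv y \<in> T"
    and ts: "ts \<in> factorizations G T r g" and i: "i \<in> {1..<r}"
  shows "hurwitz_letter G (i, b) ts \<in> factorizations G T r g"
    and "hurwitz_letter G (i, b) (hurwitz_letter G (i, \<not> b) ts) = ts"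
proof -
  have [simp]: "length ts = r" using ts by (simp add: factorizations_def)
  obtain xs x y ys where s: "ts = xs @ x # y # ys" "i = length xs + 1"
    using split_at2[of i ts] i \<open>length ts = r\<close> by metis
  have m: "x \<in> T" "y \<in> T" "set xs \<subseteq> T" "set ys \<subseteq> T"
    and p: "list_prod G ts = g" using ts s by (auto simp: factorizations_def)
  then have c: "x \<in> carrier G" "y \<in> carrier G" "set xs \<subseteq> carrier G" "set ys \<subseteq> carrier G"
    using T(1) by auto
  show "hurwitz_letter G (i, b) ts \<in> factorizations G T r g"
    using ts m c T(2)[OF m(1,2)] T(3)[OF m(2,1)]
    by (cases b) (auto simp: factorizations_def s hurwitz_letter_split list_prod_append
        m_assoc inv_mult_cancel simp del: hurwitz_letter.simps)
  show "hurwitz_letter G (i, b) (hurwitz_letter G (i, \<not> b) ts) = ts"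
    using c by (cases b) (simp_all add: s hurwitz_letter_split m_assoc inv_mult_cancel
        del: hurwitz_letter.simps)
qed

lemma hurwitz_letter_far:
  assumes "i \<in> {1..<length ts}" "j \<in> {1..<length ts}" "i + 2 \<le> j"
  shows "hurwitz_letter G (i, True) (hurwitz_letter G (j, True) ts) =
         hurwitz_letter G (j, True) (hurwitz_letter G (i, True) ts)"
proof -
  obtain xs x y ys where s: "ts = xs @ x # y # ys" "i = length xs + 1"
    using split_at2[OF assms(1)] by metis
  define k where "k = j - length xs - 2"
  have "k \<in> {1..<length ys}" using assms s by (auto simp: k_def)
  then obtain us u v vs where s': "ys = us @ u # v # vs" "k = length us + 1"
    using split_at2 by metis
  have j: "j = length (xs @ x # y # us) + 1" using assms(3) s s' by (simp add: k_def)
  have j': "j = length (xs @ x' # y' # us) + 1" for x' y' :: 'a using j by simp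
  have "hurwitz_letter G (j, True) (xs @ x' # y' # us @ u # v # vs) =
        xs @ x' # y' # us @ v # (inv v \<otimes> u \<otimes> v) # vs" for x' y'
    using hurwitz_letter_split(1)[of j "xs @ x' # y' # us" G u v vs, OF j'] by simp
  then show ?thesis by (simp add: s(1) s' hurwitz_letter_split(1)[OF s(2)] del: hurwitz_letter.simps)
qed

lemma hurwitz_letter_braid:
  assumes "i \<in> {1..<length ts}" "i + 1 \<in> {1..<length ts}" "set ts \<subseteq> carrier G"
  shows "hurwitz_letter G (i, True) (hurwitz_letter G (i + 1, True) (hurwitz_letter G (i, True) ts)) =
         hurwitz_letter G (i + 1, True) (hurwitz_letter G (i, True) (hurwitz_letter G (i + 1, True) ts))"
proof -
  obtain xs x y ys where s: "ts = xs @ x # y # ys" "i = length xs + 1"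
    using split_at2[OF assms(1)] by metis
  obtain z zs where z: "ys = z # zs" using assms(2) s by (cases ys) auto
  have c: "x \<in> carrier G" "y \<in> carrier G" "z \<in> carrier G" using assms(3) s z by auto
  have j: "i + 1 = length (xs @ [x']) + 1" for x' using s by simp
  have "hurwitz_letter G (i + 1, True) (xs @ x' # u # v # zs) = xs @ x' # v # (inv v \<otimes> u \<otimes> v) # zs" for x' u v
    using hurwitz_letter_split(1)[of "i + 1" "xs @ [x']" G u v zs, OF j] by simp
  then show ?thesis using c
    by (simp add: s(1) z hurwitz_letter_split(1)[OF s(2)] m_assoc inv_mult_cancel inv_mult_group
        del: hurwitz_letter.simps)
qed


lemma image_const_on: "a \<in> A \<Longrightarrow> (\<And>x. x \<in> A \<Longrightarrow> f x = y) \<Longrightarrow> f ` A = {y}"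
  by auto

lemma hurwitz_word_simps [simp]:
  "hurwitz_word G [] ts = ts"
  "hurwitz_word G (x # w) ts = hurwitz_letter G x (hurwitz_word G w ts)"
  "hurwitz_word G (v @ w) ts = hurwitz_word G v (hurwitz_word G w ts)"
  by (simp_all add: hurwitz_word_def)

context
  fixes T assumes T: "T \<subseteq> carrier G"
      "\<And>x y. x \<in> T \<Longrightarrow> y \<in> T \<Longrightarrow> inv y \<otimes> x \<otimes> y \<in> T"
      "\<And>x y. x \<in> T \<Longrightarrow> y \<in> T \<Longrightarrow> y \<otimes> x \<otimes> inv y \<in> T"
begin

lemma hurwitz_word_closed:
  "w \<in> braid_words r \<Longrightarrow> ts \<in> factorizations G T r g \<Longrightarrow> hurwitz_word G w ts \<in> factorizations G T r g"
proof (induction w)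
  case (Cons x w)
  obtain i b where x: "x = (i, b)" by fastforce
  with Cons have "hurwitz_word G w ts \<in> factorizations G T r g" "i \<in> {1..<r}" by auto
  from hurwitz_letter_closed(1)[OF T this] show ?case by (simp add: x del: hurwitz_letter.simps)
qed simp

lemma hurwitz_word_equiv:
  "braid_equiv r v w \<Longrightarrow> ts \<in> factorizations G T r g \<Longrightarrow> hurwitz_word G v ts = hurwitz_word G w ts"
proof (induction rule: braid_equiv.induct)
  case (cancel u v i b)
  have "hurwitz_word G v ts \<in> factorizations G T r g"
    using cancel by (intro hurwitz_word_closed)
  from hurwitz_letter_closed(2)[OF T this cancel(3)] show ?case by simp
next
  case (far u v i j)
  have "hurwitz_word G v ts \<in> factorizations G T r g"
    using far by (intro hurwitz_word_closed)
  then have "length (hurwitz_word G v ts) = r" by (simp add: factorizations_def)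
  with far hurwitz_letter_far[of i "hurwitz_word G v ts" j] show ?case
    by (simp del: hurwitz_letter.simps)
next
  case (braid u v i)
  have "hurwitz_word G v ts \<in> factorizations G T r g"
    using braid by (intro hurwitz_word_closed)
  then have "length (hurwitz_word G v ts) = r" "set (hurwitz_word G v ts) \<subseteq> carrier G"
    using T(1) by (auto simp add: factorizations_def)
  with braid hurwitz_letter_braid[of i "hurwitz_word G v ts"] show ?case
    by (simp del: hurwitz_letter.simps)
qed auto

lemma hurwitz_action_class:
  assumes w: "w \<in> braid_words r" and ts: "ts \<in> factorizations G T r g"
  shows "hurwitz_action G (factorizations G T r g) (braid_rel r `` {w}) ts = hurwitz_word G w ts"
proof -
  have "(\<lambda>v. hurwitz_word G v ts) ` (braid_rel r `` {w}) = {hurwitz_word G w ts}"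
  proof (rule image_const_on)
    show "w \<in> braid_rel r `` {w}" using braid_equiv.refl[OF w] by (simp add: braid_rel_def)
    fix v assume "v \<in> braid_rel r `` {w}"
    then have "braid_equiv r v w" by (simp add: braid_rel_def braid_equiv.sym)
    then show "hurwitz_word G v ts = hurwitz_word G w ts" by (rule hurwitz_word_equiv[OF _ ts])
  qed
  then show ?thesis using ts by (simp add: hurwitz_action_def)
qed

lemma hurwitz_action_Bij:
  assumes w: "w \<in> braid_words r"
  shows "hurwitz_action G (factorizations G T r g) (braid_rel r `` {w}) \<in> Bij (factorizations G T r g)"
proof -
  let ?E = "factorizations G T r g"
  obtain v where v: "v \<in> braid_words r" "braid_equiv r (v @ w) []"
    using braid_word_inv[OF w] by blast
  obtain u where u: "u \<in> braid_words r" "braid_equiv r (u @ v) []"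
    using braid_word_inv[OF v(1)] by blast
  have uw: "hurwitz_word G u ts = hurwitz_word G w ts" if ts: "ts \<in> ?E" for ts
  proof -
    have "hurwitz_word G u (hurwitz_word G v (hurwitz_word G w ts)) = hurwitz_word G w ts"
      using hurwitz_word_equiv[OF u(2) hurwitz_word_closed[OF w ts]] by simp
    moreover have "hurwitz_word G v (hurwitz_word G w ts) = ts"
      using hurwitz_word_equiv[OF v(2) ts] by simp
    ultimately show ?thesis by simp
  qed
  have "bij_betw (hurwitz_word G w) ?E ?E"
  proof (rule bij_betw_byWitness[of _ "hurwitz_word G v"])
    show "\<forall>ts\<in>?E. hurwitz_word G v (hurwitz_word G w ts) = ts"
      using hurwitz_word_equiv[OF v(2)] by simp
    show "\<forall>ts\<in>?E. hurwitz_word G w (hurwitz_word G v ts) = ts"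
      using hurwitz_word_equiv[OF u(2)] uw[OF hurwitz_word_closed[OF v(1)]] by simp
  qed (auto intro: hurwitz_word_closed w v)
  moreover have "bij_betw (hurwitz_action G ?E (braid_rel r `` {w})) ?E ?E \<longleftrightarrow> bij_betw (hurwitz_word G w) ?E ?E"
    by (intro bij_betw_cong hurwitz_action_class w)
  ultimately show ?thesis by (simp add: Bij_def hurwitz_action_def)
qed

lemma hurwitz_group_action:
  "group_action (braid_group r) (factorizations G T r g) (hurwitz_action G (factorizations G T r g))"
proof (intro group_action.intro group_hom.intro group_braid_group group_BijGroup group_hom_axioms.intro homI)
  let ?E = "factorizations G T r g" let ?h = "hurwitz_action G ?E"
  fix x assume "x \<in> carrier (braid_group r)"
  then obtain v where v: "v \<in> braid_words r" "x = braid_rel r `` {v}"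
    by (auto simp: carrier_braid_group)
  have x: "?h x \<in> Bij ?E" unfolding v(2) by (rule hurwitz_action_Bij[OF v(1)])
  then show "?h x \<in> carrier (BijGroup ?E)" by (simp add: BijGroup_def)
  fix y assume "y \<in> carrier (braid_group r)"
  then obtain w where w: "w \<in> braid_words r" "y = braid_rel r `` {w}"
    by (auto simp: carrier_braid_group)
  have y: "?h y \<in> Bij ?E" unfolding w(2) by (rule hurwitz_action_Bij[OF w(1)])
  have "?h (x \<otimes>\<^bsub>braid_group r\<^esub> y) = compose ?E (?h x) (?h y)"
  proof
    fix ts show "?h (x \<otimes>\<^bsub>braid_group r\<^esub> y) ts = compose ?E (?h x) (?h y) ts"
    proof (cases "ts \<in> ?E")
      case True
      then show ?thesis using v w
        by (simp add: braid_mult_class hurwitz_action_class hurwitz_word_closed compose_def)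
    qed (simp add: hurwitz_action_def compose_def)
  qed
  then show "?h (x \<otimes>\<^bsub>braid_group r\<^esub> y) = ?h x \<otimes>\<^bsub>BijGroup ?E\<^esub> ?h y"
    using x y by (simp add: BijGroup_def)
qed

end

end

section \<open>Integrality, and the reflection group acts by isometries\<close>

lemma set_basis_list:
  "set (basis_list C) = {Arm i j | i j. i \<in> {1..sym_t C} \<and> j \<in> {1..<sym_p C i}} \<union> {Zero, ZeroStar}"
  unfolding basis_list_def by (auto simp del: upt_Suc simp: less_Suc_eq_le)

lemma euler_form_superset:
  assumes "finite A" "Poly_Mapping.keys x \<subseteq> A" "Poly_Mapping.keys y \<subseteq> A"
  shows "euler_form C \<kappa> x y =
     (\<Sum>a\<in>A. \<Sum>b\<in>A. Poly_Mapping.lookup x a * Poly_Mapping.lookup y b * basis_form C \<kappa> a b)"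
proof -
  have "euler_form C \<kappa> x y = (\<Sum>a\<in>Poly_Mapping.keys x. \<Sum>b\<in>A. Poly_Mapping.lookup x a * Poly_Mapping.lookup y b * basis_form C \<kappa> a b)"
    unfolding euler_form_def using assms
    by (intro sum.cong refl sum.mono_neutral_left) (auto simp: in_keys_iff)
  also have "\<dots> = (\<Sum>a\<in>A. \<Sum>b\<in>A. Poly_Mapping.lookup x a * Poly_Mapping.lookup y b * basis_form C \<kappa> a b)"
    using assms by (intro sum.mono_neutral_left) (auto simp: in_keys_iff)
  finally show ?thesis .
qed

lemma euler_form_add:
  "euler_form C \<kappa> (x + y) z = euler_form C \<kappa> x z + euler_form C \<kappa> y z"
  "euler_form C \<kappa> z (x + y) = euler_form C \<kappa> z x + euler_form C \<kappa> z y"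
proof -
  let ?A = "Poly_Mapping.keys x \<union> Poly_Mapping.keys y \<union> Poly_Mapping.keys z"
  have A: "finite ?A" "Poly_Mapping.keys x \<subseteq> ?A" "Poly_Mapping.keys y \<subseteq> ?A" "Poly_Mapping.keys z \<subseteq> ?A"
    "Poly_Mapping.keys (x + y) \<subseteq> ?A" using keys_add[of x y] by auto
  show "euler_form C \<kappa> (x + y) z = euler_form C \<kappa> x z + euler_form C \<kappa> y z"
    "euler_form C \<kappa> z (x + y) = euler_form C \<kappa> z x + euler_form C \<kappa> z y"
    using A by (simp_all add: euler_form_superset[of ?A] lookup_add algebra_simps sum.distrib)
qed

lemma euler_form_cmul:
  "euler_form C \<kappa> (frag_cmul k x) y = k * euler_form C \<kappa> x y"
  "euler_form C \<kappa> y (frag_cmul k x) = k * euler_form C \<kappa> y x"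
proof -
  let ?A = "Poly_Mapping.keys x \<union> Poly_Mapping.keys y"
  have A: "finite ?A" "Poly_Mapping.keys x \<subseteq> ?A" "Poly_Mapping.keys y \<subseteq> ?A"
    "Poly_Mapping.keys (frag_cmul k x) \<subseteq> ?A" using keys_cmul[of k x] by auto
  show "euler_form C \<kappa> (frag_cmul k x) y = k * euler_form C \<kappa> x y"
    "euler_form C \<kappa> y (frag_cmul k x) = k * euler_form C \<kappa> y x"
    using A by (simp_all add: euler_form_superset[of ?A] sum_distrib_left mult_ac)
qed

lemma euler_form_frag_of [simp]: "euler_form C \<kappa> (frag_of a) (frag_of b) = basis_form C \<kappa> a b"
  by (simp add: euler_form_def)

lemma sym_form_add:
  "sym_form C \<kappa> (x + y) z = sym_form C \<kappa> x z + sym_form C \<kappa> y z"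
  "sym_form C \<kappa> z (x + y) = sym_form C \<kappa> z x + sym_form C \<kappa> z y"
  by (simp_all add: sym_form_def euler_form_add)

lemma sym_form_cmul:
  "sym_form C \<kappa> (frag_cmul k x) y = k * sym_form C \<kappa> x y"
  "sym_form C \<kappa> y (frag_cmul k x) = k * sym_form C \<kappa> y x"
  by (simp_all add: sym_form_def euler_form_cmul algebra_simps)

lemma sym_form_diff:
  "sym_form C \<kappa> (x - y) z = sym_form C \<kappa> x z - sym_form C \<kappa> y z"
  "sym_form C \<kappa> z (x - y) = sym_form C \<kappa> z x - sym_form C \<kappa> z y"
  using sym_form_add(1)[of C \<kappa> "x - y" y z] sym_form_add(2)[of C \<kappa> z "x - y" y]
  by (metis add_diff_cancel_right' diff_add_cancel)+

lemma sym_form_commute: "sym_form C \<kappa> x y = sym_form C \<kappa> y x"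
  by (simp add: sym_form_def)

lemma arm_value_exact:
  assumes "is_symbol C" "admissible_scale C \<kappa>" "i \<in> {1..sym_t C}"
  shows "arm_value C \<kappa> i * int (sym_e C i) = int (\<kappa> * sym_eps C * sym_f C i)" "arm_value C \<kappa> i > 0"
proof -
  have "sym_e C i dvd \<kappa> * sym_eps C * sym_f C i" using assms by (auto simp: admissible_scale_def)
  then obtain m where m: "\<kappa> * sym_eps C * sym_f C i = sym_e C i * m" by (rule dvdE)
  have "\<kappa> \<noteq> 0" "sym_eps C \<noteq> 0" "sym_f C i \<noteq> 0"
    using assms bspec[of "{1..sym_t C}" _ i] unfolding is_symbol_def admissible_scale_def
    by (metis insert_iff not_one_le_zero singleton_iff zero_neq_numeral zero_neq_one)+
  then have "\<kappa> * sym_eps C * sym_f C i \<noteq> 0" by simp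
  then have "sym_e C i \<noteq> 0" "m \<noteq> 0" unfolding m by simp_all
  moreover from this have "arm_value C \<kappa> i = int m" by (simp add: arm_value_def m)
  ultimately show "arm_value C \<kappa> i * int (sym_e C i) = int (\<kappa> * sym_eps C * sym_f C i)"
    and "arm_value C \<kappa> i > 0" unfolding m by simp_all
qed

lemma sym_form_basis_pos:
  assumes "is_symbol C" "admissible_scale C \<kappa>" "a \<in> set (basis_list C)"
  shows "sym_form C \<kappa> (frag_of a) (frag_of a) > 0"
proof -
  have *: "\<kappa> > 0" "sym_eps C > 0" using assms by (auto simp: is_symbol_def admissible_scale_def)
  show ?thesis
  proof (cases a)
    case (Arm i j)
    then have "i \<in> {1..sym_t C}" using assms by (simp add: set_basis_list)
    from arm_value_exact(2)[OF assms(1,2) this] show ?thesis by (simp add: Arm sym_form_def)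
  qed (use * in \<open>simp_all add: sym_form_def\<close>)
qed

lemma sym_form_basis_integral:
  assumes C: "is_symbol C" "admissible_scale C \<kappa>"
    and ab: "a \<in> set (basis_list C)" "b \<in> set (basis_list C)"
  shows "sym_form C \<kappa> (frag_of a) (frag_of a) dvd 2 * sym_form C \<kappa> (frag_of b) (frag_of a)"
proof -
  have e: "sym_eps C = 1 \<or> sym_eps C = 2" using C by (auto simp: is_symbol_def)
  show ?thesis
  proof (cases a)
    case (Arm i j)
    define u where "u = arm_value C \<kappa> i"
    have "i \<in> {1..sym_t C}" using ab Arm by (simp add: set_basis_list)
    from arm_value_exact(1)[OF C this]
    have 1: "int (\<kappa> * sym_eps C * sym_f C i) = u * int (sym_e C i)" by (simp add: u_def)
    have "int (\<kappa> * (sym_eps C)\<^sup>2 * sym_f C i) = int (sym_eps C) * int (\<kappa> * sym_eps C * sym_f C i)"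
      by (simp add: power2_eq_square)
    then have 2: "int (\<kappa> * (sym_eps C)\<^sup>2 * sym_f C i) = u * (int (sym_eps C) * int (sym_e C i))"
      unfolding 1 by simp
    have N: "basis_form C \<kappa> a a + basis_form C \<kappa> a a = 2 * u"
      by (simp add: \<open>a = _\<close> u_def)
    have "u dvd basis_form C \<kappa> b a + basis_form C \<kappa> a b"
    proof (cases b)
      case (Arm i' j')
      then show ?thesis unfolding \<open>a = _\<close> Arm by (auto simp: u_def)
    next
      case Zero
      have "basis_form C \<kappa> a b = (if j = 1 then - (u * int (sym_e C i)) else 0)"
        unfolding \<open>a = _\<close> Zero basis_form.simps 1 ..
      moreover have "basis_form C \<kappa> b a = 0" by (simp add: \<open>a = _\<close> Zero)
      ultimately show ?thesis by simp
    next
      case ZeroStar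
      have "basis_form C \<kappa> a b = (if j = 1 then - (u * (int (sym_eps C) * int (sym_e C i))) else 0)"
        unfolding \<open>a = _\<close> ZeroStar basis_form.simps 2 ..
      moreover have "basis_form C \<kappa> b a = 0" by (simp add: \<open>a = _\<close> ZeroStar)
      ultimately show ?thesis by simp
    qed
    then show ?thesis unfolding sym_form_def euler_form_frag_of N by (rule mult_dvd_mono[OF dvd_refl])
  next
    case Zero
    then show ?thesis unfolding sym_form_def euler_form_frag_of
      by (cases b) (simp_all add: mult.assoc)
  next
    case ZeroStar
    then show ?thesis unfolding sym_form_def euler_form_frag_of
      using e by (cases b) (auto simp: power2_eq_square)
  qed
qed

lemma sym_form_integral:
  assumes "is_symbol C" "admissible_scale C \<kappa>" "a \<in> set (basis_list C)" "x \<in> carrier (can_lattice C)"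
  shows "sym_form C \<kappa> (frag_of a) (frag_of a) dvd 2 * sym_form C \<kappa> x (frag_of a)"
proof -
  have "Poly_Mapping.keys x \<subseteq> set (basis_list C)" using assms(4) by (simp add: can_lattice_def)
  then show ?thesis
  proof (induction x rule: frag_induction)
    case zero
    then show ?case by (simp add: sym_form_def euler_form_def)
  next
    case (one b)
    then show ?case using sym_form_basis_integral[OF assms(1-3)] by simp
  next
    case (diff x y)
    then show ?case by (simp add: sym_form_diff right_diff_distrib)
  qed
qed

lemma group_can_lattice: "group (can_lattice C)"
  by (simp add: can_lattice_def)

lemma group_isometry_group: "group (isometry_group C \<kappa>)"
proof -
  let ?L = "carrier (can_lattice C)"
  let ?I = "{g \<in> auto (can_lattice C). \<forall>x\<in>?L. \<forall>y\<in>?L. sym_form C \<kappa> (g x) (g y) = sym_form C \<kappa> x y}"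
  interpret L: group "can_lattice C" by (rule group_can_lattice)
  interpret B: group "BijGroup ?L" by (rule group_BijGroup)
  have "subgroup ?I (BijGroup ?L)"
  proof
    show "?I \<subseteq> carrier (BijGroup ?L)" using L.subgroup_auto subgroup.subset by blast
    show "\<one>\<^bsub>BijGroup ?L\<^esub> \<in> ?I" using subgroup.one_closed[OF L.subgroup_auto] by (auto simp: BijGroup_def)
    fix g assume g: "g \<in> ?I"
    then have gB: "g \<in> Bij ?L" by (auto simp: auto_def)
    show "inv\<^bsub>BijGroup ?L\<^esub> g \<in> ?I"
    proof safe
      show "inv\<^bsub>BijGroup ?L\<^esub> g \<in> auto (can_lattice C)" using g subgroup.m_inv_closed[OF L.subgroup_auto] by blast
      fix x y assume xy: "x \<in> ?L" "y \<in> ?L"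
      then have "inv_into ?L g x \<in> ?L" "g (inv_into ?L g x) = x" "inv_into ?L g y \<in> ?L" "g (inv_into ?L g y) = y"
        using gB by (auto simp: Bij_inv_into_mem Bij_def bij_betw_def f_inv_into_f)
      then show "sym_form C \<kappa> ((inv\<^bsub>BijGroup ?L\<^esub> g) x) ((inv\<^bsub>BijGroup ?L\<^esub> g) y) = sym_form C \<kappa> x y"
        using g xy by (simp add: inv_BijGroup[OF gB]) metis
    qed
    fix h assume h: "h \<in> ?I"
    then have hB: "h \<in> Bij ?L" by (auto simp: auto_def)
    show "g \<otimes>\<^bsub>BijGroup ?L\<^esub> h \<in> ?I"
    proof safe
      show "g \<otimes>\<^bsub>BijGroup ?L\<^esub> h \<in> auto (can_lattice C)" using g h subgroup.m_closed[OF L.subgroup_auto] by blast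
      fix x y assume xy: "x \<in> ?L" "y \<in> ?L"
      then show "sym_form C \<kappa> ((g \<otimes>\<^bsub>BijGroup ?L\<^esub> h) x) ((g \<otimes>\<^bsub>BijGroup ?L\<^esub> h) y) = sym_form C \<kappa> x y"
        using g h gB hB Bij_imp_funcset[OF hB] by (auto simp: BijGroup_def compose_def Pi_iff)
    qed
  qed
  then show ?thesis
    using B.subgroup_imp_group by (simp add: isometry_group_def AutoGroup_def)
qed

lemma simple_reflection_in_isometry_group:
  assumes C: "is_symbol C" "admissible_scale C \<kappa>" and a: "a \<in> set (basis_list C)"
  shows "simple_reflection C \<kappa> a \<in> carrier (isometry_group C \<kappa>)"
proof -
  let ?L = "carrier (can_lattice C)" let ?s = "simple_reflection C \<kappa> a"
  define N where "N = sym_form C \<kappa> (frag_of a) (frag_of a)"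
  define k where "k x = 2 * sym_form C \<kappa> x (frag_of a) div N" for x
  have N: "N > 0" using sym_form_basis_pos[OF C a] by (simp add: N_def)
  have kN: "k x * N = 2 * sym_form C \<kappa> x (frag_of a)" if "x \<in> ?L" for x
    using sym_form_integral[OF C a that] by (simp add: k_def N_def)
  have aL: "frag_of a \<in> ?L" using a by (simp add: can_lattice_def)
  have addL: "x + y \<in> ?L" if "x \<in> ?L" "y \<in> ?L" for x y
    using that keys_add[of x y] by (auto simp: can_lattice_def)
  have s: "?s x = x - frag_cmul (k x) (frag_of a)" if "x \<in> ?L" for x
    using that by (simp add: simple_reflection_def k_def N_def)
  have sL: "?s x \<in> ?L" if "x \<in> ?L" for x
    unfolding s[OF that] using that a keys_diff[of x "frag_cmul (k x) (frag_of a)"]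
    by (auto simp: can_lattice_def split: if_splits)
  have k_add: "k (x + y) = k x + k y" if "x \<in> ?L" "y \<in> ?L" for x y
  proof -
    have "k (x + y) * N = (k x + k y) * N"
      using kN[OF addL[OF that]] kN[OF that(1)] kN[OF that(2)] by (simp add: sym_form_add algebra_simps)
    then show ?thesis using N by simp
  qed
  have k_s: "k (?s x) = - k x" if x: "x \<in> ?L" for x
  proof -
    have "k (?s x) * N = 2 * sym_form C \<kappa> x (frag_of a) - 2 * (k x * N)"
      unfolding kN[OF sL[OF x]] unfolding s[OF x] sym_form_diff sym_form_cmul N_def
      by (simp add: right_diff_distrib)
    then have "k (?s x) * N = (- k x) * N" using kN[OF x] by simp
    with N show ?thesis by (metis less_irrefl mult_right_cancel)
  qed
  have ss: "?s (?s x) = x" if "x \<in> ?L" for x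
    unfolding s[OF sL[OF that]] k_s[OF that] unfolding s[OF that]
    by (simp flip: minus_frag_cmul)
  have "?s \<in> hom (can_lattice C) (can_lattice C)"
  proof (rule homI)
    fix x y assume xy: "x \<in> ?L" "y \<in> ?L"
    then show "?s (x \<otimes>\<^bsub>can_lattice C\<^esub> y) = ?s x \<otimes>\<^bsub>can_lattice C\<^esub> ?s y"
      using s[OF addL[OF xy]] s[OF xy(1)] s[OF xy(2)] k_add[OF xy]
      by (simp add: can_lattice_def frag_cmul_distrib)
  qed (rule sL)
  moreover have "?s \<in> Bij ?L"
    unfolding Bij_def
    using bij_betw_byWitness[of ?L ?s ?s ?L] ss sL by (auto simp: simple_reflection_def)
  moreover have "sym_form C \<kappa> (?s x) (?s y) = sym_form C \<kappa> x y" if xy: "x \<in> ?L" "y \<in> ?L" for x y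
  proof -
    let ?a = "frag_of a"
    have "sym_form C \<kappa> (?s x) (?s y) = sym_form C \<kappa> x y - k y * sym_form C \<kappa> x ?a - k x * sym_form C \<kappa> y ?a + k x * k y * N"
      unfolding s[OF xy(1)] s[OF xy(2)] N_def
      by (simp add: sym_form_diff sym_form_cmul sym_form_commute[of C \<kappa> ?a y] algebra_simps)
    then have "2 * sym_form C \<kappa> (?s x) (?s y) = 2 * sym_form C \<kappa> x y - k y * (2 * sym_form C \<kappa> x ?a) - k x * (2 * sym_form C \<kappa> y ?a) + 2 * (k x * k y * N)"
      by simp
    then show ?thesis using kN[OF xy(1), symmetric] kN[OF xy(2), symmetric] by simp
  qed
  ultimately show ?thesis by (simp add: isometry_group_def auto_def)
qed

lemma hurwitz_action_reduced_factorizations: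
  assumes C: "is_symbol C" "admissible_scale C \<kappa>"
  defines "G \<equiv> reflection_group C \<kappa>" and "T \<equiv> reflections C \<kappa>" and "c \<equiv> coxeter_element C \<kappa>"
  shows "coxeter_element C \<kappa> \<in> carrier G" and "T \<subseteq> carrier G" and "reduced_factorizations G T c \<noteq> {}"
    and "group_action (braid_group (factor_length G T c)) (reduced_factorizations G T c)
           (hurwitz_action G (reduced_factorizations G T c))"
proof -
  interpret I: group "isometry_group C \<kappa>" by (rule group_isometry_group)
  interpret group G unfolding G_def reflection_group_def by simp
  have S: "simple_reflection C \<kappa> a \<in> carrier G" if "a \<in> set (basis_list C)" for a
    unfolding G_def reflection_group_def
    using I.subgroup_generated_subset_carrier_subset[of "simple_reflection C \<kappa> ` set (basis_list C)"]
      simple_reflection_in_isometry_group[OF C] that by blast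
  show c: "coxeter_element C \<kappa> \<in> carrier G"
    unfolding coxeter_element_def G_def[symmetric] using S by (intro list_prod_closed) auto
  have T_iff: "x \<in> T \<longleftrightarrow> (\<exists>w\<in>carrier G. \<exists>a\<in>set (basis_list C). x = w \<otimes>\<^bsub>G\<^esub> simple_reflection C \<kappa> a \<otimes>\<^bsub>G\<^esub> inv\<^bsub>G\<^esub> w)" for x
    unfolding T_def reflections_def G_def by blast
  show TG: "T \<subseteq> carrier G" using S by (auto simp: T_iff)
  have conj: "y \<otimes>\<^bsub>G\<^esub> x \<otimes>\<^bsub>G\<^esub> inv\<^bsub>G\<^esub> y \<in> T" if "x \<in> T" "y \<in> carrier G" for x y
  proof -
    from that obtain w a where *: "w \<in> carrier G" "a \<in> set (basis_list C)"
       "x = w \<otimes>\<^bsub>G\<^esub> simple_reflection C \<kappa> a \<otimes>\<^bsub>G\<^esub> inv\<^bsub>G\<^esub> w" by (auto simp: T_iff)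
    then show ?thesis unfolding T_iff using that S
      by (intro bexI[of _ "y \<otimes>\<^bsub>G\<^esub> w"] bexI[of _ a]) (simp_all add: m_assoc inv_mult_group)
  qed
  have ST: "simple_reflection C \<kappa> a \<in> T" if "a \<in> set (basis_list C)" for a
    unfolding T_iff using that S by (intro bexI[of _ "\<one>\<^bsub>G\<^esub>"] bexI[of _ a]) auto
  have "map (simple_reflection C \<kappa>) (basis_list C) \<in> factorizations G T (length (basis_list C)) c"
    unfolding factorizations_def c_def coxeter_element_def G_def using ST by auto
  then show "reduced_factorizations G T c \<noteq> {}"
    unfolding reduced_factorizations_def factor_length_def
    by (intro LeastI_ex[of "\<lambda>r. factorizations G T r c \<noteq> {}"]) blast
  have "inv\<^bsub>G\<^esub> y \<otimes>\<^bsub>G\<^esub> x \<otimes>\<^bsub>G\<^esub> y \<in> T" if "x \<in> T" "y \<in> T" for x y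
    using conj[OF that(1), of "inv\<^bsub>G\<^esub> y"] that TG by auto
  then show "group_action (braid_group (factor_length G T c)) (reduced_factorizations G T c)
           (hurwitz_action G (reduced_factorizations G T c))"
    unfolding reduced_factorizations_def using conj TG by (intro hurwitz_group_action) auto
qed

end

theory Submission
  imports Defs
begin

text \<open>
  The vector \<open>a = \<alpha>\<^bsub>0*\<^esub> - \<epsilon> \<alpha>\<^sub>0\<close> lies in the radical of the symmetric form, and the reflection group
  \<open>W\<close> fixes it. Modulo \<open>a\<close> the lattice has the arm vectors and \<open>\<alpha>\<^sub>0\<close> as a basis, and \<open>W\<close> acts through the
  Weyl group of a Cartan matrix with a star as its diagram, the centre of the star being \<open>\<alpha>\<^sub>0\<close>. The
  reflections in \<open>\<alpha>\<^sub>0\<close> and \<open>\<alpha>\<^bsub>0*\<^esub>\<close> agree modulo \<open>a\<close>, so the image of the Coxeter element \<open>c\<close> is the product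
  of the arm reflections, each taken once. An element of \<open>T\<close> is described by an affine root \<open>(\<beta>, z)\<close>: a
  real root \<open>\<beta>\<close> of the star together with the coefficient \<open>z\<close> of \<open>a/\<epsilon>\<close>. The arm vectors have \<open>z = 0\<close>,
  while \<open>\<alpha>\<^sub>0\<close> and \<open>\<alpha>\<^bsub>0*\<^esub>\<close> give \<open>(\<alpha>\<^sub>0, 0)\<close> and \<open>(\<alpha>\<^sub>0, 1)\<close>. The claim is that Hurwitz moves take every
  reduced factorization of \<open>c\<close> to the standard one.

  The first half is about Weyl groups. Give a group element \<open>w\<close> the depth \<open>- ht (w \<rho>)\<close>, where \<open>\<rho>\<close> is a
  strictly dominant vector, and look at the depths of the products of the initial segments of a
  factorization. If one of them is larger than both its neighbours, and the two reflections that meet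
  there differ, then a Hurwitz move of these two lowers it (\<open>no_peak\<close>). A factorization for which the
  sum of the depths is least possible thus either contains two equal neighbours, and such a pair can be
  pushed to the end of the list, or has increasing depths. In the second case the exchange condition
  identifies it, up to Hurwitz moves, if the product is one of distinct simple reflections. Hence
  every factorization of the image of \<open>c\<close> becomes the list of arm reflections followed by pairs of equal
  reflections (\<open>hurwitz_normal_form\<close>).

  The second half keeps track of the coefficients of \<open>a\<close>. A reduced factorization of \<open>c\<close> is no longer
  than the standard one, so it has at most one such pair \<open>(\<beta>, y), (\<beta>, z)\<close>. That \<open>\<delta> \<noteq> 0\<close> yields a vector
  orthogonal to all arms but not to \<open>\<alpha>\<^sub>0\<close>. The arm reflections fix it and \<open>c\<close> moves it by a multiple of \<open>a\<close>;
  comparing this multiple with the effect of the pair shows that the pair is present, that the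
  coefficient of \<open>\<alpha>\<^sub>0\<close> in \<open>\<beta>\<close> is 1 and that \<open>z = y + 1\<close> (\<open>pair_root\<close>). A pair can be carried past an arm
  reflection and back, which conjugates \<open>\<beta>\<close> by that reflection; repeating this makes \<open>\<beta>\<close> equal to \<open>\<alpha>\<^sub>0\<close>
  (\<open>pair_to_zero\<close>). Moves inside the pair shift \<open>y\<close> to \<open>0\<close> (\<open>shift_pair\<close>), and then the product being
  \<open>c\<close> forces the coefficients of the arm roots to vanish as well (\<open>arm_shifts_zero\<close>).
\<close>

section \<open>Symmetrizable Cartan matrices and their real roots\<close>

text \<open>Vectors are coefficient functions on the index type, of which only the coordinates in \<open>I\<close> take part
  in the form; this way index sets that depend on parameters need no type of their own. A strictly
  dominant vector in the lattice takes the place of a Weyl vector; it exists as soon as the matrix is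
  nondegenerate.\<close>

locale cartan_lattice =
  fixes I :: "'i set" and D :: "'i \<Rightarrow> int" and A :: "'i \<Rightarrow> 'i \<Rightarrow> int"
  assumes finite_I: "finite I"
    and D_pos: "i \<in> I \<Longrightarrow> D i > 0"
    and A_diag: "i \<in> I \<Longrightarrow> A i i = 2"
    and A_off_diag: "i \<in> I \<Longrightarrow> j \<in> I \<Longrightarrow> i \<noteq> j \<Longrightarrow> A i j \<le> 0"
    and A_symmetrizable: "i \<in> I \<Longrightarrow> j \<in> I \<Longrightarrow> D i * A i j = D j * A j i"
    and ex_dominant: "\<exists>x. \<forall>i\<in>I. (\<Sum>j\<in>I. A i j * x j) > 0"
begin

text \<open>The pairing of a vector with the simple coroot of index \<open>i\<close>.\<close>

definition coroot :: "'i \<Rightarrow> ('i \<Rightarrow> int) \<Rightarrow> int" where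
  "coroot i x = (\<Sum>j\<in>I. A i j * x j)"

definition simple :: "'i \<Rightarrow> 'i \<Rightarrow> int" where
  "simple i = (\<lambda>j. if j = i then 1 else 0)"

definition srefl :: "'i \<Rightarrow> ('i \<Rightarrow> int) \<Rightarrow> 'i \<Rightarrow> int" where
  "srefl i x = (\<lambda>j. x j - coroot i x * simple i j)"

definition act :: "'i list \<Rightarrow> ('i \<Rightarrow> int) \<Rightarrow> 'i \<Rightarrow> int" where
  "act ws = foldr srefl ws"

text \<open>The invariant form, normalised so that the simple root of index \<open>i\<close> has square length \<open>2 D i\<close>.\<close>

definition form :: "('i \<Rightarrow> int) \<Rightarrow> ('i \<Rightarrow> int) \<Rightarrow> int" where
  "form x y = (\<Sum>i\<in>I. x i * D i * coroot i y)"

definition ht :: "('i \<Rightarrow> int) \<Rightarrow> int" where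
  "ht x = (\<Sum>i\<in>I. x i)"

definition pos :: "('i \<Rightarrow> int) \<Rightarrow> bool" where
  "pos x \<longleftrightarrow> (\<forall>i. x i \<ge> 0) \<and> (\<exists>i\<in>I. x i > 0)"

abbreviation neg :: "('i \<Rightarrow> int) \<Rightarrow> bool" where
  "neg x \<equiv> pos (\<lambda>j. - x j)"

text \<open>These are the real roots of the Cartan matrix.\<close>

definition root :: "('i \<Rightarrow> int) \<Rightarrow> bool" where
  "root b \<longleftrightarrow> (\<exists>ws i. set ws \<subseteq> I \<and> i \<in> I \<and> b = act ws (simple i))"

text \<open>The pairing of \<open>x\<close> with the coroot of \<open>b\<close>. If \<open>b\<close> is a root then the division is exact, see
  \<open>cor_form\<close>.\<close>

definition cor :: "('i \<Rightarrow> int) \<Rightarrow> ('i \<Rightarrow> int) \<Rightarrow> int" where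
  "cor b x = 2 * form x b div form b b"

definition refl :: "('i \<Rightarrow> int) \<Rightarrow> ('i \<Rightarrow> int) \<Rightarrow> 'i \<Rightarrow> int" where
  "refl b x = (\<lambda>j. x j - cor b x * b j)"

text \<open>One equation covers additivity and homogeneity, in the shape in which a reflection changes a
  vector.\<close>

definition linear :: "(('i \<Rightarrow> int) \<Rightarrow> 'i \<Rightarrow> int) \<Rightarrow> bool" where
  "linear f \<longleftrightarrow> (\<forall>x y k. f (\<lambda>j. x j - k * y j) = (\<lambda>j. f x j - k * f y j))"

lemma coroot_diff: "coroot i (\<lambda>j. x j - k * y j) = coroot i x - k * coroot i y"
  by (simp add: coroot_def sum_subtractf sum_distrib_left algebra_simps)

lemma coroot_simple [simp]: "j \<in> I \<Longrightarrow> coroot i (simple j) = A i j"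
  by (simp add: coroot_def simple_def finite_I if_distrib cong: if_cong)

lemma form_diff:
  "form (\<lambda>j. x j - k * y j) z = form x z - k * form y z"
  "form z (\<lambda>j. x j - k * y j) = form z x - k * form z y"
  by (simp_all add: form_def coroot_diff sum_subtractf sum_distrib_left algebra_simps)

lemma form_commute: "form x y = form y x"
proof -
  have "form x y = (\<Sum>i\<in>I. \<Sum>j\<in>I. x i * (D i * A i j) * y j)"
    by (simp add: form_def coroot_def sum_distrib_left mult_ac)
  also have "\<dots> = (\<Sum>i\<in>I. \<Sum>j\<in>I. x i * (D j * A j i) * y j)"
    by (intro sum.cong) (simp_all add: A_symmetrizable)
  also have "\<dots> = (\<Sum>j\<in>I. \<Sum>i\<in>I. x i * (D j * A j i) * y j)" by (rule sum.swap)
  also have "\<dots> = form y x"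
    by (simp add: form_def coroot_def sum_distrib_left mult_ac)
  finally show ?thesis .
qed

lemma form_simple:
  assumes "i \<in> I" shows "form (simple i) x = D i * coroot i x" "form x (simple i) = D i * coroot i x"
proof -
  show "form (simple i) x = D i * coroot i x" using assms
    by (simp add: form_def simple_def finite_I if_distrib[of "\<lambda>c. c * _"] cong: if_cong)
  then show "form x (simple i) = D i * coroot i x" by (simp add: form_commute)
qed

lemma form_simple_simple: "i \<in> I \<Longrightarrow> form (simple i) (simple i) = 2 * D i"
  by (simp add: form_simple A_diag)

lemma act_simps [simp]: "act [] x = x" "act (i # ws) x = srefl i (act ws x)"
  "act (vs @ ws) x = act vs (act ws x)"
  by (simp_all add: act_def)

lemma linear_srefl: "linear (srefl i)"
  by (simp add: linear_def srefl_def coroot_diff algebra_simps)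

lemma linear_comp: "linear f \<Longrightarrow> linear g \<Longrightarrow> linear (\<lambda>x. f (g x))"
  by (simp add: linear_def)

lemma linear_act: "linear (act ws)"
proof (induction ws)
  case (Cons i ws)
  then show ?case using linear_comp[OF linear_srefl] by (simp add: linear_def)
qed (simp add: linear_def)

lemmas act_diff = linear_act[unfolded linear_def, rule_format]

lemma linear_zero: "linear f \<Longrightarrow> f (\<lambda>_. 0) = (\<lambda>_. 0)"
  unfolding linear_def by (drule spec[of _ "\<lambda>_. 0"], drule spec[of _ "\<lambda>_. 0"], drule spec[of _ 1]) simp

lemma linear_scale: "linear f \<Longrightarrow> f (\<lambda>j. k * x j) = (\<lambda>j. k * f x j)"
  using linear_zero[of f] linear_def[of f, THEN iffD1, rule_format, of "\<lambda>_. 0" "-k" x] by simp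

lemma linear_minus: "linear f \<Longrightarrow> f (\<lambda>j. - x j) = (\<lambda>j. - f x j)"
  using linear_scale[of f "-1" x] by simp

lemmas act_scale = linear_scale[OF linear_act]
lemmas act_minus = linear_minus[OF linear_act]

lemma srefl_simple: "i \<in> I \<Longrightarrow> srefl i (simple i) = (\<lambda>j. - simple i j)"
  by (simp add: srefl_def A_diag fun_eq_iff)

lemma srefl_srefl [simp]: "i \<in> I \<Longrightarrow> srefl i (srefl i x) = x"
  unfolding srefl_def coroot_diff by (simp add: A_diag)

lemma form_srefl: "i \<in> I \<Longrightarrow> form (srefl i x) (srefl i y) = form x y"
  unfolding srefl_def form_diff
  by (simp add: form_simple A_diag algebra_simps)

lemma act_rev [simp]: "set ws \<subseteq> I \<Longrightarrow> act ws (act (rev ws) x) = x"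
  "set ws \<subseteq> I \<Longrightarrow> act (rev ws) (act ws x) = x"
  by (induction ws arbitrary: x) auto

lemma form_act: "set ws \<subseteq> I \<Longrightarrow> form (act ws x) (act ws y) = form x y"
  by (induction ws) (auto simp: form_srefl)

lemma form_act_left: "set ws \<subseteq> I \<Longrightarrow> form x (act ws y) = form (act (rev ws) x) y"
  using form_act[of ws "act (rev ws) x" y] by simp

lemma act_outside: "set ws \<subseteq> I \<Longrightarrow> j \<notin> set ws \<Longrightarrow> act ws x j = x j"
  by (induction ws) (auto simp: srefl_def simple_def)

lemma act_cong: "set ws \<subseteq> I \<Longrightarrow> (\<And>j. j \<in> I \<Longrightarrow> x j = y j) \<Longrightarrow> j \<in> I \<Longrightarrow> act ws x j = act ws y j"
proof (induction ws arbitrary: j)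
  case (Cons i ws)
  have eq: "act ws x j = act ws y j" if "j \<in> I" for j
    using Cons.IH[OF _ Cons.prems(2) that] Cons.prems(1) by simp
  have "coroot i (act ws x) = coroot i (act ws y)"
    unfolding coroot_def by (rule sum.cong) (simp_all add: eq)
  with eq[OF Cons.prems(3)] show ?case by (simp add: srefl_def)
qed simp

text \<open>Group elements treat coordinates outside \<open>I\<close> in the same way, so they may be compared on the
  lattice proper.\<close>

lemma act_eqI_supported:
  assumes "set vs \<subseteq> I" "set ws \<subseteq> I"
    and eq: "\<And>x. (\<And>j. j \<notin> I \<Longrightarrow> x j = 0) \<Longrightarrow> act vs x = act ws x"
  shows "act vs = act ws"
proof (intro ext)
  fix x j
  show "act vs x j = act ws x j"
  proof (cases "j \<in> I")
    case True
    let ?x = "\<lambda>j. if j \<in> I then x j else 0"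
    have "act vs x j = act vs ?x j" by (rule act_cong[OF assms(1) _ True]) simp
    moreover have "act ws x j = act ws ?x j" by (rule act_cong[OF assms(2) _ True]) simp
    moreover have "act vs ?x = act ws ?x" by (rule eq) simp
    ultimately show ?thesis by simp
  next
    case False
    then have "j \<notin> set vs" "j \<notin> set ws" using assms(1,2) by auto
    then show ?thesis using act_outside assms(1,2) by simp
  qed
qed

lemma root_simple: "i \<in> I \<Longrightarrow> root (simple i)"
  unfolding root_def by (rule exI[of _ "[]"]) auto

lemma root_act: "root b \<Longrightarrow> set vs \<subseteq> I \<Longrightarrow> root (act vs b)"
  unfolding root_def by (metis act_simps(3) le_sup_iff set_append)

lemma root_outside: "root b \<Longrightarrow> j \<notin> I \<Longrightarrow> b j = 0"
  unfolding root_def by (auto simp: act_outside[OF _ contra_subsetD] simple_def)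

text \<open>The form is invariant, so the coroot of \<open>w \<alpha>\<^sub>i\<close> is the coroot of \<open>\<alpha>\<^sub>i\<close> composed with the inverse of \<open>w\<close>.\<close>

lemma cor_act:
  assumes "set ws \<subseteq> I" "i \<in> I"
  shows "cor (act ws (simple i)) x = coroot i (act (rev ws) x)"
  using D_pos[OF assms(2)] assms
  by (simp add: cor_def form_act form_act_left form_simple A_diag)

lemma cor_simple: "i \<in> I \<Longrightarrow> cor (simple i) = coroot i"
  using cor_act[of "[]" i] by auto

lemma refl_simple: "i \<in> I \<Longrightarrow> refl (simple i) = srefl i"
  by (simp add: fun_eq_iff refl_def srefl_def cor_simple)

lemma refl_act:
  assumes "set ws \<subseteq> I" "i \<in> I"
  shows "refl (act ws (simple i)) = act (ws @ i # rev ws)"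
  using assms act_diff[of ws "act (rev ws) x" "coroot i (act (rev ws) x)" "simple i" for x]
  by (auto simp: fun_eq_iff refl_def cor_act srefl_def)

lemma refl_word:
  assumes "root b"
  obtains ws where "set ws \<subseteq> I" "refl b = act ws"
proof -
  from assms obtain ws i where *: "set ws \<subseteq> I" "i \<in> I" "b = act ws (simple i)" unfolding root_def by blast
  show ?thesis using that[of "ws @ i # rev ws"] * refl_act by simp
qed

lemma form_root_pos: "root b \<Longrightarrow> form b b > 0"
  unfolding root_def using D_pos by (auto simp: form_act form_simple_simple)

lemma cor_form: "root b \<Longrightarrow> cor b x * form b b = 2 * form x b"
  unfolding root_def
  by (auto simp: cor_act form_act form_act_left form_simple A_diag)

lemma root_refl: "root b \<Longrightarrow> root c \<Longrightarrow> root (refl b c)"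
  using refl_word[of b] root_act by metis

lemma linear_refl: "root b \<Longrightarrow> linear (refl b)"
  using refl_word[of b] linear_act by metis

lemma cor_diff: "root b \<Longrightarrow> cor b (\<lambda>j. x j - k * y j) = cor b x - k * cor b y"
  unfolding root_def by (auto simp: cor_act act_diff coroot_diff)

lemma cor_self [simp]: "root b \<Longrightarrow> cor b b = 2"
  using form_root_pos[of b] by (simp add: cor_def)

lemma refl_self [simp]: "root b \<Longrightarrow> refl b b = (\<lambda>j. - b j)"
  by (simp add: refl_def fun_eq_iff)

lemma cor_refl: "root b \<Longrightarrow> cor b (refl b x) = - cor b x"
  unfolding refl_def by (subst cor_diff) auto

lemma refl_refl [simp]: "root b \<Longrightarrow> refl b (refl b x) = x"
  using cor_refl[of b x] by (simp add: refl_def fun_eq_iff)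

lemma form_refl: "root b \<Longrightarrow> form (refl b x) (refl b y) = form x y"
  using refl_word[of b] form_act by metis

lemma form_refl_left: "root b \<Longrightarrow> form x (refl b y) = form (refl b x) y"
  using form_refl[of b "refl b x" y] by simp

lemma cor_refl_root: "root b \<Longrightarrow> root c \<Longrightarrow> cor (refl b c) x = cor c (refl b x)"
  by (simp add: cor_def form_refl form_refl_left)

lemma refl_conj: "root b \<Longrightarrow> root c \<Longrightarrow> refl (refl b c) x = refl b (refl c (refl b x))"
proof -
  assume b: "root b" and c: "root c"
  have "refl b (refl c (refl b x)) = refl b (\<lambda>j. refl b x j - cor c (refl b x) * c j)"
    by (simp add: refl_def[of c])
  also have "\<dots> = (\<lambda>j. x j - cor c (refl b x) * refl b c j)"
    using linear_refl[OF b] b by (simp add: linear_def)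
  finally show ?thesis by (simp add: refl_def[of "refl b c"] cor_refl_root[OF b c])
qed

lemma cor_uminus: "cor (\<lambda>j. - b j) x = - cor b x" if "root b"
proof -
  have "cor (refl b b) x = - cor b x" using that by (simp only: cor_refl_root[OF that that] cor_refl)
  then show ?thesis using that by simp
qed

lemma refl_uminus: "root b \<Longrightarrow> refl (\<lambda>j. - b j) = refl b"
  by (simp add: fun_eq_iff refl_def cor_uminus)

lemma root_uminus: "root b \<Longrightarrow> root (\<lambda>j. - b j)"
  using root_refl[of b b] by simp

text \<open>Real roots are primitive: a group element turns one into a simple root, which has a coordinate
  equal to 1. Hence each of the two factors divides the other.\<close>

lemma root_proportional:
  assumes b: "root b" and c: "root c" and mn: "m > 0" "n > 0" and eq: "\<And>j. m * b j = n * c j"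
  shows "b = c"
proof -
  have dvd: "n dvd m" if "root b" "\<And>j. m * b j = n * c j" for b c :: "'i \<Rightarrow> int" and m n
  proof -
    from that(1) obtain ws i where *: "set ws \<subseteq> I" "i \<in> I" "b = act ws (simple i)" unfolding root_def by blast
    have "(\<lambda>j. m * act (rev ws) b j) = (\<lambda>j. n * act (rev ws) c j)"
      unfolding act_scale[symmetric] that(2) ..
    then have "m * act (rev ws) b i = n * act (rev ws) c i" by (rule fun_cong)
    moreover have "act (rev ws) b i = 1" using * by (simp add: simple_def)
    ultimately show ?thesis by simp
  qed
  have "n dvd m" using dvd[OF b eq] .
  moreover have "m dvd n" using dvd[OF c eq[symmetric]] .
  ultimately have "m = n" using mn zdvd_antisym_nonneg[of m n] by simp
  then have "b j = c j" for j using eq[of j] mn by simp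
  then show ?thesis by (rule ext)
qed

end

section \<open>Positive and negative roots\<close>

text \<open>The alternating word with \<open>n\<close> letters whose last letter is \<open>t\<close>; new letters are added in front.\<close>

fun alt :: "'a \<Rightarrow> 'a \<Rightarrow> nat \<Rightarrow> 'a list" where
  "alt s t 0 = []"
| "alt s t (Suc n) = (if even n then t else s) # alt s t n"

text \<open>Applying \<open>alt s t n\<close> to the simple root \<open>\<alpha>\<^sub>s\<close> gives a combination of \<open>\<alpha>\<^sub>s\<close> and \<open>\<alpha>\<^sub>t\<close>. The first entry is
  the coefficient of the simple root whose reflection was applied last, the second entry the other one.
  Here \<open>a\<close> and \<open>b\<close> stand for \<open>- A s t\<close> and \<open>- A t s\<close>, see \<open>alt_act\<close>.\<close>

fun dihedral_coeffs :: "int \<Rightarrow> int \<Rightarrow> nat \<Rightarrow> int \<times> int" where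
  "dihedral_coeffs a b 0 = (1, 0)"
| "dihedral_coeffs a b (Suc n) =
     ((if even n then b else a) * fst (dihedral_coeffs a b n) - snd (dihedral_coeffs a b n), fst (dihedral_coeffs a b n))"

text \<open>If \<open>ab \<ge> 4\<close> the dihedral group is infinite and the coefficients grow too fast to change sign. If
  \<open>ab \<le> 3\<close> it is finite, there are only six cases, and each sequence passes through \<open>(0, 1)\<close> before an
  entry becomes negative.\<close>

lemma dihedral_coeffs_nonneg:
  fixes a b :: int
  assumes ab: "a \<ge> 0" "b \<ge> 0" "a = 0 \<longleftrightarrow> b = 0"
  shows "(fst (dihedral_coeffs a b n) \<ge> 0 \<and> snd (dihedral_coeffs a b n) \<ge> 0) \<or>
    (\<exists>k<n. dihedral_coeffs a b k = (0, 1))"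
proof (cases "a * b \<ge> 4")
  case True
  \<comment> \<open>The second inequality says that the next coefficient is at least the one two steps before it.\<close>
  have "0 \<le> snd (dihedral_coeffs a b n) \<and>
     2 * snd (dihedral_coeffs a b n) \<le> (if even n then b else a) * fst (dihedral_coeffs a b n)"
  proof (induction n)
    case 0 then show ?case using ab by simp
  next
    case (Suc n)
    define x y u v where "x = fst (dihedral_coeffs a b n)" and "y = snd (dihedral_coeffs a b n)"
      and "u = (if even n then b else a)" and "v = (if even n then a else b)"
    have uv: "u \<ge> 0" "v \<ge> 0" "u * v \<ge> 4" using ab True by (auto simp: u_def v_def mult.commute)
    have IH: "0 \<le> y" "2 * y \<le> u * x" using Suc by (auto simp: x_def y_def u_def)
    have "u \<noteq> 0" using uv by auto
    then have "u > 0" using uv by simp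
    then have x: "x \<ge> 0" using IH by (metis dual_order.trans mult_nonneg_nonneg zero_le_mult_iff zero_le_numeral not_less)
    have "v * (2 * y) \<le> v * (u * x)" using IH uv by (intro mult_left_mono)
    moreover have "4 * x \<le> (u * v) * x" using uv x by (intro mult_right_mono)
    ultimately have "2 * x \<le> v * (u * x - y)" by (simp add: algebra_simps)
    then show ?case using x by (simp add: x_def[symmetric] y_def[symmetric] u_def[symmetric] v_def[symmetric]) (simp add: u_def v_def split: if_splits)
  qed
  moreover have "a > 0" "b > 0" using True ab by (auto simp: order_le_less)
  ultimately show ?thesis
    by (smt (verit) mult_less_0_iff)
next
  case False
  have "a \<le> 3 \<and> b \<le> 3"
  proof -
    have "a \<le> a * b" "b \<le> a * b" if "a > 0" "b > 0" using that by (simp_all add: mult_le_cancel_left1 mult_le_cancel_right1)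
    then show ?thesis using False ab by linarith
  qed
  then have "a \<in> {0,1,2,3}" "b \<in> {0,1,2,3}" using ab by auto
  then have "(a, b) \<in> {(0,0),(1,1),(1,2),(2,1),(1,3),(3,1)}" using False ab by auto
  then have "\<exists>K. dihedral_coeffs a b K = (0, 1) \<and> (\<forall>k\<in>{..K}. fst (dihedral_coeffs a b k) \<ge> 0 \<and> snd (dihedral_coeffs a b k) \<ge> 0)"
  proof (elim insertE; (elim emptyE)?)
    \<comment> \<open>These are the Weyl groups of types \<open>A\<^sub>1 \<times> A\<^sub>1\<close>, \<open>A\<^sub>2\<close>, \<open>B\<^sub>2\<close> and \<open>G\<^sub>2\<close>.\<close>
    assume "(a, b) = (0, 0)" then show ?thesis by (intro exI[of _ "Suc 0"]) (simp add: atMost_Suc)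
  next
    assume "(a, b) = (1, 1)" then show ?thesis by (intro exI[of _ "Suc (Suc 0)"]) (simp add: atMost_Suc)
  next
    assume "(a, b) = (1, 2)" then show ?thesis by (intro exI[of _ "Suc (Suc (Suc 0))"]) (simp add: atMost_Suc)
  next
    assume "(a, b) = (2, 1)" then show ?thesis by (intro exI[of _ "Suc (Suc (Suc 0))"]) (simp add: atMost_Suc)
  next
    assume "(a, b) = (1, 3)" then show ?thesis by (intro exI[of _ "Suc (Suc (Suc (Suc (Suc 0))))"]) (simp add: atMost_Suc)
  next
    assume "(a, b) = (3, 1)" then show ?thesis by (intro exI[of _ "Suc (Suc (Suc (Suc (Suc 0))))"]) (simp add: atMost_Suc)
  qed
  then obtain K where K: "dihedral_coeffs a b K = (0, 1)"
    "\<And>k. k \<le> K \<Longrightarrow> fst (dihedral_coeffs a b k) \<ge> 0 \<and> snd (dihedral_coeffs a b k) \<ge> 0" by auto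
  then show ?thesis by (cases "n \<le> K") auto
qed

lemma alt_snoc: "\<exists>z. alt s t (Suc n) = z @ [t] \<and> length z = n \<and> set z \<subseteq> {s, t}"
proof (induction n)
  case (Suc n)
  then obtain z where "alt s t (Suc n) = z @ [t]" "length z = n" "set z \<subseteq> {s, t}" by blast
  then show ?case by (intro exI[of _ "(if even (Suc n) then t else s) # z"]) auto
qed simp

lemma length_alt [simp]: "length (alt s t n) = n"
  by (induction n) auto

lemma set_alt: "set (alt s t n) \<subseteq> {s, t}"
  by (induction n) auto

lemma alt_split: "k \<le> n \<Longrightarrow> \<exists>z. alt s t n = z @ alt s t k \<and> length z = n - k \<and> set z \<subseteq> {s, t}"
proof (induction n)
  case (Suc n)
  show ?case
  proof (cases "k = Suc n")
    case False
    with Suc obtain z where "alt s t n = z @ alt s t k" "length z = n - k" "set z \<subseteq> {s, t}" by auto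
    with False Suc.prems show ?thesis by (intro exI[of _ "(if even n then t else s) # z"]) auto
  qed (auto intro: exI[of _ "[]"])
qed simp

context cartan_lattice
begin

lemma alt_act:
  assumes "s \<in> I" "t \<in> I" "s \<noteq> t"
  defines "c \<equiv> dihedral_coeffs (- A s t) (- A t s)"
  shows "act (alt s t n) (simple s) =
    (\<lambda>j. (if even n then fst (c n) else snd (c n)) * simple s j + (if even n then snd (c n) else fst (c n)) * simple t j)"
proof (induction n)
  case 0
  then show ?case by (simp add: c_def)
next
  case (Suc n)
  have lin: "coroot i (\<lambda>j. p * simple s j + q * simple t j) = p * A i s + q * A i t" for i p q
    using coroot_diff[of i "\<lambda>j. p * simple s j" "-q" "simple t"]
      coroot_diff[of i "\<lambda>j. 0 * simple s j" "-p" "simple s"] coroot_simple[OF assms(1), of i]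
      coroot_simple[OF assms(2), of i] coroot_diff[of i "simple s" 1 "simple s"] by simp
  have lin': "coroot i (\<lambda>j. q * simple t j + p * simple s j) = q * A i t + p * A i s" for i p q
    using lin[of i p q] by (simp add: add.commute)
  define x y where "x = fst (c n)" and "y = snd (c n)"
  have c: "fst (c (Suc n)) = (if even n then - A t s else - A s t) * x - y" "snd (c (Suc n)) = x"
    by (simp_all add: c_def x_def y_def)
  show ?case unfolding c alt.simps act_simps Suc.IH x_def[symmetric] y_def[symmetric] srefl_def
    using assms(1,2) by (cases "even n") (simp_all add: lin lin' A_diag fun_eq_iff algebra_simps)
qed

text \<open>As long as the coefficients are nonnegative the first alternative holds. Before a sign change the
  image of \<open>\<alpha>\<^sub>s\<close> is the simple root whose reflection comes next; applying that reflection is then the same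
  as applying \<open>s\<close> first, and two letters cancel.\<close>

lemma dihedral_root:
  assumes st: "s \<in> I" "t \<in> I" "s \<noteq> t"
  shows "(\<exists>p q. p \<ge> 0 \<and> q \<ge> 0 \<and> act (alt s t n) (simple s) = (\<lambda>j. p * simple s j + q * simple t j)) \<or>
    (\<exists>z. length z < n \<and> set z \<subseteq> {s, t} \<and> (\<forall>x. act (alt s t n) (srefl s x) = act z x))"
proof -
  define c where "c = dihedral_coeffs (- A s t) (- A t s)"
  have "A s t = 0 \<longleftrightarrow> A t s = 0"
    using A_symmetrizable[OF st(1,2)] D_pos[OF st(1)] D_pos[OF st(2)] by auto
  then have "(fst (c n) \<ge> 0 \<and> snd (c n) \<ge> 0) \<or> (\<exists>k<n. c k = (0, 1))"
    unfolding c_def using A_off_diag[of s t] A_off_diag[of t s] st by (intro dihedral_coeffs_nonneg) auto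
  then show ?thesis
  proof
    assume "fst (c n) \<ge> 0 \<and> snd (c n) \<ge> 0"
    then show ?thesis using alt_act[OF st, of n] unfolding c_def[symmetric]
      by (intro disjI1 exI[of _ "if even n then fst (c n) else snd (c n)"] exI[of _ "if even n then snd (c n) else fst (c n)"]) simp
  next
    assume "\<exists>k<n. c k = (0, 1)"
    then obtain k where k: "k < n" "c k = (0, 1)" by blast
    define u where "u = (if even k then t else s)"
    have ks: "set (alt s t k) \<subseteq> I" using set_alt[of s t k] st by auto
    have "act (alt s t k) (simple s) = simple u"
      using alt_act[OF st, of k] k unfolding c_def[symmetric] by (auto simp: u_def)
    then have "srefl u x = act (alt s t k @ s # rev (alt s t k)) x" for x
      using refl_act[OF ks st(1)] refl_simple[of u] st by (simp add: u_def split: if_splits)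
    then have *: "act (alt s t (Suc k)) (srefl s x) = act (alt s t k) x" for x
      using st ks by (simp add: u_def[symmetric])
    obtain z where z: "alt s t n = z @ alt s t (Suc k)" "length z = n - Suc k" "set z \<subseteq> {s, t}"
      using alt_split[of "Suc k" n s t] k by auto
    have "act (alt s t n) (srefl s x) = act (z @ alt s t k) x" for x
      unfolding z(1) act_simps(3) * ..
    moreover have "set (z @ alt s t k) \<subseteq> {s, t}" using z set_alt[of s t k] by auto
    ultimately show ?thesis using z k by (intro disjI2 exI[of _ "z @ alt s t k"]) auto
  qed
qed

text \<open>Two equal neighbouring letters cancel.\<close>

lemma alternating_or_shorter:
  assumes "s \<in> I" "t \<in> I" and "set u \<subseteq> {s, t}"
  shows "(\<exists>v. set v \<subseteq> {s, t} \<and> act v = act u \<and> length v < length u) \<or>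
    u = alt s t (length u) \<or> u = alt t s (length u)"
  using assms(3)
proof (induction u)
  case (Cons x u)
  then have x: "x = s \<or> x = t" and u: "set u \<subseteq> {s, t}" by auto
  from Cons.IH[OF u] consider v where "set v \<subseteq> {s, t}" "act v = act u" "length v < length u"
    | "u = alt s t (length u)" | "u = alt t s (length u)" by blast
  then show ?case
  proof cases
    case 1
    have "act (x # v) = act (x # u)" by (rule ext) (simp add: 1(2))
    moreover have "set (x # v) \<subseteq> {s, t}" "length (x # v) < length (x # u)" using 1(1,3) x by auto
    ultimately show ?thesis by blast
  next
    case 2
    then obtain n where n: "u = alt s t n" by blast
    show ?thesis
    proof (cases "n = 0 \<or> x = (if even n then t else s)")
      case True
      then have "x # u = alt s t (Suc n) \<or> x # u = alt t s (Suc n)" using n x by auto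
      moreover have "length (x # u) = Suc n" using n by simp
      ultimately show ?thesis by metis
    next
      case False
      then obtain m where m: "n = Suc m" by (cases n) auto
      with False n x have *: "u = x # alt s t m" by (auto split: if_splits)
      then have "act (x # u) = act (alt s t m)" using x assms(1,2) by (intro ext) auto
      with * set_alt[of s t m] show ?thesis by (intro disjI1 exI[of _ "alt s t m"]) auto
    qed
  next
    case 3
    then obtain n where n: "u = alt t s n" by blast
    show ?thesis
    proof (cases "n = 0 \<or> x = (if even n then s else t)")
      case True
      then have "x # u = alt s t (Suc n) \<or> x # u = alt t s (Suc n)" using n x by auto
      moreover have "length (x # u) = Suc n" using n by simp
      ultimately show ?thesis by metis
    next
      case False
      then obtain m where m: "n = Suc m" by (cases n) auto
      with False n x have *: "u = x # alt t s m" by (auto split: if_splits)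
      then have "act (x # u) = act (alt t s m)" using x assms(1,2) by (intro ext) auto
      with * set_alt[of t s m] show ?thesis by (intro disjI1 exI[of _ "alt t s m"]) auto
    qed
  qed
qed simp

text \<open>The Coxeter length, in the group of linear maps generated by the simple reflections.\<close>

definition len :: "(('i \<Rightarrow> int) \<Rightarrow> 'i \<Rightarrow> int) \<Rightarrow> nat" where
  "len f = (LEAST n. \<exists>ws. set ws \<subseteq> I \<and> length ws = n \<and> act ws = f)"

lemma len_le: "set ws \<subseteq> I \<Longrightarrow> len (act ws) \<le> length ws"
  unfolding len_def by (rule Least_le) auto

lemma reduced_word:
  assumes "set ws \<subseteq> I"
  obtains vs where "set vs \<subseteq> I" "act vs = act ws" "length vs = len (act ws)"
proof -
  have "\<exists>vs. set vs \<subseteq> I \<and> length vs = len (act ws) \<and> act vs = act ws"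
    unfolding len_def by (rule LeastI_ex) (use assms in auto)
  with that show ?thesis by blast
qed

lemma act_eqI: "act vs = act ws \<Longrightarrow> act vs' = act ws' \<Longrightarrow> act (vs @ vs') = act (ws @ ws')"
  by (rule ext) simp

lemma len_append:
  assumes "set vs \<subseteq> I" "set ws \<subseteq> I"
  shows "len (act (vs @ ws)) \<le> len (act vs) + length ws"
proof -
  obtain us where "set us \<subseteq> I" "act us = act vs" "length us = len (act vs)" using reduced_word assms by blast
  with assms show ?thesis using len_le[of "us @ ws"] act_eqI[of us vs ws ws] by simp
qed

text \<open>The positivity theorem for reflection groups, by induction on the length of \<open>w\<close>. A reduced word of
  \<open>w\<close> ends in some \<open>t \<noteq> s\<close>. Write \<open>w = v u\<close> with \<open>u\<close> a word in \<open>s\<close> and \<open>t\<close>, lengths adding up, and \<open>v\<close>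
  as short as possible. Then neither \<open>s\<close> nor \<open>t\<close> shortens \<open>v\<close>, so \<open>v \<alpha>\<^sub>s\<close> and \<open>v \<alpha>\<^sub>t\<close> have nonnegative
  coefficients by induction, and the dihedral case applies to \<open>u\<close>.\<close>

theorem simple_root_nonneg:
  assumes "set w \<subseteq> I" "s \<in> I" "len (act w) \<le> len (act (w @ [s]))"
  shows "act w (simple s) j \<ge> 0"
  using assms
proof (induction "len (act w)" arbitrary: w s j rule: less_induct)
  case less
  obtain r where r: "set r \<subseteq> I" "act r = act w" "length r = len (act w)" using reduced_word less.prems(1) by blast
  show ?case
  proof (cases r rule: rev_exhaust)
    case Nil
    then have "act w (simple s) = simple s" using r(2)[symmetric] by simp
    then show ?thesis by (simp add: simple_def)
  next
    case (snoc r' t)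
    have t: "t \<in> I" "set r' \<subseteq> I" using r snoc by auto
    have "s \<noteq> t"
    proof
      assume "s = t"
      then have "act (w @ [s]) = act r'" using r(2)[symmetric] snoc t by (simp add: fun_eq_iff)
      then have "len (act (w @ [s])) \<le> length r'" using len_le[OF t(2)] by simp
      with less.prems(3) r(3) snoc show False by simp
    qed
    define Fac where "Fac v \<longleftrightarrow> set v \<subseteq> I \<and> (\<exists>u. set u \<subseteq> {s, t} \<and> act (v @ u) = act w \<and> len (act v) + length u = len (act w))" for v
    have "len (act w) \<le> len (act r') + 1" using len_append[of r' "[t]"] t r(2) snoc by simp
    then have "len (act r') + 1 = len (act w)" using len_le[OF t(2)] r(3) snoc by simp
    then have "Fac r'" unfolding Fac_def using t r snoc by (auto intro!: exI[of _ "[t]"])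
    then obtain v where v: "Fac v" and v_min: "\<And>v'. Fac v' \<Longrightarrow> len (act v) \<le> len (act v')"
      using ex_has_least_nat[of Fac r' "\<lambda>v. len (act v)"] by blast
    then obtain u where vI: "set v \<subseteq> I" and u: "set u \<subseteq> {s, t}" "act (v @ u) = act w" "len (act v) + length u = len (act w)"
      unfolding Fac_def by blast
    have "len (act v) < len (act w)" using v_min[OF \<open>Fac r'\<close>] \<open>len (act r') + 1 = len (act w)\<close> by simp
    have uI: "set u \<subseteq> I" using u less.prems(2) t by auto
    have min: "length u \<le> length u'" if "act u' = act u" "set u' \<subseteq> {s, t}" for u'
    proof -
      have "set u' \<subseteq> I" using that less.prems(2) t by auto
      then have "len (act w) \<le> len (act v) + length u'"
        using len_append[OF vI, of u'] act_eqI[OF HOL.refl, of u' u v] that(1) u(2) by simp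
      with u(3) show ?thesis by simp
    qed
    have v_nonneg: "act v (simple a) j \<ge> 0" if a: "a \<in> {s, t}" for a j
    proof -
      have aI: "a \<in> I" using a less.prems(2) t by auto
      have "len (act v) \<le> len (act (v @ [a]))"
      proof (rule ccontr)
        assume neg: "\<not> ?thesis"
        have eq: "act ((v @ [a]) @ (a # u)) = act w" unfolding u(2)[symmetric] using aI by (simp add: fun_eq_iff)
        have "len (act w) \<le> len (act (v @ [a])) + length (a # u)"
          using len_append[of "v @ [a]" "a # u"] vI aI uI eq by simp
        with neg u(3) have "len (act (v @ [a])) + length (a # u) = len (act w)" by simp
        with eq have "Fac (v @ [a])" unfolding Fac_def using vI aI a u(1) by (intro conjI exI[of _ "a # u"]) auto
        from v_min[OF this] neg show False by simp
      qed
      from less.hyps[OF \<open>len (act v) < len (act w)\<close> vI aI this] show ?thesis .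
    qed
    have ws: "act (w @ [s]) = act (v @ z)" if "\<And>x. act u (srefl s x) = act z x" for z
    proof (rule ext)
      fix x show "act (w @ [s]) x = act (v @ z) x" using fun_cong[OF u(2), of "srefl s x"] that by simp
    qed
    have no_short: "\<not> (length z < length u \<and> set z \<subseteq> {s, t} \<and> (\<forall>x. act u (srefl s x) = act z x))" for z
    proof
      assume z: "length z < length u \<and> set z \<subseteq> {s, t} \<and> (\<forall>x. act u (srefl s x) = act z x)"
      then have "len (act (w @ [s])) \<le> len (act v) + length z"
        using ws[of z] len_append[of v z] vI less.prems(2) t by auto
      with z u(3) less.prems(3) show False by simp
    qed
    have "u = alt s t (length u)"
    proof (rule ccontr)
      assume no: "\<not> ?thesis"
      then have alt: "u = alt t s (length u)"
        using alternating_or_shorter[OF less.prems(2) t(1) u(1)] min by (metis not_less)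
      with no obtain n where n: "length u = Suc n" by (cases "length u") auto
      obtain z where "u = z @ [s]" "length z = n" "set z \<subseteq> {s, t}"
        using alt_snoc[of t s n] alt n by auto
      with no_short[of z] n less.prems(2) show False by simp
    qed
    then obtain p q where pq: "p \<ge> 0" "q \<ge> 0" "act u (simple s) = (\<lambda>j. p * simple s j + q * simple t j)"
      using dihedral_root[OF less.prems(2) t(1) \<open>s \<noteq> t\<close>, of "length u"] no_short by metis
    have "act w (simple s) j = act v (\<lambda>j. p * simple s j - (- q) * simple t j) j"
      using fun_cong[OF u(2), of "simple s"] pq(3) by simp
    also have "\<dots> = p * act v (simple s) j + q * act v (simple t) j"
      unfolding act_diff act_scale by simp
    finally show ?thesis using pq v_nonneg by simp
  qed
qed

lemma root_pos_or_neg: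
  assumes "root b" shows "pos b \<or> neg b"
proof -
  from assms obtain ws i where b: "set ws \<subseteq> I" "i \<in> I" "b = act ws (simple i)" unfolding root_def by blast
  have "\<exists>k\<in>I. b k \<noteq> 0"
  proof (rule ccontr)
    assume "\<not> ?thesis"
    then have "form b b = 0" by (simp add: form_def)
    with form_root_pos[OF assms] show False by simp
  qed
  then obtain k where k: "k \<in> I" "b k \<noteq> 0" by blast
  show ?thesis
  proof (cases "len (act ws) \<le> len (act (ws @ [i]))")
    case True
    then have nn: "b j \<ge> 0" for j unfolding b(3) by (rule simple_root_nonneg[OF b(1,2)])
    with k have "b k > 0" by (simp add: order_less_le)
    with nn k show ?thesis unfolding pos_def by blast
  next
    case False
    have "act ((ws @ [i]) @ [i]) = act ws" using b(2) by (simp add: fun_eq_iff)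
    with False have "len (act (ws @ [i])) \<le> len (act ((ws @ [i]) @ [i]))" by simp
    from simple_root_nonneg[OF _ b(2) this] b(1,2) have "act (ws @ [i]) (simple i) j \<ge> 0" for j by simp
    moreover have "act (ws @ [i]) (simple i) = (\<lambda>j. - b j)"
      using b(2) unfolding b(3) by (simp add: srefl_simple act_minus)
    ultimately have nn: "- b j \<ge> 0" for j by simp
    with k have "- b k > 0" by (metis neg_equal_0_iff_equal order_less_le)
    with nn k show ?thesis unfolding pos_def by blast
  qed
qed

lemma not_pos_neg: "pos b \<Longrightarrow> \<not> neg b"
  unfolding pos_def by (metis neg_0_le_iff_le not_less)

section \<open>Lowering peaks\<close>

lemma pos_root_iff: "root b \<Longrightarrow> \<not> pos b \<longleftrightarrow> neg b"
  using root_pos_or_neg not_pos_neg by blast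

text \<open>A positive root other than \<open>\<alpha>\<^sub>i\<close> has a positive coefficient at a further index, because roots are
  primitive, and that coefficient survives the reflection.\<close>

lemma srefl_pos:
  assumes "root b" "pos b" "i \<in> I" "b \<noteq> simple i"
  shows "pos (srefl i b)"
proof -
  have "\<exists>k\<in>I. k \<noteq> i \<and> b k > 0"
  proof (rule ccontr)
    assume no: "\<not> ?thesis"
    have "b k = 0" if "k \<noteq> i" for k
      using no that assms(2) root_outside[OF assms(1), of k] unfolding pos_def by (metis order_less_le)
    then have eq: "1 * b j = b i * simple i j" for j by (simp add: simple_def)
    have "b i > 0" using no assms(2) unfolding pos_def by metis
    with root_proportional[OF assms(1) root_simple[OF assms(3)] _ _ eq] assms(4) show False by simp
  qed
  then obtain k where "k \<in> I" "k \<noteq> i" "b k > 0" by blast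
  then have "srefl i b k > 0" by (simp add: srefl_def simple_def)
  then have "\<not> neg (srefl i b)" unfolding pos_def by (metis neg_0_le_iff_le not_less)
  moreover have "root (srefl i b)" using root_act[OF assms(1), of "[i]"] assms(3) by simp
  ultimately show ?thesis using root_pos_or_neg by blast
qed

definition inversions :: "(('i \<Rightarrow> int) \<Rightarrow> 'i \<Rightarrow> int) \<Rightarrow> ('i \<Rightarrow> int) set" where
  "inversions f = {b. root b \<and> pos b \<and> neg (f b)}"

text \<open>A further simple reflection in front adds at most one inversion, by \<open>srefl_pos\<close>.\<close>

lemma finite_inversions: "set ws \<subseteq> I \<Longrightarrow> finite (inversions (act ws))"
proof (induction ws)
  case Nil
  then show ?case using not_pos_neg by (simp add: inversions_def) (metis (lifting) Collect_empty_eq finite.emptyI)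
next
  case (Cons i ws)
  have "inversions (act (i # ws)) \<subseteq> insert (act (rev ws) (simple i)) (inversions (act ws))"
  proof
    fix b assume "b \<in> inversions (act (i # ws))"
    then have b: "root b" "pos b" "neg (srefl i (act ws b))" by (auto simp: inversions_def)
    have r: "root (act ws b)" using root_act b(1) Cons.prems by auto
    show "b \<in> insert (act (rev ws) (simple i)) (inversions (act ws))"
    proof (cases "act ws b = simple i")
      case True
      then have "b = act (rev ws) (simple i)" using Cons.prems act_rev(2)[of ws b] by auto
      then show ?thesis by simp
    next
      case False
      then have "\<not> pos (act ws b)" using srefl_pos[OF r _ _ False] b(3) not_pos_neg Cons.prems by auto
      then show ?thesis using b r pos_root_iff by (auto simp: inversions_def)
    qed
  qed
  moreover have "finite (inversions (act ws))" using Cons by simp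
  ultimately show ?case by (blast intro: finite_subset)
qed

definition rho :: "'i \<Rightarrow> int" where
  "rho = (SOME x. \<forall>i\<in>I. coroot i x > 0)"

lemma coroot_rho: "i \<in> I \<Longrightarrow> coroot i rho > 0"
  using someI_ex[of "\<lambda>x. \<forall>i\<in>I. coroot i x > 0"] ex_dominant by (simp add: rho_def coroot_def)

lemma cor_rho_pos:
  assumes "root b" "pos b" shows "cor b rho > 0"
proof -
  obtain i where i: "i \<in> I" "b i > 0" using assms(2) by (auto simp: pos_def)
  have "form b rho > 0" unfolding form_def
  proof (rule sum_pos2[OF finite_I i(1)])
    show "0 < b i * D i * coroot i rho" using i D_pos coroot_rho by simp
    show "0 \<le> b j * D j * coroot j rho" if "j \<in> I" for j
      using that assms(2) D_pos[OF that] coroot_rho[OF that] by (simp add: pos_def)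
  qed
  then have "cor b rho * form b b > 0" using cor_form[OF assms(1), of rho] by (simp add: form_commute)
  then show ?thesis using form_root_pos[OF assms(1)] by (simp add: zero_less_mult_iff)
qed

lemma cor_rho_neg: "root b \<Longrightarrow> neg b \<Longrightarrow> cor b rho < 0"
  using cor_rho_pos[OF root_uminus] by (simp add: cor_uminus)

lemma ht_diff: "ht (\<lambda>j. x j - k * y j) = ht x - k * ht y"
  by (simp add: ht_def sum_subtractf sum_distrib_left)

lemma ht_pos: "pos x \<Longrightarrow> ht x > 0"
  unfolding pos_def ht_def using finite_I by (metis sum_pos2)

lemma ht_neg: "neg x \<Longrightarrow> ht x < 0"
  using ht_pos[of "\<lambda>j. - x j"] by (simp add: ht_def sum_negf)

text \<open>The height of \<open>\<rho> - w \<rho>\<close> up to an additive constant. Multiplying \<open>w\<close> from the right by the reflection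
  in a positive root \<open>b\<close> raises it exactly if \<open>w b\<close> is positive (\<open>depth_refl\<close>), so it is increasing in the
  Bruhat order; unlike the length it changes by an explicit amount.\<close>

definition depth :: "(('i \<Rightarrow> int) \<Rightarrow> 'i \<Rightarrow> int) \<Rightarrow> int" where
  "depth f = - ht (f rho)"

text \<open>Along a reduced word, every letter subtracts a nonnegative multiple of a positive root from \<open>\<rho>\<close>.\<close>

lemma act_rho_le: "set ws \<subseteq> I \<Longrightarrow> act ws rho j \<le> rho j"
proof (induction "len (act ws)" arbitrary: ws rule: less_induct)
  case less
  obtain r where r: "set r \<subseteq> I" "act r = act ws" "length r = len (act ws)" using reduced_word less.prems by blast
  show ?case
  proof (cases r rule: rev_exhaust)
    case Nil
    then show ?thesis using fun_cong[OF r(2), of rho] by simp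
  next
    case (snoc r' i)
    then have i: "i \<in> I" "set r' \<subseteq> I" using r by auto
    have l: "len (act r') < len (act ws)" using len_le[OF i(2)] r(3) snoc by simp
    then have "len (act r') \<le> len (act (r' @ [i]))" using r(2) snoc by simp
    from simple_root_nonneg[OF i(2,1) this] have "act r' (simple i) j \<ge> 0" .
    moreover have "act ws rho j = act r' rho j - coroot i rho * act r' (simple i) j"
      using fun_cong[OF fun_cong[OF r(2), of rho], of j] snoc by (simp add: srefl_def act_diff)
    ultimately show ?thesis using less.hyps[OF l i(2)] coroot_rho[OF i(1)]
      by (smt (verit) mult_nonneg_nonneg)
  qed
qed

lemma depth_ge: "set ws \<subseteq> I \<Longrightarrow> depth (act ws) \<ge> - ht rho"
  using act_rho_le by (simp add: depth_def ht_def sum_mono)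

lemma depth_refl: "linear f \<Longrightarrow> depth (\<lambda>x. f (refl b x)) = depth f + cor b rho * ht (f b)"
  by (simp add: depth_def refl_def linear_def ht_diff)

text \<open>The root \<open>- refl b c\<close> forms with \<open>b\<close> a pair with the same product of reflections as the pair of \<open>b\<close> and
  \<open>c\<close>; this is a Hurwitz move followed by a change of sign.\<close>

lemma rotate_root:
  assumes b: "root b" and c: "root c"
  shows "root (\<lambda>j. cor b c * b j - c j)"
    and "refl (\<lambda>j. cor b c * b j - c j) (refl b x) = refl b (refl c x)"
    and "cor (\<lambda>j. cor b c * b j - c j) x = cor c b * cor b x - cor c x"
proof -
  have eq: "(\<lambda>j. cor b c * b j - c j) = (\<lambda>j. - refl b c j)" by (simp add: refl_def)
  have r: "root (refl b c)" using b c by (rule root_refl)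
  show "root (\<lambda>j. cor b c * b j - c j)" unfolding eq by (rule root_uminus[OF r])
  show "refl (\<lambda>j. cor b c * b j - c j) (refl b x) = refl b (refl c x)"
    unfolding eq using b c r by (simp add: refl_uminus refl_conj)
  have "cor (\<lambda>j. cor b c * b j - c j) x = - cor c (refl b x)"
    unfolding eq using b c r by (simp add: cor_uminus cor_refl_root)
  then show "cor (\<lambda>j. cor b c * b j - c j) x = cor c b * cor b x - cor c x"
    using c by (simp add: refl_def cor_diff)
qed

text \<open>Suppose that \<open>w\<close> is a peak between the reflections in \<open>b\<close> and \<open>c\<close> which neither Hurwitz move lowers.
  Writing \<open>p, q\<close> for the values of the coroots of \<open>b, c\<close> at \<open>\<rho>\<close>, and \<open>u, v\<close> for the heights of \<open>- w b, - w c\<close>,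
  the two assumptions on depths read \<open>pu + qv \<le> qmu\<close> and \<open>pu + qv \<le> pnv\<close>, with \<open>m, n\<close> the two Cartan integers
  of \<open>b\<close> and \<open>c\<close>. Multiplying them and comparing arithmetic and geometric means gives \<open>mn \<ge> 4\<close>. The
  second one alone shows that the rotated root is positive, the first one that \<open>w\<close> makes it negative.\<close>

lemma minimal_peak_rotates:
  assumes ws: "set ws \<subseteq> I" and bc: "b \<in> inversions (act ws)" "c \<in> inversions (act ws)" "b \<noteq> c"
    and le: "depth (act ws) \<le> depth (\<lambda>x. act ws (refl b (refl c x)))"
      "depth (act ws) \<le> depth (\<lambda>x. act ws (refl c (refl b x)))"
  shows "cor b c * cor c b \<ge> 4" "cor b c > 0" "cor c b > 0"
    and "(\<lambda>j. cor b c * b j - c j) \<in> inversions (act ws)" "(\<lambda>j. cor b c * b j - c j) \<noteq> b"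
proof -
  define p q u v m n where "p = cor b rho" and "q = cor c rho" and "u = - ht (act ws b)" and "v = - ht (act ws c)"
    and "m = cor b c" and "n = cor c b"
  have b: "root b" "pos b" "neg (act ws b)" and c: "root c" "pos c" "neg (act ws c)"
    using bc by (auto simp: inversions_def)
  have pos: "p > 0" "q > 0" "u > 0" "v > 0"
    using cor_rho_pos[OF b(1,2)] cor_rho_pos[OF c(1,2)] ht_neg[OF b(3)] ht_neg[OF c(3)] by (auto simp: p_def q_def u_def v_def)
  have lin: "linear (\<lambda>x. act ws (refl b x))" if "root b" for b
    using linear_comp[OF linear_act linear_refl[OF that]] .
  have "depth (\<lambda>x. act ws (refl b (refl c x))) = depth (act ws) - p * u + q * ht (act ws (refl b c))"
    using depth_refl[OF lin[OF b(1)], of c] depth_refl[OF linear_act, of ws b] by (simp add: p_def q_def u_def)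
  also have "ht (act ws (refl b c)) = m * u - v"
    by (simp add: refl_def act_diff ht_diff m_def u_def v_def)
  finally have 1: "p * u + q * v \<le> q * (m * u)" using le(1) by (simp add: algebra_simps)
  have "depth (\<lambda>x. act ws (refl c (refl b x))) = depth (act ws) - q * v + p * ht (act ws (refl c b))"
    using depth_refl[OF lin[OF c(1)], of b] depth_refl[OF linear_act, of ws c] by (simp add: p_def q_def v_def)
  also have "ht (act ws (refl c b)) = n * v - u"
    by (simp add: refl_def act_diff ht_diff n_def u_def v_def)
  finally have 2: "p * u + q * v \<le> p * (n * v)" using le(2) by (simp add: algebra_simps)
  have pu: "p * u > 0" "q * v > 0" using pos by simp_all
  have "q * (m * u) > 0" "p * (n * v) > 0" using 1 2 pu by linarith+
  then show m: "cor b c > 0" and n: "cor c b > 0"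
    using pos unfolding m_def[symmetric] n_def[symmetric] by (simp_all add: zero_less_mult_iff)
  have "q * v < q * (m * u)" "q * v < p * (n * v)" using 1 2 pu by linarith+
  then have 3: "v < m * u" and "q * v < (p * n) * v" using pos by (simp_all add: mult.assoc)
  then have 4: "q < p * n" using pos by (simp only: mult_less_cancel_right)
  have "4 * (p * u) * (q * v) \<le> (p * u + q * v)\<^sup>2"
    using zero_le_power2[of "p * u - q * v"] by (simp add: power2_eq_square algebra_simps)
  also have "\<dots> \<le> (q * (m * u)) * (p * (n * v))"
    unfolding power2_eq_square using 1 2 pu by (intro mult_mono) auto
  finally have "4 * (p * u * (q * v)) \<le> (m * n) * (p * u * (q * v))" by (simp add: algebra_simps)
  then show "cor b c * cor c b \<ge> 4" using pu unfolding m_def[symmetric] n_def[symmetric]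
    by (metis mult_le_cancel_right_pos mult_pos_pos)
  let ?e = "\<lambda>j. cor b c * b j - c j"
  note rot = rotate_root[OF b(1) c(1)]
  have "cor ?e rho > 0" using 4 unfolding rot(3) by (simp add: p_def q_def n_def mult.commute)
  then have e_pos: "pos ?e" using cor_rho_neg[OF rot(1)] root_pos_or_neg[OF rot(1)] by force
  have "act ws ?e = (\<lambda>j. - (act ws c j - m * act ws b j))"
    using act_minus[of ws "\<lambda>j. c j - m * b j"] by (simp add: act_diff m_def)
  then have "ht (act ws ?e) = - (ht (act ws c) - m * ht (act ws b))"
    by (simp add: ht_def sum_subtractf sum_distrib_left)
  then have "ht (act ws ?e) < 0" using 3 by (simp add: u_def v_def)
  then have "neg (act ws ?e)" using ht_pos[of "act ws ?e"] root_pos_or_neg[OF root_act[OF rot(1) ws]] by force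
  with e_pos rot(1) show "?e \<in> inversions (act ws)" by (simp add: inversions_def)
  show "?e \<noteq> b"
  proof
    assume "?e = b"
    then have eq: "(m - 1) * b j = 1 * c j" for j
      using fun_cong[of ?e b j] by (simp add: m_def left_diff_distrib)
    obtain k where "b k > 0" "c k \<ge> 0" using b(2) c(2) by (auto simp: pos_def)
    obtain l where "b l \<ge> 0" "c l > 0" using b(2) c(2) by (auto simp: pos_def)
    then have "0 < (m - 1) * b l" "b l \<ge> 0" using eq[of l] by simp_all
    then have "m - 1 > 0" by (simp only: zero_less_mult_iff) auto
    from root_proportional[OF b(1) c(1) this _ eq] bc(3) show False by simp
  qed
qed

text \<open>Otherwise \<open>minimal_peak_rotates\<close> applies again and again, in both directions, to pairs of inversions
  of \<open>w\<close> with a fixed product. Two steps to the left and two steps to the right lead from \<open>b'\<close> to roots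
  \<open>v2\<close> and \<open>v1\<close> with \<open>v1 + v2 = (kl - 2) b'\<close> and \<open>kl - 2 \<ge> 2\<close>, so \<open>b'\<close> cannot have the largest
  Euclidean norm among the finitely many roots met, unless \<open>v1 = v2 = b'\<close>. In that case \<open>b'\<close> and \<open>c'\<close>
  are proportional.\<close>

theorem no_peak:
  assumes ws: "set ws \<subseteq> I" and bc: "b \<in> inversions (act ws)" "c \<in> inversions (act ws)" "b \<noteq> c"
  shows "depth (\<lambda>x. act ws (refl b (refl c x))) < depth (act ws) \<or>
    depth (\<lambda>x. act ws (refl c (refl b x))) < depth (act ws)"
proof (rule ccontr)
  assume contra: "\<not> ?thesis"
  let ?f = "act ws" and ?N = "inversions (act ws)"
  define S where "S = {(b', c'). b' \<in> ?N \<and> c' \<in> ?N \<and> b' \<noteq> c' \<and> (\<forall>x. refl b' (refl c' x) = refl b (refl c x))}"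
  have r: "root b'" if "b' \<in> ?N" for b' using that by (simp add: inversions_def)
  have S_le: "depth ?f \<le> depth (\<lambda>x. ?f (refl b' (refl c' x)))" "depth ?f \<le> depth (\<lambda>x. ?f (refl c' (refl b' x)))"
    if "(b', c') \<in> S" for b' c'
  proof -
    from that have s: "b' \<in> ?N" "c' \<in> ?N" "\<And>x. refl b' (refl c' x) = refl b (refl c x)" by (auto simp: S_def)
    show "depth ?f \<le> depth (\<lambda>x. ?f (refl b' (refl c' x)))" using contra by (simp add: s(3))
    have "refl c' (refl b' x) = refl c (refl b x)" for x
    proof -
      have "x = refl b' (refl c' (refl c (refl b x)))"
        unfolding s(3) using r[OF bc(1)] r[OF bc(2)] by simp
      then have "refl c' (refl b' x) = refl c' (refl b' (refl b' (refl c' (refl c (refl b x)))))"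
        by (rule arg_cong[of x _ "\<lambda>x. refl c' (refl b' x)"])
      then show ?thesis using r[OF s(1)] r[OF s(2)] by simp
    qed
    then show "depth ?f \<le> depth (\<lambda>x. ?f (refl c' (refl b' x)))" using contra by simp
  qed
  have left: "(\<lambda>j. cor b' c' * b' j - c' j, b') \<in> S" if "(b', c') \<in> S" for b' c'
    using that minimal_peak_rotates[OF ws _ _ _ S_le[OF that]] rotate_root(2)[OF r r, of b' c'] by (auto simp: S_def)
  have right: "(c', \<lambda>j. cor c' b' * c' j - b' j) \<in> S" if "(b', c') \<in> S" for b' c'
  proof -
    from that have s: "c' \<in> ?N" "b' \<in> ?N" "c' \<noteq> b'" by (auto simp: S_def)
    let ?e = "\<lambda>j. cor c' b' * c' j - b' j"
    note st = minimal_peak_rotates[OF ws s S_le(2,1)[OF that]]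
    have "refl c' (refl ?e x) = refl b' (refl c' x)" for x
      using rotate_root(2)[OF r[OF s(1)] r[OF s(2)], of "refl c' x"] r[OF s(1)] by simp
    with st(4,5) s that show ?thesis by (auto simp: S_def)
  qed
  define n where "n x = (\<Sum>i\<in>I. (x i)\<^sup>2)" for x :: "'i \<Rightarrow> int"
  have "S \<subseteq> ?N \<times> ?N" by (auto simp: S_def)
  then have "finite S" using finite_inversions[OF ws] by (meson finite_subset finite_SigmaI)
  moreover have "(b, c) \<in> S" using bc by (simp add: S_def)
  ultimately have fin: "finite ((n \<circ> fst) ` S)" "(n \<circ> fst) ` S \<noteq> {}" by auto
  from Max_in[OF this] obtain z where z: "z \<in> S" "Max ((n \<circ> fst) ` S) = n (fst z)"
    unfolding image_iff comp_apply by blast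
  obtain b' c' where bc': "z = (b', c')" by fastforce
  have s: "(b', c') \<in> S" using z bc' by simp
  have max: "n x \<le> n b'" if "(x, y) \<in> S" for x y
    using Max_ge[OF fin(1) imageI[OF that]] unfolding z(2) bc' by simp
  from s have N: "b' \<in> ?N" "c' \<in> ?N" "b' \<noteq> c'" by (auto simp: S_def)
  define k l where "k = cor b' c'" and "l = cor c' b'"
  note st = minimal_peak_rotates[OF ws N S_le[OF s], folded k_def l_def]
  define v1 where "v1 = (\<lambda>j. l * c' j - b' j)"
  define v2 where "v2 = (\<lambda>j. l * (k * b' j - c' j) - b' j)"
  have "n v1 \<le> n b'" using max[OF right[OF right[OF s]]] by (simp add: v1_def l_def)
  have "cor (\<lambda>j. k * b' j - c' j) b' = l"
    using rotate_root(3)[OF r r, OF N(1,2), of b'] r[OF N(1)] by (simp add: k_def l_def)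
  then have "n v2 \<le> n b'" using max[OF left[OF left[OF s]]] by (simp add: v2_def k_def)
  have sum: "v1 j + v2 j = (k * l - 2) * b' j" for j by (simp add: v1_def v2_def algebra_simps)
  \<comment> \<open>The parallelogram identity: maximality of \<open>b'\<close> leaves no room for \<open>v1 \<noteq> v2\<close>.\<close>
  have "n (\<lambda>j. v1 j + v2 j) + n (\<lambda>j. v1 j - v2 j) = 2 * n v1 + 2 * n v2"
    unfolding n_def sum_distrib_left sum.distrib[symmetric]
    by (rule sum.cong) (simp_all add: power2_eq_square algebra_simps)
  then have *: "n (\<lambda>j. v1 j + v2 j) + n (\<lambda>j. v1 j - v2 j) \<le> 4 * n b'" using \<open>n v1 \<le> n b'\<close> \<open>n v2 \<le> n b'\<close> by simp
  have nsum: "n (\<lambda>j. v1 j + v2 j) = (k * l - 2)\<^sup>2 * n b'"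
    unfolding sum by (simp add: n_def power_mult_distrib sum_distrib_left)
  have nn: "n x \<ge> 0" for x by (simp add: n_def sum_nonneg)
  have "(2::int)\<^sup>2 \<le> (k * l - 2)\<^sup>2" using st(1) by (intro power_mono) auto
  then have "4 * n b' \<le> (k * l - 2)\<^sup>2 * n b'" using mult_right_mono[OF _ nn] by fastforce
  with * nsum nn[of "\<lambda>j. v1 j - v2 j"] have z: "n (\<lambda>j. v1 j - v2 j) = 0" and eq: "(k * l - 2)\<^sup>2 * n b' = 4 * n b'" by linarith+
  obtain i where i: "i \<in> I" "b' i > 0" using N(1) by (auto simp: inversions_def pos_def)
  have "n b' > 0" unfolding n_def using i by (intro sum_pos2[OF finite_I i(1)]) auto
  with eq have "(k * l - 2)\<^sup>2 = 2\<^sup>2" by simp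
  then have "k * l - 2 = 2" using st(1) by (simp only: power2_eq_iff) auto
  have "v1 j = v2 j" for j
  proof (cases "j \<in> I")
    case True
    with z finite_I show ?thesis unfolding n_def by (simp add: sum_nonneg_eq_0_iff)
  next
    case False
    then show ?thesis using root_outside[OF r[OF N(1)] False] root_outside[OF r[OF N(2)] False]
      by (simp add: v1_def v2_def)
  qed
  with sum \<open>k * l - 2 = 2\<close> have "v1 j = b' j" for j by (metis mult_2 mult_cancel_left zero_neq_numeral)
  then have "2 * b' j = l * c' j" for j using fun_cong[OF v1_def, of j] by fastforce
  from root_proportional[OF r r _ st(3) this] N show False by simp
qed

end

section \<open>Hurwitz moves on affine roots\<close>

text \<open>The second component is the coefficient of a vector that all reflections fix.\<close>

type_synonym 'a aroot = "('a \<Rightarrow> int) \<times> int"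

context cartan_lattice
begin

text \<open>The reflection in the affine root \<open>b\<close>; it acts on vectors and, in the same way, on affine roots.\<close>

definition arefl :: "'i aroot \<Rightarrow> 'i aroot \<Rightarrow> 'i aroot" where
  "arefl b x = (refl (fst b) (fst x), snd x - cor (fst b) (fst x) * snd b)"

definition aneg :: "'i aroot \<Rightarrow> 'i aroot" where
  "aneg b = (\<lambda>j. - fst b j, - snd b)"

text \<open>The two elementary Hurwitz moves on a list of reflections, read off from affine roots. As \<open>b\<close> and
  \<open>aneg b\<close> define the same reflection, a change of sign is a move, too.\<close>

inductive hurwitz :: "'i aroot list \<Rightarrow> 'i aroot list \<Rightarrow> bool" for bs where
  start: "hurwitz bs bs"
| right: "hurwitz bs (xs @ b # c # ys) \<Longrightarrow> hurwitz bs (xs @ c # arefl c b # ys)"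
| left: "hurwitz bs (xs @ b # c # ys) \<Longrightarrow> hurwitz bs (xs @ arefl b c # b # ys)"
| sign: "hurwitz bs (xs @ b # ys) \<Longrightarrow> hurwitz bs (xs @ aneg b # ys)"

definition lprod :: "'i aroot list \<Rightarrow> ('i \<Rightarrow> int) \<Rightarrow> 'i \<Rightarrow> int" where
  "lprod bs = foldr (\<lambda>b. refl (fst b)) bs"

definition aprod :: "'i aroot list \<Rightarrow> 'i aroot \<Rightarrow> 'i aroot" where
  "aprod bs = foldr arefl bs"

abbreviation roots :: "'i aroot list \<Rightarrow> bool" where
  "roots bs \<equiv> \<forall>b\<in>set bs. root (fst b)"

lemma lprod_simps [simp]: "lprod [] x = x" "lprod (b # bs) x = refl (fst b) (lprod bs x)"
  "lprod (bs @ cs) x = lprod bs (lprod cs x)"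
  by (simp_all add: lprod_def)

lemma aprod_simps [simp]: "aprod [] x = x" "aprod (b # bs) x = arefl b (aprod bs x)"
  "aprod (bs @ cs) x = aprod bs (aprod cs x)"
  by (simp_all add: aprod_def)

lemma fst_arefl [simp]: "fst (arefl b x) = refl (fst b) (fst x)"
  by (simp add: arefl_def)

lemma fst_aprod: "fst (aprod bs x) = lprod bs (fst x)"
  by (induction bs) auto

lemma fst_aneg: "fst (aneg b) = (\<lambda>j. - fst b j)"
  by (simp add: aneg_def)

lemma arefl_aneg: "root (fst b) \<Longrightarrow> arefl (aneg b) x = arefl b x"
  by (simp add: arefl_def aneg_def refl_uminus cor_uminus)

lemma arefl_self: "root (fst b) \<Longrightarrow> arefl b b = aneg b"
  by (simp add: arefl_def aneg_def)

lemma arefl_arefl [simp]: "root (fst b) \<Longrightarrow> arefl b (arefl b x) = x"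
  by (simp add: arefl_def cor_refl prod_eq_iff)

lemma arefl_conj:
  assumes "root (fst b)" "root (fst c)"
  shows "arefl (arefl b c) x = arefl b (arefl c (arefl b x))"
proof -
  have eq: "cor (fst b) (refl (fst c) (refl (fst b) (fst x))) =
      - cor (fst b) (fst x) - cor (fst c) (refl (fst b) (fst x)) * cor (fst b) (fst c)"
    using assms by (subst refl_def[of "fst c"]) (simp add: cor_diff cor_refl)
  then show ?thesis using assms
    unfolding arefl_def by (simp add: refl_conj cor_refl_root eq) (simp add: algebra_simps)
qed

lemma aprod_shift:
  "aprod bs (x, m) = (fst (aprod bs (x, 0)), snd (aprod bs (x, 0)) + m)"
  by (induction bs) (auto simp: arefl_def fst_aprod)

lemma hurwitz_trans:
  assumes "hurwitz as bs" "hurwitz bs cs" shows "hurwitz as cs"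
  using assms(2) by induction (auto intro: assms(1) hurwitz.intros)

lemma hurwitz_context: "hurwitz bs cs \<Longrightarrow> hurwitz (ps @ bs @ qs) (ps @ cs @ qs)"
proof (induction rule: hurwitz.induct)
  case (right xs b c ys)
  then show ?case using hurwitz.right[of "ps @ bs @ qs" "ps @ xs" b c "ys @ qs"] by simp
next
  case (left xs b c ys)
  then show ?case using hurwitz.left[of "ps @ bs @ qs" "ps @ xs" b c "ys @ qs"] by simp
next
  case (sign xs b ys)
  then show ?case using hurwitz.sign[of "ps @ bs @ qs" "ps @ xs" b "ys @ qs"] by simp
qed (rule hurwitz.start)

lemma hurwitz_length: "hurwitz bs cs \<Longrightarrow> length cs = length bs"
  by (induction rule: hurwitz.induct) auto

lemma hurwitz_closed:
  assumes "hurwitz bs cs" "set bs \<subseteq> R"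
    and "\<And>b c. b \<in> R \<Longrightarrow> c \<in> R \<Longrightarrow> arefl b c \<in> R" "\<And>b. b \<in> R \<Longrightarrow> aneg b \<in> R"
  shows "set cs \<subseteq> R"
  using assms by (induction rule: hurwitz.induct) auto

lemma hurwitz_roots: "hurwitz bs cs \<Longrightarrow> roots bs \<Longrightarrow> roots cs"
  using hurwitz_closed[of bs cs "{b. root (fst b)}"] root_refl root_uminus by (auto simp: fst_aneg)

lemma hurwitz_aprod:
  assumes "hurwitz bs cs" "roots bs" shows "aprod cs x = aprod bs x"
  using assms
proof (induction arbitrary: x rule: hurwitz.induct)
  case (right xs b c ys)
  then have "root (fst b)" "root (fst c)" using hurwitz_roots by fastforce+
  with right show ?case by (simp add: arefl_conj)
next
  case (left xs b c ys)
  then have "root (fst b)" "root (fst c)" using hurwitz_roots by fastforce+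
  with left show ?case by (simp add: arefl_conj)
next
  case (sign xs b ys)
  then have "root (fst b)" using hurwitz_roots by fastforce
  with sign show ?case by (simp add: arefl_aneg)
qed simp

lemma hurwitz_lprod:
  assumes "hurwitz bs cs" "roots bs" shows "lprod cs x = lprod bs x"
  using hurwitz_aprod[OF assms, of "(x, 0)"] fst_aprod by (metis fst_conv)

lemma hurwitz_move_left: "hurwitz (us @ [b]) (aprod us b # us)"
proof (induction us)
  case (Cons u us)
  from hurwitz_context[OF this, of "[u]" "[]"]
  have "hurwitz ((u # us) @ [b]) ([] @ u # aprod us b # us)" by simp
  from hurwitz.left[OF this] show ?case by simp
qed (simp add: hurwitz.start)

lemma hurwitz_move_right: "hurwitz (b # us) (us @ [aprod (rev us) b])"
proof (induction us arbitrary: b)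
  case (Cons u us)
  have "hurwitz (b # u # us) (u # arefl u b # us)"
    using hurwitz.right[of "b # u # us" "[]" b u us] by (simp add: hurwitz.start)
  moreover have "hurwitz (u # arefl u b # us) (u # us @ [aprod (rev us) (arefl u b)])"
    using hurwitz_context[OF Cons, of "[u]" "arefl u b" "[]"] by simp
  ultimately show ?case using hurwitz_trans by simp
qed (simp add: hurwitz.start)

text \<open>Modulo the extra coordinate the two reflections of the pair cancel, so letting the pair pass changes
  only second components.\<close>

lemma hurwitz_pair_right:
  assumes "root b"
  shows "\<exists>us'. hurwitz ((b, y) # (b, z) # us) (us' @ [(b, y), (b, z)]) \<and> map fst us' = map fst us"
proof (induction us)
  case (Cons u us)
  then obtain us' where us': "hurwitz ((b, y) # (b, z) # us) (us' @ [(b, y), (b, z)])" "map fst us' = map fst us" by blast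
  let ?u = "arefl (b, y) (arefl (b, z) u)"
  have "hurwitz ((b, y) # (b, z) # u # us) (?u # (b, y) # (b, z) # us)"
    using hurwitz_context[OF hurwitz_move_left[of "[(b, y), (b, z)]" u], of "[]" us] by simp
  moreover have "hurwitz (?u # (b, y) # (b, z) # us) (?u # us' @ [(b, y), (b, z)])"
    using hurwitz_context[OF us'(1), of "[?u]" "[]"] by simp
  ultimately have "hurwitz ((b, y) # (b, z) # u # us) ((?u # us') @ [(b, y), (b, z)])"
    using hurwitz_trans by simp
  moreover have "map fst (?u # us') = map fst (u # us)" using us'(2) assms by simp
  ultimately show ?case by blast
qed (auto intro: hurwitz.start)

lemma hurwitz_pair_left:
  assumes "root b"
  shows "\<exists>us'. hurwitz (us @ [(b, y), (b, z)]) ((b, y) # (b, z) # us') \<and> map fst us' = map fst us"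
proof (induction us)
  case (Cons u us)
  then obtain us' where us': "hurwitz (us @ [(b, y), (b, z)]) ((b, y) # (b, z) # us')" "map fst us' = map fst us" by blast
  let ?u = "arefl (b, z) (arefl (b, y) u)"
  have "hurwitz ((u # us) @ [(b, y), (b, z)]) (u # (b, y) # (b, z) # us')"
    using hurwitz_context[OF us'(1), of "[u]" "[]"] by simp
  moreover have "hurwitz (u # (b, y) # (b, z) # us') ((b, y) # (b, z) # ?u # us')"
    using hurwitz_context[OF hurwitz_move_right[of u "[(b, y), (b, z)]"], of "[]" us'] by simp
  ultimately have "hurwitz ((u # us) @ [(b, y), (b, z)]) ((b, y) # (b, z) # ?u # us')"
    using hurwitz_trans by blast
  moreover have "map fst (?u # us') = map fst (u # us)" using us'(2) assms by simp
  ultimately show ?case by blast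
qed (auto intro: hurwitz.start)

lemma lprod_word:
  assumes "roots bs"
  obtains ws where "set ws \<subseteq> I" "lprod bs = act ws"
proof -
  have "\<exists>ws. set ws \<subseteq> I \<and> lprod bs = act ws" using assms
  proof (induction bs)
    case Nil
    show ?case by (rule exI[of _ "[]"]) (auto simp: lprod_def act_def)
  next
    case (Cons b bs)
    then obtain ws where ws: "set ws \<subseteq> I" "lprod bs = act ws" by auto
    obtain vs where "set vs \<subseteq> I" "refl (fst b) = act vs" using Cons.prems refl_word by auto
    with ws show ?case by (intro exI[of _ "vs @ ws"]) auto
  qed
  with that show ?thesis by blast
qed

lemma root_lprod: "roots bs \<Longrightarrow> root b \<Longrightarrow> root (lprod bs b)"
  by (induction bs) (auto intro: root_refl)

section \<open>Factorizations of products of distinct simple reflections\<close>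

text \<open>The sum of the depths of the products \<open>f b\<^sub>1 \<dots> b\<^sub>k\<close>, \<open>k \<ge> 1\<close>, made nonnegative by \<open>depth_ge\<close>.\<close>

fun potential :: "(('i \<Rightarrow> int) \<Rightarrow> 'i \<Rightarrow> int) \<Rightarrow> 'i aroot list \<Rightarrow> nat" where
  "potential f [] = 0"
| "potential f (b # bs) =
     nat (depth (\<lambda>x. f (refl (fst b) x)) + ht rho) + potential (\<lambda>x. f (refl (fst b) x)) bs"

lemma potential_append: "potential f (bs @ cs) = potential f bs + potential (\<lambda>x. f (lprod bs x)) cs"
  by (induction bs arbitrary: f) auto

lemma hurwitz_pos:
  assumes "roots bs"
  shows "\<exists>cs. hurwitz bs cs \<and> (\<forall>c\<in>set cs. pos (fst c)) \<and> (\<forall>f. potential f cs = potential f bs)"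
  using assms
proof (induction bs)
  case (Cons b bs)
  then obtain cs where cs: "hurwitz bs cs" "\<forall>c\<in>set cs. pos (fst c)" "\<And>f. potential f cs = potential f bs" by auto
  have 1: "hurwitz (b # bs) (b # cs)" using hurwitz_context[OF cs(1), of "[b]" "[]"] by simp
  from Cons.prems have r: "root (fst b)" by simp
  then consider "pos (fst b)" | "neg (fst b)" using root_pos_or_neg by blast
  then show ?case
  proof cases
    case 1
    with \<open>hurwitz (b # bs) (b # cs)\<close> cs show ?thesis by (intro exI[of _ "b # cs"]) auto
  next
    case 2
    have "hurwitz (b # bs) (aneg b # cs)" using hurwitz.sign[of "b # bs" "[]" b cs] 1 by simp
    with 2 cs r show ?thesis by (intro exI[of _ "aneg b # cs"]) (auto simp: fst_aneg refl_uminus)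
  qed
qed (auto intro: hurwitz.start)

text \<open>By \<open>depth_refl\<close> this says that the depths of the products of the initial segments increase.\<close>

definition rising :: "'i aroot list \<Rightarrow> bool" where
  "rising bs \<longleftrightarrow> (\<forall>xs b ys. bs = xs @ b # ys \<longrightarrow> pos (lprod xs (fst b)))"

text \<open>Take a list of least potential among those that Hurwitz moves reach. A Hurwitz move at one place
  changes only one initial product, so by \<open>no_peak\<close> there is no peak between distinct reflections. The
  first step from the identity goes up, and a step up is then followed by another step up.\<close>

lemma rising_or_equal_neighbours:
  assumes "roots bs"
  shows "\<exists>cs. hurwitz bs cs \<and> (\<forall>c\<in>set cs. pos (fst c)) \<and>
    (rising cs \<or> (\<exists>xs b c ys. cs = xs @ b # c # ys \<and> fst b = fst c))"
proof -
  obtain ds where ds: "hurwitz bs ds" "\<And>es. hurwitz bs es \<Longrightarrow> potential (\<lambda>x. x) ds \<le> potential (\<lambda>x. x) es"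
    using ex_has_least_nat[of "hurwitz bs" bs "potential (\<lambda>x. x)"] hurwitz.start by blast
  obtain cs where cs: "hurwitz ds cs" "\<forall>c\<in>set cs. pos (fst c)" "potential (\<lambda>x. x) cs = potential (\<lambda>x. x) ds"
    using hurwitz_pos[OF hurwitz_roots[OF ds(1) assms]] by blast
  have h: "hurwitz bs cs" using ds(1) cs(1) by (rule hurwitz_trans)
  have r: "roots cs" by (rule hurwitz_roots[OF h assms])
  have min: "potential (\<lambda>x. x) cs \<le> potential (\<lambda>x. x) es" if "hurwitz bs es" for es
    using ds(2)[OF that] cs(3) by simp
  have "rising cs" if no: "\<not> (\<exists>xs b c ys. cs = xs @ b # c # ys \<and> fst b = fst c)"
  proof -
    have "pos (lprod xs (fst b))" if "cs = xs @ b # ys" for xs b ys using that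
    proof (induction xs arbitrary: b ys rule: rev_induct)
      case Nil
      then show ?case using cs(2) by simp
    next
      case (snoc c xs)
      then have eq: "cs = xs @ c # b # ys" by simp
      then have bc: "root (fst b)" "root (fst c)" "pos (fst b)" "pos (fst c)" "roots xs" using r cs(2) by auto
      \<comment> \<open>The last step before \<open>b\<close> goes up; if the next one goes down, then \<open>lprod (xs @ [c])\<close> is a peak.\<close>
      have up: "pos (lprod xs (fst c))" using snoc.IH[OF eq] .
      have rx: "roots (xs @ [c])" using bc by simp
      obtain ws where ws: "set ws \<subseteq> I" "lprod (xs @ [c]) = act ws" using lprod_word[OF rx] .
      have g: "act ws x = lprod xs (refl (fst c) x)" for x using fun_cong[OF ws(2), of x] by simp
      show ?case
      proof (rule ccontr)
        assume "\<not> ?case"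
        then have "neg (act ws (fst b))"
          using root_pos_or_neg[OF root_lprod[OF rx bc(1)]] ws(2) by simp
        then have b_inv: "fst b \<in> inversions (act ws)" using bc by (simp add: inversions_def)
        obtain vs where vs: "set vs \<subseteq> I" "lprod xs = act vs" using lprod_word[OF bc(5)] .
        have "act ws (fst c) = (\<lambda>j. - lprod xs (fst c) j)" using bc(2) by (simp add: g vs(2) act_minus)
        then have c_inv: "fst c \<in> inversions (act ws)" using bc up by (simp add: inversions_def)
        have "fst c \<noteq> fst b" using no eq by metis
        have dg: "depth (act us) + ht rho \<ge> 0" if "set us \<subseteq> I" for us using depth_ge[OF that] by simp
        let ?D = "\<lambda>f. nat (depth f + ht rho)"
        define rest where "rest = potential (\<lambda>x. lprod xs (refl (fst c) (refl (fst b) x))) ys"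
        have p0: "potential (\<lambda>x. x) cs = potential (\<lambda>x. x) xs + ?D (act ws) + ?D (\<lambda>x. lprod xs (refl (fst c) (refl (fst b) x))) + rest"
          unfolding eq rest_def by (simp add: potential_append g[symmetric] fun_eq_iff[symmetric])
        have p1: "potential (\<lambda>x. x) (xs @ b # arefl b c # ys) =
            potential (\<lambda>x. x) xs + ?D (\<lambda>x. act ws (refl (fst c) (refl (fst b) x))) + ?D (\<lambda>x. lprod xs (refl (fst c) (refl (fst b) x))) + rest"
          unfolding rest_def using bc by (simp add: potential_append g refl_conj)
        have p2: "potential (\<lambda>x. x) (xs @ arefl c b # c # ys) =
            potential (\<lambda>x. x) xs + ?D (\<lambda>x. act ws (refl (fst b) (refl (fst c) x))) + ?D (\<lambda>x. lprod xs (refl (fst c) (refl (fst b) x))) + rest"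
          unfolding rest_def using bc by (simp add: potential_append g refl_conj)
        have "hurwitz bs (xs @ b # arefl b c # ys)" "hurwitz bs (xs @ arefl c b # c # ys)"
          using h unfolding eq by (auto intro: hurwitz.right hurwitz.left)
        from this[THEN min] p0 p1 p2
        have "?D (act ws) \<le> ?D (\<lambda>x. act ws (refl (fst c) (refl (fst b) x)))"
          "?D (act ws) \<le> ?D (\<lambda>x. act ws (refl (fst b) (refl (fst c) x)))" by simp_all
        moreover have "depth (\<lambda>x. act ws (refl (fst c) (refl (fst b) x))) < depth (act ws) \<or>
            depth (\<lambda>x. act ws (refl (fst b) (refl (fst c) x))) < depth (act ws)"
          using no_peak[OF ws(1) c_inv b_inv \<open>fst c \<noteq> fst b\<close>] .
        \<comment> \<open>The shifted depth at the peak is positive, so truncation to natural numbers keeps the strict inequality.\<close>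
        moreover have "depth (act ws) + ht rho > 0"
        proof -
          have "depth (act ws) = depth (act vs) + cor (fst c) rho * ht (act vs (fst c))"
            using depth_refl[OF linear_act, of vs "fst c"] by (simp add: g[symmetric] vs(2)[symmetric])
          moreover have "cor (fst c) rho > 0" "ht (act vs (fst c)) > 0"
            using cor_rho_pos bc ht_pos up vs(2) by auto
          ultimately show ?thesis using dg[OF vs(1)] by (smt (verit) mult_pos_pos)
        qed
        ultimately show False by linarith
      qed
    qed
    then show ?thesis by (simp add: rising_def)
  qed
  with h cs(2) show ?thesis by blast
qed

text \<open>Apply the letters of the word from the right. The sign of \<open>b\<close> changes at some letter \<open>k\<close>, and \<open>\<alpha>\<^sub>k\<close> is
  the only positive root whose sign that letter changes.\<close>

lemma exchange:
  assumes "set is \<subseteq> I" "root b" "pos b" "neg (act is b)"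
  shows "\<exists>ps k qs. is = ps @ k # qs \<and> act qs b = simple k"
  using assms(1,4)
proof (induction "is")
  case Nil
  then show ?case using not_pos_neg assms(3) by simp
next
  case (Cons i "is")
  then have r: "root (act is b)" using root_act[OF assms(2)] by simp
  show ?case
  proof (cases "pos (act is b)")
    case True
    then have "act is b = simple i" using srefl_pos[OF r True] Cons.prems not_pos_neg by auto
    then show ?thesis by (intro exI[of _ "[]"]) auto
  next
    case False
    then have "neg (act is b)" using pos_root_iff[OF r] by simp
    with Cons obtain ps k qs where "is = ps @ k # qs" "act qs b = simple k" by auto
    then show ?thesis by (intro exI[of _ "i # ps"]) auto
  qed
qed

text \<open>The last step goes up, so by the exchange condition removing the last reflection \<open>b\<close> removes a letter
  \<open>k\<close> from the word. The shorter list is equivalent to the shorter word by induction, and \<open>b\<close>, moved to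
  the place of \<open>k\<close>, turns into \<open>\<alpha>\<^sub>k\<close>.\<close>

lemma rising_normal_form:
  assumes "rising bs" "roots bs" "\<forall>b\<in>set bs. pos (fst b)" "set is \<subseteq> I" "distinct is" "lprod bs = act is"
  shows "\<exists>us. hurwitz bs us \<and> map fst us = map simple is"
  using assms
proof (induction bs arbitrary: "is" rule: rev_induct)
  case Nil
  \<comment> \<open>The empty product is the identity, whereas a product of distinct simple reflections ending in \<open>k\<close> sends \<open>\<alpha>\<^sub>k\<close> to a vector with coefficient \<open>-1\<close> at \<open>k\<close>.\<close>
  have "is = []"
  proof (cases "is" rule: rev_exhaust)
    case (snoc is' k)
    with Nil.prems have k: "k \<in> I" "k \<notin> set is'" "set is' \<subseteq> I" by auto
    have "simple k = act is (simple k)" using fun_cong[OF Nil.prems(6), of "simple k"] by simp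
    also have "\<dots> = (\<lambda>j. - act is' (simple k) j)" using k by (simp add: snoc srefl_simple act_minus)
    finally have "simple k k = - simple k k" using act_outside[OF k(3,2), of "simple k"] by (simp add: fun_eq_iff)
    then show ?thesis by (simp add: simple_def)
  qed
  then show ?case by (auto intro: hurwitz.start)
next
  case (snoc b bs)
  from snoc.prems have b: "root (fst b)" "pos (fst b)" "roots bs" by auto
  have up: "pos (lprod bs (fst b))" using snoc.prems(1) unfolding rising_def by blast
  obtain ws where ws: "set ws \<subseteq> I" "lprod bs = act ws" using lprod_word[OF b(3)] .
  have "act is (fst b) = (\<lambda>j. - lprod bs (fst b) j)"
    using fun_cong[OF snoc.prems(6), of "fst b"] b(1) by (simp add: ws(2) act_minus)
  with up obtain ps k qs where s: "is = ps @ k # qs" "act qs (fst b) = simple k"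
    using exchange[OF snoc.prems(4) b(1,2)] by auto
  then have I: "k \<in> I" "set ps \<subseteq> I" "set qs \<subseteq> I" using snoc.prems(4) by auto
  have bk: "fst b = act (rev qs) (simple k)" using s(2) I act_rev(2)[of qs "fst b"] by simp
  have "lprod bs x = act (ps @ qs) x" for x
  proof -
    have "lprod bs x = act is (refl (fst b) x)"
      using fun_cong[OF snoc.prems(6), of "refl (fst b) x"] b(1) by simp
    also have "refl (fst b) x = act (rev qs @ k # qs) x"
      using refl_act[of "rev qs" k] I unfolding bk by simp
    finally show ?thesis using I by (simp add: s(1))
  qed
  then have "lprod bs = act (ps @ qs)" by (rule ext)
  moreover have "rising bs" using snoc.prems(1) unfolding rising_def by auto
  ultimately obtain us where us: "hurwitz bs us" "map fst us = map simple (ps @ qs)"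
    using snoc.IH[of "ps @ qs"] b snoc.prems s(1) by auto
  then obtain vs ws where vw: "us = vs @ ws" "map fst vs = map simple ps" "map fst ws = map simple qs"
    by (auto simp: map_eq_append_conv)
  have "hurwitz (bs @ [b]) (vs @ ws @ [b])" using hurwitz_context[OF us(1), of "[]" "[b]"] vw by simp
  moreover have "hurwitz (vs @ ws @ [b]) (vs @ aprod ws b # ws)"
    using hurwitz_context[OF hurwitz_move_left[of ws b], of vs "[]"] by simp
  ultimately have "hurwitz (bs @ [b]) (vs @ aprod ws b # ws)" by (rule hurwitz_trans)
  moreover have "fst (aprod ws b) = simple k"
  proof -
    have "lprod ws x = act qs x" for x using vw(3) I(3)
      by (induction ws arbitrary: qs) (auto simp: refl_simple)
    then show ?thesis using s(2) by (simp add: fst_aprod)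
  qed
  ultimately show ?case using vw s by (intro exI[of _ "vs @ aprod ws b # ws"]) auto
qed

definition paired :: "(('i \<Rightarrow> int) \<times> int \<times> int) list \<Rightarrow> 'i aroot list" where
  "paired qs = concat (map (\<lambda>(b, y, z). [(b, y), (b, z)]) qs)"

text \<open>Every pair of equal neighbours goes to the end of the list; by \<open>rising_or_equal_neighbours\<close> what
  is left when there are no more of them is rising.\<close>

theorem hurwitz_normal_form:
  assumes "roots bs" "set is \<subseteq> I" "distinct is" "lprod bs = act is"
  shows "\<exists>us qs. hurwitz bs (us @ paired qs) \<and> map fst us = map simple is \<and> (\<forall>(b, y, z)\<in>set qs. root b \<and> pos b)"
  using assms(1,4)
proof (induction "length bs" arbitrary: bs rule: less_induct)
  case less
  obtain cs where cs: "hurwitz bs cs" "\<forall>c\<in>set cs. pos (fst c)"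
     "rising cs \<or> (\<exists>xs b c ys. cs = xs @ b # c # ys \<and> fst b = fst c)"
    using rising_or_equal_neighbours[OF less.prems(1)] by blast
  have r: "roots cs" by (rule hurwitz_roots[OF cs(1) less.prems(1)])
  have p: "lprod cs = act is" using hurwitz_lprod[OF cs(1) less.prems(1)] less.prems(2) by (simp add: fun_eq_iff)
  from cs(3) show ?case
  proof
    assume "rising cs"
    from rising_normal_form[OF this r cs(2) assms(2,3) p] obtain us where "hurwitz cs us" "map fst us = map simple is" by blast
    with hurwitz_trans[OF cs(1)] show ?thesis by (intro exI[of _ us] exI[of _ "[]"]) (auto simp: paired_def)
  next
    assume "\<exists>xs b c ys. cs = xs @ b # c # ys \<and> fst b = fst c"
    then obtain xs b y z ys where eq: "cs = xs @ (b, y) # (b, z) # ys" by (metis prod.collapse)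
    with r cs(2) have b: "root b" "pos b" by auto
    obtain ys' where ys': "hurwitz ((b, y) # (b, z) # ys) (ys' @ [(b, y), (b, z)])" "map fst ys' = map fst ys"
      using hurwitz_pair_right[OF b(1)] by blast
    have h: "hurwitz bs ((xs @ ys') @ [(b, y), (b, z)])"
      using hurwitz_trans[OF cs(1)] hurwitz_context[OF ys'(1), of xs "[]"] eq by simp
    have r': "roots (xs @ ys')" using hurwitz_roots[OF h less.prems(1)] by simp
    have "lprod (xs @ ys') x = act is x" for x
      using hurwitz_lprod[OF h less.prems(1), of x] less.prems(2) b(1) by simp
    then have p': "lprod (xs @ ys') = act is" by (rule ext)
    have "length (xs @ ys') < length bs" using hurwitz_length[OF h] by simp
    from less.hyps[OF this r' p'] obtain us qs where
      IH: "hurwitz (xs @ ys') (us @ paired qs)" "map fst us = map simple is" "\<forall>(b, y, z)\<in>set qs. root b \<and> pos b" by blast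
    have "hurwitz bs (us @ paired (qs @ [(b, y, z)]))"
      using hurwitz_trans[OF h] hurwitz_context[OF IH(1), of "[]" "[(b, y), (b, z)]"] by (simp add: paired_def)
    with IH b show ?thesis by (intro exI[of _ us] exI[of _ "qs @ [(b, y, z)]"]) auto
  qed
qed

end

section \<open>The star of a canonical symbol\<close>

text \<open>The vertices other than \<open>ZeroStar\<close> form a basis of the lattice modulo \<open>a = \<alpha>\<^bsub>0*\<^esub> - \<epsilon> \<alpha>\<^sub>0\<close>.\<close>

definition star :: "canonical_symbol \<Rightarrow> vertex set" where
  "star C = set (basis_list C) - {ZeroStar}"

definition arms :: "canonical_symbol \<Rightarrow> vertex list" where
  "arms C = concat (map (\<lambda>i. map (Arm i) (rev [1..<sym_p C i])) (rev [1..<Suc (sym_t C)]))"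

lemma basis_list_arms: "basis_list C = arms C @ [Zero, ZeroStar]"
  by (simp add: basis_list_def arms_def)

lemma set_arms: "set (arms C) = {Arm i j | i j. i \<in> {1..sym_t C} \<and> j \<in> {1..<sym_p C i}}"
  unfolding arms_def by (auto simp del: upt_Suc simp: less_Suc_eq_le)

lemma distinct_arms: "distinct (arms C)"
proof -
  have "distinct (concat (map (\<lambda>i. map (Arm i) (rev [1..<sym_p C i])) xs))" if "distinct xs" for xs
    using that by (induction xs) (auto simp: distinct_map inj_on_def)
  then show ?thesis unfolding arms_def by simp
qed

lemma star_arms: "star C = insert Zero (set (arms C))"
  by (auto simp: star_def basis_list_arms set_arms)

lemma sum_star: "sum g (star C) = g Zero + (\<Sum>i=1..sym_t C. \<Sum>j=1..<sym_p C i. g (Arm i j))"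
proof -
  have eq: "set (arms C) = (\<lambda>(i, j). Arm i j) ` (SIGMA i:{1..sym_t C}. {1..<sym_p C i})"
    unfolding set_arms by auto
  have inj: "inj_on (\<lambda>(i, j). Arm i j) A" for A by (auto simp: inj_on_def)
  have "sum g (set (arms C)) = (\<Sum>i=1..sym_t C. \<Sum>j=1..<sym_p C i. g (Arm i j))"
    unfolding eq sum.reindex[OF inj] by (simp add: sum.Sigma case_prod_unfold)
  moreover have "Zero \<notin> set (arms C)" by (simp add: set_arms)
  ultimately show ?thesis unfolding star_arms by simp
qed

text \<open>Half the value of the symmetric form at the basis vector.\<close>

fun star_norm :: "canonical_symbol \<Rightarrow> nat \<Rightarrow> vertex \<Rightarrow> int" where
  "star_norm C \<kappa> (Arm i j) = arm_value C \<kappa> i"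
| "star_norm C \<kappa> _ = int \<kappa>"

text \<open>The entry at \<open>a, b\<close> is \<open>2 (a, b) / (a, a)\<close>. The diagram is a star with the arms as rays of single
  edges, joined to the centre by edges that depend on the symbol.\<close>

fun star_cartan :: "canonical_symbol \<Rightarrow> vertex \<Rightarrow> vertex \<Rightarrow> int" where
  "star_cartan C (Arm i j) (Arm i' j') =
     (if i' \<noteq> i then 0 else if j' = j then 2 else if j' = Suc j \<or> j = Suc j' then - 1 else 0)"
| "star_cartan C (Arm i j) Zero = (if j = 1 then - int (sym_e C i) else 0)"
| "star_cartan C Zero (Arm i j) = (if j = 1 then - int (sym_eps C * sym_f C i) else 0)"
| "star_cartan C Zero Zero = 2"
| "star_cartan C _ _ = 0"

lemma star_coroot_arm:
  assumes "i \<in> {1..sym_t C}" "j \<in> {1..<sym_p C i}"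
  shows "(\<Sum>b\<in>star C. star_cartan C (Arm i j) b * x b) =
    2 * x (Arm i j) - (if j = 1 then int (sym_e C i) * x Zero else x (Arm i (j - 1)))
      - (if Suc j < sym_p C i then x (Arm i (Suc j)) else 0)"
proof -
  let ?P = "{1..<sym_p C i}"
  have "(\<Sum>b\<in>star C. star_cartan C (Arm i j) b * x b) =
      star_cartan C (Arm i j) Zero * x Zero + (\<Sum>j'\<in>?P. star_cartan C (Arm i j) (Arm i j') * x (Arm i j'))"
  proof -
    have eq: "(\<Sum>j'=1..<sym_p C i'. star_cartan C (Arm i j) (Arm i' j') * x (Arm i' j')) =
        (if i' = i then \<Sum>j'\<in>?P. star_cartan C (Arm i j) (Arm i j') * x (Arm i j') else 0)" for i'
      by simp
    show ?thesis unfolding sum_star sum.cong[OF HOL.refl eq] using assms(1) by (simp del: star_cartan.simps)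
  qed
  also have "(\<Sum>j'\<in>?P. star_cartan C (Arm i j) (Arm i j') * x (Arm i j')) =
      (\<Sum>j'\<in>?P. (if j' = j then 2 * x (Arm i j) else 0) - (if j' = Suc j then x (Arm i (Suc j)) else 0)
        - (if j' = j - 1 then x (Arm i (j - 1)) else 0))"
    using assms(2) by (intro sum.cong) auto
  also have "\<dots> = 2 * x (Arm i j) - (if Suc j < sym_p C i then x (Arm i (Suc j)) else 0)
        - (if j = 1 then 0 else x (Arm i (j - 1)))"
    using assms(2) by (auto simp: sum_subtractf)
  finally show ?thesis by simp
qed

lemma star_coroot_zero:
  assumes "\<And>i. i \<in> {1..sym_t C} \<Longrightarrow> sym_p C i \<ge> 2"
  shows "(\<Sum>b\<in>star C. star_cartan C Zero b * x b) =
    2 * x Zero - (\<Sum>i=1..sym_t C. int (sym_eps C * sym_f C i) * x (Arm i 1))"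
proof -
  have "(\<Sum>j=1..<sym_p C i. star_cartan C Zero (Arm i j) * x (Arm i j)) = - (int (sym_eps C * sym_f C i) * x (Arm i 1))"
    if "i \<in> {1..sym_t C}" for i
  proof -
    have "(\<Sum>j=1..<sym_p C i. star_cartan C Zero (Arm i j) * x (Arm i j)) =
        (\<Sum>j=1..<sym_p C i. if j = 1 then - (int (sym_eps C * sym_f C i) * x (Arm i 1)) else 0)"
      by (intro sum.cong) auto
    then show ?thesis using assms[OF that] by simp
  qed
  then show ?thesis unfolding sum_star by (simp add: sum_negf)
qed

locale canonical =
  fixes C :: canonical_symbol and \<kappa> :: nat
  assumes symbol: "is_symbol C" and scale: "admissible_scale C \<kappa>" and non_tub: "non_tubular C"
begin

abbreviation "t \<equiv> sym_t C"
abbreviation "p \<equiv> sym_p C"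
abbreviation "e i \<equiv> int (sym_e C i)"
abbreviation "ef i \<equiv> int (sym_eps C * sym_f C i)"

lemma p_ge: "i \<in> {1..t} \<Longrightarrow> p i \<ge> 2"
  using symbol by (simp add: is_symbol_def)

lemma kappa_pos: "\<kappa> > 0"
  using scale by (simp add: admissible_scale_def)

lemma eps_pos: "sym_eps C > 0"
  using symbol by (auto simp: is_symbol_def)

lemma f_pos: "i \<in> {1..t} \<Longrightarrow> sym_f C i > 0"
  using symbol by (force simp: is_symbol_def)

lemma e_f: "i \<in> {1..t} \<Longrightarrow> sym_e C i * sym_f C i = sym_d C i"
  using symbol by (simp add: is_symbol_def sym_e_def)

lemma arm_value_e: "i \<in> {1..t} \<Longrightarrow> arm_value C \<kappa> i * e i = int \<kappa> * ef i"
  using arm_value_exact(1)[OF symbol scale, of i] by (simp add: mult_ac)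

text \<open>Solving \<open>coroot a x = 0\<close> along an arm shows that \<open>x\<close> decreases linearly from \<open>e\<^sub>i x\<^sub>0\<close> to \<open>0\<close> in \<open>p\<^sub>i\<close>
  steps. The product of all \<open>p\<^sub>i\<close> clears denominators.\<close>

definition level :: "vertex \<Rightarrow> int" where
  "level a = (if a \<in> star C then
     (case a of Arm i j \<Rightarrow> int (p i - j) * e i * int ((\<Prod>i=1..t. p i) div p i) | _ \<Rightarrow> int (\<Prod>i=1..t. p i)) else 0)"

lemma N_div: "i \<in> {1..t} \<Longrightarrow> int (p i) * int ((\<Prod>i=1..t. p i) div p i) = int (\<Prod>i=1..t. p i)"
  by (metis dvd_mult_div_cancel dvd_prodI finite_atLeastAtMost of_nat_mult)

lemma level_arm:
  assumes "i \<in> {1..t}" "j \<in> {1..<p i}"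
  shows "(\<Sum>b\<in>star C. star_cartan C (Arm i j) b * level b) = 0"
proof -
  let ?n = "int ((\<Prod>i=1..t. p i) div p i)"
  have st: "Arm i k \<in> star C \<longleftrightarrow> k \<in> {1..<p i}" for k using assms(1) by (auto simp: star_arms set_arms)
  have l: "level (Arm i k) = (int (p i) - int k) * e i * ?n" if "k \<in> {1..<p i}" for k
    using that st by (simp add: level_def of_nat_diff)
  have z: "e i * level Zero = int (p i) * e i * ?n"
    using N_div[OF assms(1)] by (simp add: level_def star_arms)
  have "(if j = 1 then e i * level Zero else level (Arm i (j - 1))) = (int (p i) - int j + 1) * e i * ?n"
  proof (cases "j = 1")
    case False
    then have "int (j - 1) = int j - 1" "j - 1 \<in> {1..<p i}" using assms(2) by (auto simp: of_nat_diff)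
    then show ?thesis using l[of "j - 1"] False by (simp only: if_False) (simp add: algebra_simps)
  qed (use z in simp)
  moreover have "(if Suc j < p i then level (Arm i (Suc j)) else 0) = (int (p i) - int j - 1) * e i * ?n"
  proof (cases "Suc j < p i")
    case False
    then have "int (p i) = int j + 1" using assms(2) by auto
    then show ?thesis using False by simp
  qed (use l[of "Suc j"] in \<open>simp add: algebra_simps\<close>)
  ultimately show ?thesis unfolding star_coroot_arm[OF assms] l[OF assms(2)] by (simp add: algebra_simps)
qed

text \<open>The value is \<open>- \<delta>\<close> times the product of all \<open>p\<^sub>i\<close>; this is where the symbol must be non-tubular.\<close>

lemma level_zero: "(\<Sum>b\<in>star C. star_cartan C Zero b * level b) \<noteq> 0"
proof
  assume "(\<Sum>b\<in>star C. star_cartan C Zero b * level b) = 0"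
  then have z: "2 * level Zero = (\<Sum>i=1..t. ef i * level (Arm i 1))"
    using star_coroot_zero[OF p_ge] by simp
  define N where "N = (\<Prod>i=1..t. p i)"
  have "N > 0" unfolding N_def using p_ge by (intro prod_pos) force
  have tm: "of_int (ef i * level (Arm i 1)) = (of_nat N :: rat) * (of_nat (sym_eps C * sym_d C i) * (1 - 1 / of_nat (p i)))"
    if i: "i \<in> {1..t}" for i
  proof -
    have "Arm i 1 \<in> star C" using i p_ge[OF i] by (auto simp: star_arms set_arms)
    then have "level (Arm i 1) = (int (p i) - 1) * e i * int (N div p i)"
      using p_ge[OF i] by (simp add: level_def N_def of_nat_diff)
    then have "(of_int (ef i * level (Arm i 1)) :: rat) =
        of_nat (sym_eps C) * of_nat (sym_f C i * sym_e C i) * (of_nat (p i) - 1) * of_nat (N div p i)" by (simp add: mult_ac)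
    also have "sym_f C i * sym_e C i = sym_d C i" using e_f[OF i] by (simp add: mult.commute)
    also have "(of_nat (N div p i) :: rat) = of_nat N / of_nat (p i)"
    proof -
      have "p i * (N div p i) = N" using N_div[OF i] unfolding N_def of_nat_mult[symmetric] of_nat_eq_iff .
      then have "(of_nat (p i) :: rat) * of_nat (N div p i) = of_nat N" by (metis of_nat_mult)
      then show ?thesis using p_ge[OF i] by (simp add: field_simps)
    qed
    finally show ?thesis using p_ge[OF i] by (simp add: field_simps)
  qed
  have "(2 * of_nat N :: rat) = of_int (2 * level Zero)" by (simp add: level_def N_def star_arms)
  also have "\<dots> = (\<Sum>i=1..t. of_int (ef i * level (Arm i 1)))" unfolding z by simp
  also have "\<dots> = of_nat N * (\<Sum>i=1..t. of_nat (sym_eps C * sym_d C i) * (1 - 1 / of_nat (p i)))"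
    unfolding sum_distrib_left using tm by (intro sum.cong) auto
  finally have "of_nat N * sym_delta C = 0" by (simp add: sym_delta_def algebra_simps)
  then show False using \<open>N > 0\<close> non_tub by (simp add: non_tubular_def)
qed

text \<open>The vector \<open>y\<close> with entries \<open>j (p\<^sub>i - j)\<close> pairs to 2 with every arm. Adding a multiple of \<open>level\<close> leaves
  this unchanged, and makes the pairing with the centre positive if its size and sign are chosen well.\<close>

lemma ex_star_dominant: "\<exists>x. \<forall>a\<in>star C. (\<Sum>b\<in>star C. star_cartan C a b * x b) > 0"
proof -
  let ?r = "\<lambda>a x. \<Sum>b\<in>star C. star_cartan C a b * (x b :: int)"
  define y where "y a = (case a of Arm i j \<Rightarrow> int j * (int (p i) - int j) | _ \<Rightarrow> 0)" for a
  define k where "k = ?r Zero level"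
  define m where "m = sgn k * (\<bar>?r Zero y\<bar> + 1)"
  have lin: "?r a (\<lambda>b. y b + m * level b) = ?r a y + m * ?r a level" for a
    by (simp add: sum.distrib sum_distrib_left algebra_simps)
  have y_arm: "?r (Arm i j) y = 2" if "i \<in> {1..t}" "j \<in> {1..<p i}" for i j
  proof -
    have "(if Suc j < p i then y (Arm i (Suc j)) else 0) = int (Suc j) * (int (p i) - int (Suc j))"
      using that by (auto simp: y_def)
    moreover have "(if j = 1 then e i * y Zero else y (Arm i (j - 1))) = (int j - 1) * (int (p i) - int j + 1)"
      using that by (auto simp: y_def of_nat_diff)
    ultimately show ?thesis unfolding star_coroot_arm[OF that] by (simp add: y_def algebra_simps)
  qed
  have y_zero: "?r Zero y + m * k > 0"
  proof -
    have pos: "0 < q + sgn k * (\<bar>q\<bar> + 1) * k" if "k \<noteq> 0" for k q :: int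
    proof -
      have "sgn k * k = \<bar>k\<bar>" by (simp add: sgn_if)
      then have eq: "sgn k * (\<bar>q\<bar> + 1) * k = (\<bar>q\<bar> + 1) * \<bar>k\<bar>" by (metis mult.assoc mult.commute)
      have "1 \<le> \<bar>k\<bar>" using that by simp
      then have le: "(\<bar>q\<bar> + 1) * 1 \<le> (\<bar>q\<bar> + 1) * \<bar>k\<bar>" by (rule mult_left_mono) simp
      have "0 < q + (\<bar>q\<bar> + 1) * 1" by (cases "q \<ge> 0") simp_all
      then show ?thesis unfolding eq using add_left_mono[OF le] by (rule order_less_le_trans)
    qed
    show ?thesis unfolding m_def using level_zero unfolding k_def by (rule pos)
  qed
  have "?r a (\<lambda>b. y b + m * level b) > 0" if "a \<in> star C" for a
  proof -
    from that consider "a = Zero" | i j where "a = Arm i j" "i \<in> {1..t}" "j \<in> {1..<p i}"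
      unfolding star_arms set_arms by blast
    then show ?thesis
    proof cases
      case 1
      show ?thesis unfolding 1 lin k_def[symmetric] by (rule y_zero)
    next
      case 2
      then show ?thesis unfolding lin 2(1) y_arm[OF 2(2,3)] level_arm[OF 2(2,3)] by simp
    qed
  qed
  then show ?thesis by (intro exI[of _ "\<lambda>b. y b + m * level b"] ballI)
qed

end

sublocale canonical \<subseteq> cartan_lattice "star C" "star_norm C \<kappa>" "star_cartan C"
proof
  show "finite (star C)" by (simp add: star_def)
  show "star_norm C \<kappa> a > 0" if "a \<in> star C" for a
    using that kappa_pos arm_value_exact(2)[OF symbol scale] by (auto simp: star_arms set_arms)
  show "star_cartan C a a = 2" if "a \<in> star C" for a
    using that by (auto simp: star_arms set_arms)
  show "star_cartan C a b \<le> 0" if "a \<in> star C" "b \<in> star C" "a \<noteq> b" for a b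
    using that by (auto simp: star_arms set_arms)
  show "star_norm C \<kappa> a * star_cartan C a b = star_norm C \<kappa> b * star_cartan C b a"
    if "a \<in> star C" "b \<in> star C" for a b
  proof (cases a; cases b)
    fix i j assume ab: "a = Arm i j" "b = Zero"
    then have "i \<in> {1..sym_t C}" using that by (auto simp: star_arms set_arms)
    from arm_value_e[OF this] show ?thesis by (simp add: ab)
  next
    fix i j assume ab: "a = Zero" "b = Arm i j"
    then have "i \<in> {1..sym_t C}" using that by (auto simp: star_arms set_arms)
    from arm_value_e[OF this] show ?thesis by (simp add: ab)
  qed auto
  show "\<exists>x. \<forall>a\<in>star C. (\<Sum>b\<in>star C. star_cartan C a b * x b) > 0" by (rule ex_star_dominant)
qed

context canonical
begin

lemma star_cases:
  assumes "a \<in> star C"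
  obtains "a = Zero" | i j where "a = Arm i j" "i \<in> {1..t}" "j \<in> {1..<p i}" "a \<in> set (arms C)"
  using assms unfolding star_arms set_arms by blast

lemma arms_cases:
  assumes "a \<in> set (arms C)"
  obtains i j where "a = Arm i j" "i \<in> {1..t}" "j \<in> {1..<p i}" "a \<in> star C"
  using assms unfolding star_arms set_arms by blast

lemma arms_star: "set (arms C) \<subseteq> star C" and Zero_star: "Zero \<in> star C"
  by (auto simp: star_arms)

lemma coroot_arm:
  assumes "i \<in> {1..t}" "j \<in> {1..<p i}"
  shows "coroot (Arm i j) x = 2 * x (Arm i j) - (if j = 1 then e i * x Zero else x (Arm i (j - 1)))
      - (if Suc j < p i then x (Arm i (Suc j)) else 0)"
  unfolding coroot_def by (rule star_coroot_arm[OF assms])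

lemma coroot_zero: "coroot Zero x = 2 * x Zero - (\<Sum>i=1..t. ef i * x (Arm i 1))"
  unfolding coroot_def by (rule star_coroot_zero[OF p_ge])

lemma coroot_level_arm: "a \<in> set (arms C) \<Longrightarrow> coroot a level = 0"
  unfolding coroot_def by (elim arms_cases) (simp only: level_arm)

lemma coroot_level_zero: "coroot Zero level \<noteq> 0"
  unfolding coroot_def by (rule level_zero)

text \<open>A multiple of the fundamental weight of type \<open>A\<^bsub>p\<^sub>i - 1\<^esub>\<close>: it pairs with exactly one of the arm vectors,
  see \<open>coroot_weight\<close>.\<close>

definition weight :: "nat \<Rightarrow> nat \<Rightarrow> vertex \<Rightarrow> int" where
  "weight i j a = (case a of Arm i' k \<Rightarrow>
     if i' = i \<and> k \<in> {1..<p i} then int (min j k) * int (p i - max j k) else 0 | _ \<Rightarrow> 0)"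

lemma weight_outside: "i \<in> {1..t} \<Longrightarrow> a \<notin> star C \<Longrightarrow> weight i j a = 0"
  by (auto simp: weight_def star_arms set_arms split: vertex.split)

lemma coroot_weight:
  assumes i: "i \<in> {1..t}" and j: "j \<in> {1..<p i}" and a: "a \<in> set (arms C)"
  shows "coroot a (weight i j) = (if a = Arm i j then int (p i) else 0)"
proof -
  from a obtain i' k where a: "a = Arm i' k" "i' \<in> {1..t}" "k \<in> {1..<p i'}" by (rule arms_cases)
  show ?thesis
  proof (cases "i' = i")
    case False
    then show ?thesis unfolding a(1) coroot_arm[OF a(2,3)] by (simp add: weight_def)
  next
    case True
    have w: "weight i j (Arm i l) = (if l \<le> j then int l * (int (p i) - int j) else int j * (int (p i) - int l))"
      if "l \<in> {1..<p i}" for l using that j by (auto simp: weight_def of_nat_diff min_def max_def)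
    have k: "k \<in> {1..<p i}" using a True by simp
    have 1: "(if k = 1 then e i * weight i j Zero else weight i j (Arm i (k - 1))) =
       (if k \<le> j then (int k - 1) * (int (p i) - int j) else int j * (int (p i) - int k + 1))"
    proof (cases "k = 1")
      case True then show ?thesis using j by (simp add: weight_def)
    next
      case False
      then have "k - 1 \<in> {1..<p i}" "int (k - 1) = int k - 1" using k by (auto simp: of_nat_diff)
      moreover have "k - 1 \<le> j \<longleftrightarrow> k \<le> j \<or> k = Suc j" by auto
      ultimately show ?thesis using False w[of "k - 1"] by auto
    qed
    have 2: "(if Suc k < p i then weight i j (Arm i (Suc k)) else 0) =
       (if k < j then (int k + 1) * (int (p i) - int j) else int j * (int (p i) - int k - 1))"
    proof (cases "Suc k < p i")
      case True
      then show ?thesis using w[of "Suc k"] by (auto simp: algebra_simps)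
    next
      case False
      then have "p i = Suc k" "\<not> k < j" using k j by auto
      then show ?thesis by simp
    qed
    show ?thesis unfolding a(1) True coroot_arm[OF i k] 1 2 w[OF k]
      by (cases k j rule: linorder_cases) (simp_all add: algebra_simps)
  qed
qed

section \<open>The affine roots of a canonical lattice\<close>

text \<open>Since \<open>\<alpha>\<^bsub>0*\<^esub> = \<epsilon> (\<alpha>\<^sub>0 + a/\<epsilon>)\<close>, the basis vector \<open>\<alpha>\<^bsub>0*\<^esub>\<close> gives the same reflection as the affine root with
  coefficient 1 of \<open>a/\<epsilon>\<close>.\<close>

definition gen :: "vertex \<Rightarrow> vertex aroot" where
  "gen a = (if a = ZeroStar then (simple Zero, 1) else (simple a, 0))"

inductive_set aroots :: "vertex aroot set" where
  gen: "a \<in> set (basis_list C) \<Longrightarrow> gen a \<in> aroots"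
| step: "b \<in> aroots \<Longrightarrow> a \<in> set (basis_list C) \<Longrightarrow> arefl (gen a) b \<in> aroots"

lemma basis_cases:
  assumes "a \<in> set (basis_list C)"
  obtains "a = ZeroStar" | "a \<in> star C" "a \<noteq> ZeroStar"
  using assms by (auto simp: star_def)

lemma gen_root: "a \<in> set (basis_list C) \<Longrightarrow> root (fst (gen a))"
  by (elim basis_cases) (auto simp: gen_def root_simple Zero_star)

lemma aroots_root: "b \<in> aroots \<Longrightarrow> root (fst b)"
  by (induction rule: aroots.induct) (auto intro: gen_root root_refl)

lemma aroots_closed: "b \<in> aroots \<Longrightarrow> c \<in> aroots \<Longrightarrow> arefl b c \<in> aroots"
proof (induction arbitrary: c rule: aroots.induct)
  case (gen a)
  then show ?case by (intro aroots.step)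
next
  case (step b a)
  have "arefl (arefl (gen a) b) c = arefl (gen a) (arefl b (arefl (gen a) c))"
    using arefl_conj gen_root aroots_root step by simp
  then show ?case using step aroots.step by simp
qed

lemma aroots_aneg: "b \<in> aroots \<Longrightarrow> aneg b \<in> aroots"
  using aroots_closed[of b b] aroots_root[of b] by (simp add: arefl_self)

lemma hurwitz_aroots: "hurwitz bs cs \<Longrightarrow> set bs \<subseteq> aroots \<Longrightarrow> set cs \<subseteq> aroots"
  using hurwitz_closed aroots_closed aroots_aneg by blast

lemma gen_simps: "gen Zero = (simple Zero, 0)" "gen ZeroStar = (simple Zero, 1)" "a \<in> set (arms C) \<Longrightarrow> gen a = (simple a, 0)"
  by (auto simp: gen_def set_arms)

lemma map_gen_basis: "map gen (basis_list C) = map (\<lambda>a. (simple a, 0)) (arms C) @ [(simple Zero, 0), (simple Zero, 1)]"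
  by (simp add: basis_list_arms gen_simps)

text \<open>A divisibility property that the arm vectors of index \<open>i\<close> have and that is invariant under all generating
  reflections, so that it holds in their orbits. It shows that a root whose square length differs
  from that of the centre is too divisible to form the last pair of a factorization.\<close>

definition arm_type :: "nat \<Rightarrow> vertex aroot \<Rightarrow> bool" where
  "arm_type i b \<longleftrightarrow> form (fst b) (fst b) = 2 * arm_value C \<kappa> i \<and> ef i dvd fst b Zero \<and> ef i dvd snd b \<and>
     (\<forall>j k. j \<noteq> i \<longrightarrow> int (sym_f C i) dvd fst b (Arm j k))"

text \<open>A generating reflection subtracts a multiple of a simple root, so only that multiple has to be divisible.\<close>

lemma arm_type_step:
  assumes i: "i \<in> {1..t}" and a: "a \<in> set (basis_list C)" and b: "arm_type i b"
  shows "arm_type i (arefl (gen a) b)"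
proof -
  let ?x = "fst b"
  have x: "ef i dvd ?x Zero" "ef i dvd snd b" "\<And>j k. j \<noteq> i \<Longrightarrow> int (sym_f C i) dvd ?x (Arm j k)"
    and norm: "form ?x ?x = 2 * arm_value C \<kappa> i" using b by (auto simp: arm_type_def)
  have f: "int (sym_f C i) dvd ?x Zero" using x(1) by (metis dvd_trans dvd_triv_right of_nat_mult)
  have norm': "form (fst (arefl (gen a) b)) (fst (arefl (gen a) b)) = 2 * arm_value C \<kappa> i"
    using form_refl[OF gen_root[OF a]] norm by simp
  have zero: "ef i dvd coroot Zero ?x"
  proof -
    have "ef i dvd ef j * ?x (Arm j 1)" for j
    proof (cases "j = i")
      case False
      then have "int (sym_f C i) dvd ?x (Arm j 1)" by (rule x(3))
      then have "int (sym_eps C) * int (sym_f C i) dvd int (sym_eps C) * (int (sym_f C j) * ?x (Arm j 1))"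
        by (intro mult_dvd_mono) auto
      then show ?thesis by (simp add: mult.assoc)
    qed simp
    then have "ef i dvd (\<Sum>j=1..t. ef j * ?x (Arm j 1))" by (intro dvd_sum)
    then show ?thesis unfolding coroot_zero using x(1) by (intro dvd_diff dvd_mult)
  qed
  show ?thesis
  proof (cases "a \<in> set (arms C)")
    case True
    then obtain j k where jk: "a = Arm j k" "j \<in> {1..t}" "k \<in> {1..<p j}" "a \<in> star C" by (rule arms_cases)
    have s: "arefl (gen a) b = (srefl a ?x, snd b)"
      using jk(4) True by (simp add: arefl_def gen_simps refl_simple)
    have "int (sym_f C i) dvd coroot a ?x" if "j \<noteq> i"
      unfolding jk(1) coroot_arm[OF jk(2,3)] using x(3)[OF that] f by (intro dvd_diff) auto
    then show ?thesis using norm' x unfolding s arm_type_def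
      by (auto simp: srefl_def simple_def jk(1) intro!: dvd_diff)
  next
    case False
    with a have "a = Zero \<or> a = ZeroStar" by (auto simp: basis_list_arms)
    then have s: "arefl (gen a) b = (srefl Zero ?x, snd b - coroot Zero ?x * snd (gen a))"
      by (auto simp: arefl_def gen_simps refl_simple Zero_star cor_simple)
    show ?thesis using norm' x zero unfolding s arm_type_def
      by (auto simp: srefl_def simple_def intro!: dvd_diff dvd_mult2)
  qed
qed

lemma aroots_type:
  "b \<in> aroots \<Longrightarrow> form (fst b) (fst b) = 2 * int \<kappa> \<or> (\<exists>i\<in>{1..t}. arm_type i b)"
proof (induction rule: aroots.induct)
  case (gen a)
  then consider "a \<in> set (arms C)" | "a = Zero \<or> a = ZeroStar" by (auto simp: basis_list_arms)
  then show ?case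
  proof cases
    case 1
    then obtain i j where ij: "a = Arm i j" "i \<in> {1..t}" "j \<in> {1..<p i}" "a \<in> star C" by (rule arms_cases)
    have "arm_type i (gen a)" using form_simple_simple[OF ij(4)] 1 unfolding arm_type_def
      by (simp add: gen_simps ij(1) simple_def)
    with ij(2) show ?thesis by blast
  next
    case 2
    then show ?thesis using form_simple_simple[OF Zero_star] by (auto simp: gen_simps)
  qed
next
  case (step b a)
  have eq: "form (fst (arefl (gen a) b)) (fst (arefl (gen a) b)) = form (fst b) (fst b)"
    using form_refl[OF gen_root[OF step.hyps(2)]] by simp
  from step.IH show ?case using arm_type_step[OF _ step.hyps(2)] unfolding eq by blast
qed

section \<open>Reaching the standard factorization\<close>

lemma aprod_pair: "root b \<Longrightarrow> aprod [(b, y), (b, z)] (x, m) = (x, m + cor b x * (y - z))"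
  by (simp add: arefl_def cor_refl algebra_simps)

lemma form_level:
  assumes "root b" shows "form level b = b Zero * int \<kappa> * coroot Zero level"
proof -
  have "form b level = (\<Sum>a\<in>star C. if a = Zero then b Zero * int \<kappa> * coroot Zero level else 0)"
    unfolding form_def
    by (intro sum.cong) (auto simp: coroot_level_arm elim!: star_cases)
  then show ?thesis using Zero_star finite_I by (simp add: form_commute)
qed

text \<open>Since \<open>level\<close> is orthogonal to the arms, its pairing with \<open>b\<close> is the coefficient of \<open>b\<close> at the centre
  times a known number, and the hypothesis becomes \<open>form b b = 2\<kappa> (b Zero) (z - y)\<close>. If \<open>form b b = 2\<kappa>\<close>,
  both integer factors are 1. Otherwise \<open>b\<close> is of arm type, and the divisibility of \<open>b Zero\<close>, \<open>y\<close> and \<open>z\<close>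
  leads back to \<open>form b b = 2\<kappa>\<close>.\<close>

lemma pair_root:
  assumes b: "(b, y) \<in> aroots" "(b, z) \<in> aroots" "pos b"
    and eq: "cor b level * (y - z) = - coroot Zero level"
  shows "b Zero = 1" "z = y + 1" "form b b = 2 * int \<kappa>"
proof -
  have r: "root b" using aroots_root[OF b(1)] by simp
  have b0: "b Zero \<ge> 0" using b(3) by (simp add: pos_def)
  have "cor b level * form b b * (y - z) = 2 * (b Zero * int \<kappa> * coroot Zero level) * (y - z)"
    unfolding cor_form[OF r] form_level[OF r] ..
  then have "(cor b level * (y - z)) * form b b = 2 * (b Zero * int \<kappa> * coroot Zero level) * (y - z)" by (simp only: mult_ac)
  then have "coroot Zero level * form b b = coroot Zero level * (2 * int \<kappa> * (b Zero * (z - y)))"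
    unfolding eq by (simp add: algebra_simps)
  then have norm: "form b b = 2 * int \<kappa> * (b Zero * (z - y))" using coroot_level_zero by simp
  have one: "b Zero = 1 \<and> z = y + 1" if "b Zero * (z - y) = 1"
    using that b0 by (auto simp: zmult_eq_1_iff)
  have arm: "b Zero = ef i \<and> z = y + 1" if i: "i \<in> {1..t}" "arm_type i (b, x)" for i x
  proof -
    from i(2) have u: "form b b = 2 * arm_value C \<kappa> i" and "ef i dvd b Zero" by (auto simp: arm_type_def)
    then obtain k where k: "b Zero = ef i * k" by (auto elim: dvdE)
    have g: "ef i > 0" using eps_pos f_pos[OF i(1)] by simp
    have "int \<kappa> * (ef i * 1) = arm_value C \<kappa> i * e i" using arm_value_e[OF i(1)] by simp
    also have "arm_value C \<kappa> i = int \<kappa> * (b Zero * (z - y))" using u norm by simp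
    finally have "ef i * 1 = b Zero * (z - y) * e i" using kappa_pos by (simp only: mult.assoc mult_cancel_left) simp
    then have "ef i * 1 = ef i * (k * (z - y) * e i)" unfolding k by (simp only: mult_ac)
    then have "k * (z - y) * e i = 1" using g by (metis mult_cancel_left less_irrefl)
    then have "k * ((z - y) * e i) = 1" by (simp only: mult.assoc)
    moreover have "k \<ge> 0" using b0 g unfolding k by (simp add: zero_le_mult_iff)
    ultimately have "k = 1" "(z - y) * e i = 1" by (auto simp: zmult_eq_1_iff)
    then show ?thesis using k by (auto simp: zmult_eq_1_iff)
  qed
  have b2: "form b b = 2 * int \<kappa>"
  proof (rule ccontr)
    assume "form b b \<noteq> 2 * int \<kappa>"
    then obtain i i' where i: "i \<in> {1..t}" "arm_type i (b, y)" and i': "i' \<in> {1..t}" "arm_type i' (b, z)"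
      using aroots_type[OF b(1)] aroots_type[OF b(2)] by auto
    have "ef i = ef i'" using arm[OF i] arm[OF i'] by metis
    moreover have "ef i dvd y" "ef i' dvd z" using i i' by (auto simp: arm_type_def)
    ultimately have "ef i dvd z - y" by (metis dvd_diff)
    then have "ef i = 1" using arm[OF i] by simp
    then have "b Zero * (z - y) = 1" using arm[OF i] by simp
    with norm \<open>form b b \<noteq> 2 * int \<kappa>\<close> show False by simp
  qed
  then have "b Zero * (z - y) = 1" using norm kappa_pos by simp
  with one b2 show "b Zero = 1" "z = y + 1" "form b b = 2 * int \<kappa>" by auto
qed

text \<open>Bring the pair next to the affine root \<open>u\<close> over \<open>\<alpha>\<^sub>a\<close>, move it to the other side of \<open>u\<close> by conjugating
  the pair, move it back by conjugating \<open>u\<close>, and return it to the end. Passing the pair changes only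
  second components of the arm roots, whereas the first move has applied \<open>s\<^sub>a\<close> to \<open>b\<close>.\<close>

lemma conjugate_pair:
  assumes "map fst us = map simple as" "a \<in> set as" "set as \<subseteq> star C" "root b"
  shows "\<exists>us' y'. hurwitz (us @ [(b, y), (b, y + 1)]) (us' @ [(srefl a b, y'), (srefl a b, y' + 1)]) \<and> map fst us' = map fst us"
proof -
  have a: "a \<in> star C" using assms by auto
  obtain ps qs where "as = ps @ a # qs" using assms(2) by (meson split_list)
  then obtain vs u ws where us: "us = vs @ u # ws" "fst u = simple a"
    using assms(1) by (auto simp: map_eq_append_conv map_eq_Cons_conv)
  let ?b = "srefl a b" let ?y = "y - cor (fst u) b * snd u"
  have u: "arefl u (b, x) = (?b, x - cor (fst u) b * snd u)" for x
    by (simp add: arefl_def us(2) refl_simple[OF a])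
  have rb: "root ?b" using root_act[OF assms(4), of "[a]"] a by simp
  obtain ws' where ws': "hurwitz (ws @ [(b, y), (b, y + 1)]) ((b, y) # (b, y + 1) # ws')" "map fst ws' = map fst ws"
    using hurwitz_pair_left[OF assms(4)] by blast
  let ?u = "arefl (?b, ?y) (arefl (?b, ?y + 1) u)"
  obtain ws'' where ws'': "hurwitz ((?b, ?y) # (?b, ?y + 1) # ws') (ws'' @ [(?b, ?y), (?b, ?y + 1)])" "map fst ws'' = map fst ws'"
    using hurwitz_pair_right[OF rb] by blast
  have "hurwitz (us @ [(b, y), (b, y + 1)]) ((vs @ [u]) @ (b, y) # (b, y + 1) # ws')"
    using hurwitz_context[OF ws'(1), of "vs @ [u]" "[]"] us by simp
  moreover have "hurwitz ((vs @ [u]) @ (b, y) # (b, y + 1) # ws') (vs @ (?b, ?y) # (?b, ?y + 1) # u # ws')"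
  proof -
    have "hurwitz [u, (b, y), (b, y + 1)] [arefl u (b, y), u, (b, y + 1)]"
      using hurwitz.left[of _ "[]" u "(b, y)" "[(b, y + 1)]"] by (simp add: hurwitz.start)
    then have "hurwitz [u, (b, y), (b, y + 1)] [arefl u (b, y), arefl u (b, y + 1), u]"
      using hurwitz.left[of _ "[arefl u (b, y)]" u "(b, y + 1)" "[]"] by simp
    from hurwitz_context[OF this, of vs ws'] show ?thesis by (simp add: u algebra_simps)
  qed
  moreover have "hurwitz (vs @ (?b, ?y) # (?b, ?y + 1) # u # ws') (vs @ ?u # (?b, ?y) # (?b, ?y + 1) # ws')"
    using hurwitz_context[OF hurwitz_move_left[of "[(?b, ?y), (?b, ?y + 1)]" u], of vs ws'] by simp
  moreover have "hurwitz (vs @ ?u # (?b, ?y) # (?b, ?y + 1) # ws') ((vs @ ?u # ws'') @ [(?b, ?y), (?b, ?y + 1)])"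
    using hurwitz_context[OF ws''(1), of "vs @ [?u]" "[]"] by simp
  ultimately have "hurwitz (us @ [(b, y), (b, y + 1)]) ((vs @ ?u # ws'') @ [(?b, ?y), (?b, ?y + 1)])"
    using hurwitz_trans by blast
  moreover have "map fst (vs @ ?u # ws'') = map fst us" using us ws'(2) ws''(2) rb by simp
  ultimately show ?thesis by blast
qed

text \<open>Write \<open>b = \<alpha>\<^sub>0 + v\<close> with \<open>v \<ge> 0\<close> supported on the arms. Expanding \<open>(b, b)\<close> in its first argument, all terms from
  the arms are nonpositive. As \<open>(b, b) = 2\<kappa>\<close>, this forces \<open>v\<close> to vanish next to the centre. Then \<open>v\<close> itself
  pairs nonpositively with all arm vectors, and pairing it with the weights gives \<open>v \<le> 0\<close>.\<close>

lemma antidominant_root: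
  assumes b: "root b" "pos b" "b Zero = 1" "form b b = 2 * int \<kappa>"
    and anti: "\<And>a. a \<in> set (arms C) \<Longrightarrow> coroot a b \<le> 0"
  shows "b = simple Zero"
proof -
  have nn: "b a \<ge> 0" for a using b(2) by (simp add: pos_def)
  have D: "star_norm C \<kappa> a > 0" if "a \<in> set (arms C)" for a using D_pos arms_star that by auto
  have notin: "Zero \<notin> set (arms C)" by (simp add: set_arms)
  have "2 * int \<kappa> = int \<kappa> * coroot Zero b + (\<Sum>a\<in>set (arms C). b a * star_norm C \<kappa> a * coroot a b)"
  proof -
    have "sum g (star C) = g Zero + sum g (set (arms C))" for g :: "vertex \<Rightarrow> int"
      using notin by (simp add: star_arms)
    then show ?thesis using b(3,4) unfolding form_def by simp
  qed
  also have "(\<Sum>a\<in>set (arms C). b a * star_norm C \<kappa> a * coroot a b) \<le> 0"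
    using nn D anti by (intro sum_nonpos) (metis mult_nonneg_nonpos mult_nonneg_nonneg order_less_imp_le)
  finally have "int \<kappa> * 2 \<le> int \<kappa> * coroot Zero b" by simp
  then have "(\<Sum>i=1..t. ef i * b (Arm i 1)) \<le> 0"
    using kappa_pos b(3) by (simp add: coroot_zero)
  moreover have "ef i * b (Arm i 1) \<ge> 0" for i using nn by simp
  ultimately have z: "ef i * b (Arm i 1) = 0" if "i \<in> {1..t}" for i
    using that sum_nonneg_eq_0_iff[of "{1..t}" "\<lambda>i. ef i * b (Arm i 1)"] by (meson antisym finite_atLeastAtMost sum_nonneg)
  then have first: "b (Arm i 1) = 0" if "i \<in> {1..t}" for i
    using z[OF that] eps_pos f_pos[OF that] by simp
  define v where "v a = (if a = Zero then 0 else b a)" for a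
  have v: "coroot a v \<le> 0" if a: "a \<in> set (arms C)" for a
  proof -
    obtain i j where ij: "a = Arm i j" "i \<in> {1..t}" "j \<in> {1..<p i}" using arms_cases[OF a] by metis
    show ?thesis
    proof (cases "j = 1")
      case True
      then show ?thesis unfolding ij(1) coroot_arm[OF ij(2,3)] using first[OF ij(2)] nn by (simp add: v_def)
    next
      case False
      then have "coroot a v = coroot a b" unfolding ij(1) coroot_arm[OF ij(2,3)] by (simp add: v_def)
      then show ?thesis using anti[OF a] by simp
    qed
  qed
  have "b a = 0" if a: "a \<in> set (arms C)" for a
  proof -
    obtain i j where ij: "a = Arm i j" "i \<in> {1..t}" "j \<in> {1..<p i}" using arms_cases[OF a] by metis
    have "form v (weight i j) = b a * star_norm C \<kappa> a * int (p i)"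
    proof -
      have "form v (weight i j) = (\<Sum>c\<in>star C. if c = a then b a * star_norm C \<kappa> a * int (p i) else 0)"
        unfolding form_def
        by (intro sum.cong) (auto simp: v_def coroot_weight[OF ij(2,3)] ij(1) elim!: star_cases)
      then show ?thesis using a arms_star finite_I by auto
    qed
    moreover have "form (weight i j) v \<le> 0" unfolding form_def
    proof (rule sum_nonpos)
      fix c assume "c \<in> star C"
      then consider "c = Zero" | "c \<in> set (arms C)" by (auto simp: star_arms)
      then show "weight i j c * star_norm C \<kappa> c * coroot c v \<le> 0"
      proof cases
        case 2
        have "weight i j c \<ge> 0" by (simp add: weight_def split: vertex.split)
        with D[OF 2] have "weight i j c * star_norm C \<kappa> c \<ge> 0" by simp
        then show ?thesis using v[OF 2] by (rule mult_nonneg_nonpos)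
      qed (simp add: weight_def)
    qed
    ultimately have "b a * (star_norm C \<kappa> a * int (p i)) \<le> 0" by (simp add: form_commute mult.assoc)
    moreover have "star_norm C \<kappa> a * int (p i) > 0" using D[OF a] p_ge[OF ij(2)] by simp
    ultimately have "b a \<le> 0" by (metis mult_pos_pos not_less)
    then show ?thesis using nn[of a] by simp
  qed
  then show ?thesis using b(3) root_outside[OF b(1)] by (auto simp: fun_eq_iff simple_def star_arms)
qed

text \<open>Reflecting in an arm vector that pairs positively with \<open>b\<close> lowers the height of \<open>b\<close>, and \<open>b\<close> stays
  positive because its coefficient at the centre is 1.\<close>

lemma pair_to_zero:
  assumes "map fst us = map simple (arms C)" "root b" "pos b" "b Zero = 1" "form b b = 2 * int \<kappa>"
  shows "\<exists>us' y'. hurwitz (us @ [(b, y), (b, y + 1)]) (us' @ [(simple Zero, y'), (simple Zero, y' + 1)]) \<and>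
    map fst us' = map simple (arms C)"
  using assms
proof (induction "nat (ht b)" arbitrary: b us y rule: less_induct)
  case less
  show ?case
  proof (cases "\<exists>a\<in>set (arms C). coroot a b > 0")
    case False
    then have "b = simple Zero" using less.prems by (intro antidominant_root) (auto simp: not_less)
    then show ?thesis using less.prems hurwitz.start by blast
  next
    case True
    then obtain a where a: "a \<in> set (arms C)" "coroot a b > 0" by blast
    then have aI: "a \<in> star C" and a0: "a \<noteq> Zero" using arms_star by (auto simp: set_arms)
    let ?b = "srefl a b"
    have b0: "?b Zero = 1" using less.prems(4) a0 by (simp add: srefl_def simple_def)
    have "b \<noteq> simple a" using less.prems(4) a0 by (auto simp: simple_def)
    then have pos: "pos ?b" using srefl_pos less.prems(2,3) aI by blast
    have root: "root ?b" using root_act[OF less.prems(2), of "[a]"] aI by simp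
    have norm: "form ?b ?b = 2 * int \<kappa>" using form_srefl[OF aI] less.prems(5) by simp
    have "ht (simple a) = 1" using aI finite_I by (simp add: ht_def simple_def)
    then have "ht ?b = ht b - coroot a b" by (simp add: srefl_def ht_diff)
    then have lt: "nat (ht ?b) < nat (ht b)" using a(2) ht_pos[OF pos] ht_pos[OF less.prems(3)] by simp
    obtain us' y' where us': "hurwitz (us @ [(b, y), (b, y + 1)]) (us' @ [(?b, y'), (?b, y' + 1)])" "map fst us' = map fst us"
      using conjugate_pair[OF less.prems(1) a(1) arms_star less.prems(2)] by blast
    have "map fst us' = map simple (arms C)" using us'(2) less.prems(1) by simp
    from less.hyps[OF lt this root pos b0 norm] hurwitz_trans[OF us'(1)] show ?thesis by blast
  qed
qed

text \<open>The product of the two reflections is a transvection in the direction of the extra coordinate. Two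
  Hurwitz moves conjugate the pair by it, and a single one already shifts \<open>y\<close> by 1.\<close>

lemma shift_pair:
  assumes b: "root b"
  shows "hurwitz [(b, y), (b, y + 1)] [(b, z), (b, z + 1)]"
proof -
  have neg: "aneg (\<lambda>j. - b j, - x) = (b, x)" for x by (simp add: aneg_def)
  have up: "hurwitz [(b, x), (b, x + 1)] [(b, x + 1), (b, x + 1 + 1)]" for x
  proof -
    have "hurwitz [(b, x), (b, x + 1)] [(b, x + 1), arefl (b, x + 1) (b, x)]"
      using hurwitz.right[of _ "[]" "(b, x)" "(b, x + 1)" "[]"] by (simp add: hurwitz.start)
    moreover have "arefl (b, x + 1) (b, x) = (\<lambda>j. - b j, - (x + 2))" using b by (simp add: arefl_def)
    ultimately have "hurwitz [(b, x), (b, x + 1)] [(b, x + 1), aneg (\<lambda>j. - b j, - (x + 2))]"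
      using hurwitz.sign[of _ "[(b, x + 1)]" "(\<lambda>j. - b j, - (x + 2))" "[]"] by simp
    then show ?thesis unfolding neg by (simp add: add.assoc)
  qed
  have down: "hurwitz [(b, x), (b, x + 1)] [(b, x - 1), (b, x - 1 + 1)]" for x
  proof -
    have "hurwitz [(b, x), (b, x + 1)] [arefl (b, x) (b, x + 1), (b, x)]"
      using hurwitz.left[of _ "[]" "(b, x)" "(b, x + 1)" "[]"] by (simp add: hurwitz.start)
    moreover have "arefl (b, x) (b, x + 1) = (\<lambda>j. - b j, - (x - 1))" using b by (simp add: arefl_def)
    ultimately have "hurwitz [(b, x), (b, x + 1)] [aneg (\<lambda>j. - b j, - (x - 1)), (b, x)]"
      using hurwitz.sign[of _ "[]" "(\<lambda>j. - b j, - (x - 1))" "[(b, x)]"] by simp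
    then show ?thesis unfolding neg by simp
  qed
  show ?thesis
  proof (cases "y \<le> z")
    case True
    then show ?thesis
    proof (induction z rule: int_ge_induct)
      case (step z) then show ?case using up[of z] hurwitz_trans by blast
    qed (rule hurwitz.start)
  next
    case False
    then have "z \<le> y" by simp
    then show ?thesis
    proof (induction z rule: int_le_induct)
      case (step z) then show ?case using down[of z] hurwitz_trans by blast
    qed (rule hurwitz.start)
  qed
qed

lemma aprod_fix:
  assumes "map fst us = map simple as" "set as \<subseteq> set (arms C)" "\<And>a. a \<in> set as \<Longrightarrow> coroot a x = 0"
  shows "aprod us (x, m) = (x, m)"
  using assms
proof (induction us arbitrary: "as")
  case (Cons u us)
  then obtain a as' where a: "as = a # as'" "fst u = simple a" "a \<in> set (arms C)" "map fst us = map simple as'" by auto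
  then have "aprod us (x, m) = (x, m)" using Cons.IH[of as'] Cons.prems by auto
  moreover have "coroot a x = 0" using Cons.prems(3) a(1) by simp
  ultimately show ?case using a arms_star by (auto simp: arefl_def cor_simple refl_def)
qed simp

text \<open>Test the equality on the weight of the first arm root: all later reflections fix it, so the first
  second component vanishes. Then cancel the first reflection.\<close>

lemma arm_shifts_zero:
  assumes "map fst us = map simple as" "set as \<subseteq> set (arms C)" "distinct as"
    and "\<And>x m. (\<And>a. a \<notin> star C \<Longrightarrow> x a = 0) \<Longrightarrow> aprod us (x, m) = aprod (map (\<lambda>a. (simple a, 0)) as) (x, m)"
  shows "us = map (\<lambda>a. (simple a, 0)) as"
  using assms
proof (induction us arbitrary: "as")
  case (Cons u us)
  then obtain a as' where a: "as = a # as'" "fst u = simple a" "a \<in> set (arms C)" "map fst us = map simple as'" by auto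
  then obtain i j where ij: "a = Arm i j" "i \<in> {1..t}" "j \<in> {1..<p i}" "a \<in> star C" using arms_cases by blast
  have root: "root (simple a)" using root_simple ij(4) by blast
  have fix0: "coroot a' (weight i j) = 0" if "a' \<in> set as'" for a'
    using that Cons.prems(2,3) coroot_weight[OF ij(2,3), of a'] unfolding a(1) ij(1) by auto
  have as': "map fst (map (\<lambda>a. (simple a, 0::int)) as') = map simple as'" by simp
  have s': "set as' \<subseteq> set (arms C)" using Cons.prems(2) a(1) by simp
  have "arefl u (weight i j, 0) = arefl (simple a, 0) (weight i j, 0)"
    using Cons.prems(4)[of "weight i j" 0] weight_outside[OF ij(2)]
      aprod_fix[OF a(4) s' fix0] aprod_fix[OF as' s' fix0] a(1) by simp
  then have "cor (simple a) (weight i j) * snd u = 0" using a(2) by (simp add: arefl_def)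
  moreover have "cor (simple a) (weight i j) = int (p i)"
    using coroot_weight[OF ij(2,3) a(3)] ij by (simp add: cor_simple)
  ultimately have "snd u = 0" using p_ge[OF ij(2)] by simp
  with a(2) have u: "u = (simple a, 0)" by (simp add: prod_eq_iff)
  have "aprod us (x, m) = aprod (map (\<lambda>a. (simple a, 0)) as') (x, m)"
    if "\<And>a. a \<notin> star C \<Longrightarrow> x a = 0" for x m
  proof -
    have "arefl u (arefl u (aprod us (x, m))) = arefl u (arefl u (aprod (map (\<lambda>a. (simple a, 0)) as') (x, m)))"
      using Cons.prems(4)[where x = x and m = m, OF that] unfolding a(1) u by simp
    then show ?thesis using root a(2) by simp
  qed
  from Cons.IH[OF a(4) s' _ this] show ?case using Cons.prems(3) u a(1) by simp
qed simp

text \<open>The normal form modulo the extra coordinate leaves at most one pair, for reasons of length, and at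
  least one, since the arm reflections alone do not move \<open>level\<close>. The previous lemmas standardise the
  pair and then the arm roots.\<close>

theorem hurwitz_to_standard:
  assumes bs: "set bs \<subseteq> aroots" "length bs \<le> length (basis_list C)"
    and eq: "\<And>x m. (\<And>a. a \<notin> star C \<Longrightarrow> x a = 0) \<Longrightarrow> aprod bs (x, m) = aprod (map gen (basis_list C)) (x, m)"
  shows "hurwitz bs (map gen (basis_list C))"
proof -
  have r: "roots bs" using bs(1) aroots_root by auto
  have root0: "root (simple Zero)" by (rule root_simple[OF Zero_star])
  let ?arms = "map (\<lambda>a. (simple a, 0::int)) (arms C)"
  let ?pair = "[(simple Zero, 0), (simple Zero, 1)]"
  have std: "aprod (map gen (basis_list C)) (x, m) = aprod ?arms (x, m - coroot Zero x)" for x m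
    unfolding map_gen_basis aprod_simps(3) aprod_pair[OF root0] by (simp add: cor_simple Zero_star)
  have lprod_arms: "lprod ?arms x = act (arms C) x" for x
  proof -
    have "lprod (map (\<lambda>a. (simple a, 0::int)) as) x = act as x" if "set as \<subseteq> star C" for "as"
      using that by (induction "as") (auto simp: refl_simple)
    then show ?thesis using arms_star by blast
  qed
  obtain ws where ws: "set ws \<subseteq> star C" "lprod bs = act ws" using lprod_word[OF r] .
  have "act ws = act (arms C)"
  proof (rule act_eqI_supported[OF ws(1) arms_star])
    fix x :: "vertex \<Rightarrow> int" assume "\<And>a. a \<notin> star C \<Longrightarrow> x a = 0"
    from arg_cong[OF eq[where x = x and m = 0, OF this], of fst]
    show "act ws x = act (arms C) x" unfolding std by (simp add: fst_aprod ws(2) lprod_arms)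
  qed
  with ws(2) have "lprod bs = act (arms C)" by simp
  from hurwitz_normal_form[OF r arms_star distinct_arms this] obtain us qs where
    h: "hurwitz bs (us @ paired qs)" "map fst us = map simple (arms C)" "\<forall>(b, y, z)\<in>set qs. root b \<and> pos b" by blast
  have len: "length (us @ paired qs) \<le> length (arms C) + 2" using hurwitz_length[OF h(1)] bs(2) by (simp add: basis_list_arms)
  have lus: "length us = length (arms C)" using h(2) by (metis length_map)
  have level: "aprod (us @ paired qs) (level, 0) = (level, - coroot Zero level)"
  proof -
    have "aprod (us @ paired qs) (level, 0) = aprod ?arms (level, - coroot Zero level)"
      using hurwitz_aprod[OF h(1) r] eq[of level 0] std[of level 0] by (simp add: level_def)
    also have "\<dots> = (level, - coroot Zero level)"
      by (rule aprod_fix[of _ "arms C"]) (simp_all add: coroot_level_arm)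
    finally show ?thesis .
  qed
  have us_level: "aprod us (level, m) = (level, m)" for m
    by (rule aprod_fix[OF h(2)]) (simp_all add: coroot_level_arm)
  consider "qs = []" | q where "qs = [q]" | q q' qs' where "qs = q # q' # qs'"
    by (metis list.exhaust)
  then obtain b y z where qs: "qs = [(b, y, z)]"
  proof cases
    case 1
    then show ?thesis using level us_level[of 0] coroot_level_zero by (simp add: paired_def)
  next
    case 2
    with that show ?thesis by (cases q) auto
  next
    case 3
    then have "length (paired qs) \<ge> 4" by (simp add: paired_def split_beta)
    with len lus show ?thesis by simp
  qed
  have paired: "paired qs = [(b, y), (b, z)]" by (simp add: qs paired_def)
  have b: "root b" "pos b" using h(3) qs by auto
  have in_aroots: "(b, y) \<in> aroots" "(b, z) \<in> aroots" using hurwitz_aroots[OF h(1) bs(1)] paired by auto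
  have "cor b level * (y - z) = - coroot Zero level"
    using level us_level aprod_pair[OF b(1)] unfolding paired aprod_simps(3) by simp
  note pair = pair_root[OF in_aroots b(2) this]
  obtain us' y' where us': "hurwitz (us @ [(b, y), (b, y + 1)]) (us' @ [(simple Zero, y'), (simple Zero, y' + 1)])"
    "map fst us' = map simple (arms C)" using pair_to_zero[OF h(2) b pair(1,3)] by blast
  have "hurwitz (us' @ [(simple Zero, y'), (simple Zero, y' + 1)]) (us' @ ?pair)"
    using hurwitz_context[OF shift_pair[OF root0, of y' 0], of us' "[]"] by simp
  then have h': "hurwitz bs (us' @ ?pair)"
    using h(1) us'(1) hurwitz_trans unfolding paired pair(2) by blast
  have "us' = ?arms"
  proof (rule arm_shifts_zero[OF us'(2) _ distinct_arms])
    fix x :: "vertex \<Rightarrow> int" and m :: int assume x: "\<And>a. a \<notin> star C \<Longrightarrow> x a = 0"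
    have "aprod us' (x, m) = aprod (us' @ ?pair) (x, m + coroot Zero x)"
      unfolding aprod_simps(3) aprod_pair[OF root0] by (simp add: cor_simple Zero_star)
    also have "\<dots> = aprod ?arms (x, m)"
      using hurwitz_aprod[OF h' r] eq[OF x] std by simp
    finally show "aprod us' (x, m) = aprod ?arms (x, m)" .
  qed simp
  with h' show ?thesis by (simp add: map_gen_basis)
qed

end

section \<open>From affine roots to the reflection group\<close>

context canonical
begin

abbreviation "\<Gamma> \<equiv> carrier (can_lattice C)"
abbreviation "W \<equiv> reflection_group C \<kappa>"

text \<open>Coordinates of a lattice vector with respect to the star and \<open>a/\<epsilon>\<close>, using
  \<open>\<alpha>\<^bsub>0*\<^esub> = \<epsilon> \<alpha>\<^sub>0 + \<epsilon> (a/\<epsilon>)\<close>.\<close>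

definition emb :: "(vertex \<Rightarrow>\<^sub>0 int) \<Rightarrow> vertex aroot" where
  "emb x = (\<lambda>a. if a = ZeroStar then 0
      else Poly_Mapping.lookup x a + (if a = Zero then int (sym_eps C) * Poly_Mapping.lookup x ZeroStar else 0),
    int (sym_eps C) * Poly_Mapping.lookup x ZeroStar)"

lemma lattice_iff: "x \<in> \<Gamma> \<longleftrightarrow> Poly_Mapping.keys x \<subseteq> set (basis_list C)"
  by (simp add: can_lattice_def)

lemma basis_star: "set (basis_list C) = insert ZeroStar (star C)"
  by (auto simp: star_def basis_list_arms)

lemma emb_inj: "emb x = emb y \<Longrightarrow> x = y"
proof (rule poly_mapping_eqI)
  fix a assume eq: "emb x = emb y"
  then have s: "Poly_Mapping.lookup x ZeroStar = Poly_Mapping.lookup y ZeroStar"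
    using eps_pos by (simp add: emb_def)
  have "fst (emb x) a = fst (emb y) a" using eq by simp
  with s show "Poly_Mapping.lookup x a = Poly_Mapping.lookup y a" by (cases "a = ZeroStar"; cases "a = Zero") (auto simp: emb_def)
qed

lemma emb_diff: "emb (x - frag_cmul k y) = (\<lambda>a. fst (emb x) a - k * fst (emb y) a, snd (emb x) - k * snd (emb y))"
  by (auto simp: emb_def lookup_minus algebra_simps)

lemma emb_simple: "a \<in> star C \<Longrightarrow> emb (frag_of a) = (simple a, 0)"
  by (auto simp: emb_def simple_def star_def lookup_frag_of)

lemma emb_zero_star: "emb (frag_of ZeroStar) = (\<lambda>a. int (sym_eps C) * simple Zero a, int (sym_eps C))"
  by (auto simp: emb_def simple_def lookup_frag_of)

lemma emb_surj:
  assumes "\<And>a. a \<notin> star C \<Longrightarrow> v a = 0"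
  shows "\<exists>x\<in>\<Gamma>. emb x = (v, 0)"
proof -
  have fin: "finite {a. v a \<noteq> 0}" using assms finite_I by (metis (mono_tags, lifting) mem_Collect_eq rev_finite_subset subsetI)
  define x where "x = Poly_Mapping.Abs_poly_mapping v"
  have l: "Poly_Mapping.lookup x = v" unfolding x_def using fin by (rule lookup_Abs_poly_mapping)
  have z: "v ZeroStar = 0" using assms by (simp add: star_def)
  have "x \<in> \<Gamma>" unfolding lattice_iff basis_star using assms by (auto simp: in_keys_iff l)
  moreover have "emb x = (v, 0)" by (auto simp: emb_def l z)
  ultimately show ?thesis by blast
qed

lemma basis_form_star:
  assumes a: "a \<in> star C" and b: "b \<in> star C"
  shows "basis_form C \<kappa> b a + basis_form C \<kappa> a b = star_norm C \<kappa> a * star_cartan C a b"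
  using a b
proof (elim star_cases)
  fix i j assume "a = Arm i j" "i \<in> {1..t}" "b = Zero"
  then show ?thesis using arm_value_e[of i] by (simp add: mult_ac)
next
  fix i j assume "a = Zero" "b = Arm i j" "i \<in> {1..t}"
  then show ?thesis by simp
qed auto

lemma basis_form_zero_star:
  assumes "b \<in> set (basis_list C)"
  shows "basis_form C \<kappa> b ZeroStar + basis_form C \<kappa> ZeroStar b = int (sym_eps C) * (basis_form C \<kappa> b Zero + basis_form C \<kappa> Zero b)"
  by (cases b) (simp_all add: power2_eq_square)

text \<open>The vector \<open>a\<close> is in the radical.\<close>

lemma sym_form_zero_star:
  assumes "x \<in> \<Gamma>"
  shows "sym_form C \<kappa> x (frag_of ZeroStar) = int (sym_eps C) * sym_form C \<kappa> x (frag_of Zero)"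
  using assms[unfolded lattice_iff]
proof (induction x rule: frag_induction)
  case zero
  then show ?case by (simp add: sym_form_def euler_form_def)
next
  case (one b)
  then show ?case using basis_form_zero_star by (simp add: sym_form_def)
next
  case (diff x y)
  then show ?case by (simp add: sym_form_diff right_diff_distrib)
qed

lemma sym_form_emb:
  assumes "x \<in> \<Gamma>" "a \<in> star C"
  shows "sym_form C \<kappa> x (frag_of a) = star_norm C \<kappa> a * coroot a (fst (emb x))"
  using assms(1)[unfolded lattice_iff]
proof (induction x rule: frag_induction)
  case zero
  have "fst (emb 0) = (\<lambda>_. 0)" by (simp add: emb_def fun_eq_iff)
  then show ?case by (simp add: sym_form_def euler_form_def coroot_def)
next
  case (one b)
  show ?case
  proof (cases "b = ZeroStar")
    case True
    have "sym_form C \<kappa> (frag_of b) (frag_of a) = int (sym_eps C) * sym_form C \<kappa> (frag_of Zero) (frag_of a)"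
      unfolding True using sym_form_zero_star[of "frag_of a"] assms(2)
      by (simp add: sym_form_commute[of C \<kappa> "frag_of a"] lattice_iff basis_star)
    also have "sym_form C \<kappa> (frag_of Zero) (frag_of a) = star_norm C \<kappa> a * star_cartan C a Zero"
      using basis_form_star[OF assms(2) Zero_star] by (simp add: sym_form_def)
    finally show ?thesis
      using coroot_diff[of a "\<lambda>_. 0" "- int (sym_eps C)" "simple Zero"] Zero_star
      by (simp add: True emb_zero_star coroot_def[of a "\<lambda>_. 0"])
  next
    case False
    then have "b \<in> star C" using one by (simp add: basis_star)
    then show ?thesis using basis_form_star[OF assms(2), of b] by (simp add: sym_form_def emb_simple)
  qed
next
  case (diff x y)
  have "emb (x - y) = emb (x - frag_cmul 1 y)" by simp
  then have "coroot a (fst (emb (x - y))) = coroot a (fst (emb x)) - coroot a (fst (emb y))"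
    unfolding emb_diff using coroot_diff[of a "fst (emb x)" 1 "fst (emb y)"] by simp
  then show ?case using diff by (simp add: sym_form_diff right_diff_distrib)
qed

lemma emb_simple_reflection:
  assumes a: "a \<in> set (basis_list C)" and x: "x \<in> \<Gamma>"
  shows "emb (simple_reflection C \<kappa> a x) = arefl (gen a) (emb x)"
proof -
  define k where "k = 2 * sym_form C \<kappa> x (frag_of a) div sym_form C \<kappa> (frag_of a) (frag_of a)"
  have s: "simple_reflection C \<kappa> a x = x - frag_cmul k (frag_of a)"
    using x by (simp add: simple_reflection_def k_def)
  show ?thesis
  proof (cases "a = ZeroStar")
    case False
    then have aI: "a \<in> star C" using a by (simp add: basis_star)
    then have aL: "frag_of a \<in> \<Gamma>" by (simp add: lattice_iff basis_star)
    have "k = coroot a (fst (emb x))"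
      unfolding k_def sym_form_emb[OF x aI] sym_form_emb[OF aL aI] using D_pos[OF aI] aI A_diag[OF aI]
      by (simp add: emb_simple)
    then show ?thesis unfolding s emb_diff using aI False
      by (simp add: emb_simple gen_def arefl_def refl_simple srefl_def)
  next
    case True
    let ?e = "int (sym_eps C)" and ?q = "coroot Zero (fst (emb x))"
    have 1: "sym_form C \<kappa> x (frag_of a) = ?e * (int \<kappa> * ?q)"
      unfolding True sym_form_zero_star[OF x] sym_form_emb[OF x Zero_star] by simp
    have 2: "sym_form C \<kappa> (frag_of a) (frag_of a) = 2 * int \<kappa> * ?e * ?e"
      unfolding True by (simp add: sym_form_def power2_eq_square)
    \<comment> \<open>Integrality of the reflection in \<open>\<alpha>\<^bsub>0*\<^esub>\<close> says that \<open>\<epsilon>\<close> divides the pairing with the coroot of \<open>\<alpha>\<^sub>0\<close>.\<close>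
    have "2 * int \<kappa> * ?e * ?e dvd 2 * (?e * (int \<kappa> * ?q))"
      using sym_form_integral[OF symbol scale a x] unfolding 1 2 .
    then obtain l where "2 * (?e * (int \<kappa> * ?q)) = 2 * int \<kappa> * ?e * ?e * l" by (rule dvdE)
    then have "2 * int \<kappa> * ?e * ?q = 2 * int \<kappa> * ?e * (?e * l)" by (simp add: mult_ac)
    then have q: "?q = ?e * l" using kappa_pos eps_pos by simp
    have "k = l" unfolding k_def 1 2 q using kappa_pos eps_pos by (simp add: mult_ac)
    then show ?thesis unfolding s emb_diff using q
      by (simp add: True emb_zero_star gen_def arefl_def refl_simple srefl_def Zero_star cor_simple mult_ac)
  qed
qed

interpretation I: group "isometry_group C \<kappa>" by (rule group_isometry_group)

lemma group_W: "group W"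
  unfolding reflection_group_def by simp

interpretation W: group W by (rule group_W)

lemma W_isometry: "g \<in> carrier W \<Longrightarrow> g \<in> carrier (isometry_group C \<kappa>)"
  using I.carrier_subgroup_generated_subset unfolding reflection_group_def by blast

lemma W_Bij: "g \<in> carrier W \<Longrightarrow> g \<in> Bij \<Gamma>"
  using W_isometry by (auto simp: isometry_group_def auto_def)

lemma W_closed: "g \<in> carrier W \<Longrightarrow> x \<in> \<Gamma> \<Longrightarrow> g x \<in> \<Gamma>"
  using W_Bij Bij_imp_funcset by blast

lemma W_mult: "g \<in> carrier W \<Longrightarrow> h \<in> carrier W \<Longrightarrow> x \<in> \<Gamma> \<Longrightarrow> (g \<otimes>\<^bsub>W\<^esub> h) x = g (h x)"
  using W_Bij[of g] W_Bij[of h]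
  by (simp add: reflection_group_def isometry_group_def AutoGroup_def BijGroup_def compose_def)

lemma W_one: "x \<in> \<Gamma> \<Longrightarrow> \<one>\<^bsub>W\<^esub> x = x"
  by (simp add: reflection_group_def isometry_group_def AutoGroup_def BijGroup_def)

lemma W_eqI:
  assumes "g \<in> carrier W" "h \<in> carrier W" "\<And>x. x \<in> \<Gamma> \<Longrightarrow> emb (g x) = emb (h x)"
  shows "g = h"
  using assms W_Bij[THEN Bij_imp_extensional] emb_inj by (intro extensionalityI[of g \<Gamma> h]) auto

lemma simple_reflection_W: "a \<in> set (basis_list C) \<Longrightarrow> simple_reflection C \<kappa> a \<in> carrier W"
  using I.subgroup_generated_subset_carrier_subset[of "simple_reflection C \<kappa> ` set (basis_list C)"]
    simple_reflection_in_isometry_group[OF symbol scale] unfolding reflection_group_def by blast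

text \<open>The relation is not symmetric in its arguments: \<open>b\<close> and \<open>aneg b\<close> represent the same reflection, but an
  affine root represents at most one (\<open>represents_unique\<close>).\<close>

definition represents :: "((vertex \<Rightarrow>\<^sub>0 int) \<Rightarrow> (vertex \<Rightarrow>\<^sub>0 int)) \<Rightarrow> vertex aroot \<Rightarrow> bool" where
  "represents g b \<longleftrightarrow> g \<in> carrier W \<and> b \<in> aroots \<and> (\<forall>x\<in>\<Gamma>. emb (g x) = arefl b (emb x))"

lemma represents_simple: "a \<in> set (basis_list C) \<Longrightarrow> represents (simple_reflection C \<kappa> a) (gen a)"
  unfolding represents_def using simple_reflection_W aroots.gen emb_simple_reflection by blast

lemma represents_unique: "represents g b \<Longrightarrow> represents h b \<Longrightarrow> g = h"
  unfolding represents_def by (intro W_eqI) auto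

lemma represents_list_unique: "list_all2 represents gs bs \<Longrightarrow> list_all2 represents hs bs \<Longrightarrow> gs = hs"
proof (induction gs bs arbitrary: hs rule: list_all2_induct)
  case (Cons g gs b bs)
  from Cons.prems obtain h hs' where "hs = h # hs'" "represents h b" "list_all2 represents hs' bs"
    unfolding list_all2_Cons2 by blast
  with Cons show ?case using represents_unique[of g b h] by simp
qed simp

lemma represents_inv:
  assumes "represents g b" shows "inv\<^bsub>W\<^esub> g = g"
proof -
  from assms have g: "g \<in> carrier W" "root (fst b)" "\<And>x. x \<in> \<Gamma> \<Longrightarrow> emb (g x) = arefl b (emb x)"
    using aroots_root by (auto simp: represents_def)
  have "g \<otimes>\<^bsub>W\<^esub> g = \<one>\<^bsub>W\<^esub>"
    using g by (intro W_eqI) (simp_all add: W_mult W_closed W_one)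
  then show ?thesis using g(1) by (simp add: W.inv_equality)
qed

text \<open>Reflections are involutions, so conjugation by \<open>g\<close> and by its inverse is the same; both Hurwitz letters are covered.\<close>

lemma represents_conj:
  assumes "represents g b" "represents h c"
  shows "represents (g \<otimes>\<^bsub>W\<^esub> h \<otimes>\<^bsub>W\<^esub> inv\<^bsub>W\<^esub> g) (arefl b c)" "represents (inv\<^bsub>W\<^esub> g \<otimes>\<^bsub>W\<^esub> h \<otimes>\<^bsub>W\<^esub> g) (arefl b c)"
proof -
  have *: "g \<in> carrier W" "h \<in> carrier W" "b \<in> aroots" "c \<in> aroots"
    "\<And>x. x \<in> \<Gamma> \<Longrightarrow> emb (g x) = arefl b (emb x)" "\<And>x. x \<in> \<Gamma> \<Longrightarrow> emb (h x) = arefl c (emb x)"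
    using assms by (auto simp: represents_def)
  have "represents (g \<otimes>\<^bsub>W\<^esub> h \<otimes>\<^bsub>W\<^esub> g) (arefl b c)"
    unfolding represents_def using * aroots_closed arefl_conj[OF aroots_root aroots_root, OF *(3,4)]
    by (simp add: W_mult W_closed)
  then show "represents (g \<otimes>\<^bsub>W\<^esub> h \<otimes>\<^bsub>W\<^esub> inv\<^bsub>W\<^esub> g) (arefl b c)" "represents (inv\<^bsub>W\<^esub> g \<otimes>\<^bsub>W\<^esub> h \<otimes>\<^bsub>W\<^esub> g) (arefl b c)"
    using represents_inv[OF assms(1)] by simp_all
qed

lemma represents_aneg: "represents g b \<Longrightarrow> represents g (aneg b)"
  using aroots_aneg aroots_root by (auto simp: represents_def arefl_aneg)

text \<open>Conjugation by a single generator acts on affine roots by \<open>represents_conj\<close>; the group is generated by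
  such elements.\<close>

lemma represents_conj_W:
  assumes "g \<in> carrier W" "represents h c"
  shows "\<exists>b. represents (g \<otimes>\<^bsub>W\<^esub> h \<otimes>\<^bsub>W\<^esub> inv\<^bsub>W\<^esub> g) b"
proof -
  let ?S = "simple_reflection C \<kappa> ` set (basis_list C)"
  have conj: "\<exists>c. represents (s \<otimes>\<^bsub>W\<^esub> h \<otimes>\<^bsub>W\<^esub> inv\<^bsub>W\<^esub> s) c" "inv\<^bsub>W\<^esub> s = s"
    if "s \<in> ?S" "represents h c" for s h c
    using that represents_simple represents_conj(1) represents_inv by blast+
  have "g \<in> generate (isometry_group C \<kappa>) (carrier (isometry_group C \<kappa>) \<inter> ?S)"
    using assms(1) by (simp add: reflection_group_def carrier_subgroup_generated)
  then show ?thesis using assms(2)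
  proof (induction arbitrary: h c rule: generate.induct)
    case one
    then have "h \<in> carrier W" by (simp add: represents_def)
    then have "\<one>\<^bsub>W\<^esub> \<otimes>\<^bsub>W\<^esub> h \<otimes>\<^bsub>W\<^esub> inv\<^bsub>W\<^esub> \<one>\<^bsub>W\<^esub> = h" by simp
    moreover have "\<one>\<^bsub>isometry_group C \<kappa>\<^esub> = \<one>\<^bsub>W\<^esub>" by (simp add: reflection_group_def)
    ultimately show ?case using one by (intro exI[of _ c]) simp
  next
    case (incl s)
    then show ?case using conj(1) by blast
  next
    case (inv s)
    then have s: "s \<in> ?S" by simp
    then have "s \<in> carrier W" using simple_reflection_W by blast
    then have "inv\<^bsub>isometry_group C \<kappa>\<^esub> s = inv\<^bsub>W\<^esub> s" unfolding reflection_group_def by simp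
    then show ?case using conj[OF s inv.prems] by simp
  next
    case (eng g1 g2)
    have "generate (isometry_group C \<kappa>) (carrier (isometry_group C \<kappa>) \<inter> ?S) = carrier W"
      by (simp add: reflection_group_def carrier_subgroup_generated)
    then have g: "g1 \<in> carrier W" "g2 \<in> carrier W" "h \<in> carrier W" using eng by (auto simp: represents_def)
    have m: "g1 \<otimes>\<^bsub>isometry_group C \<kappa>\<^esub> g2 = g1 \<otimes>\<^bsub>W\<^esub> g2" by (simp add: reflection_group_def)
    obtain b where "represents (g2 \<otimes>\<^bsub>W\<^esub> h \<otimes>\<^bsub>W\<^esub> inv\<^bsub>W\<^esub> g2) b" using eng by blast
    then obtain b' where "represents (g1 \<otimes>\<^bsub>W\<^esub> (g2 \<otimes>\<^bsub>W\<^esub> h \<otimes>\<^bsub>W\<^esub> inv\<^bsub>W\<^esub> g2) \<otimes>\<^bsub>W\<^esub> inv\<^bsub>W\<^esub> g1) b'" using eng by blast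
    then show ?case unfolding m using g by (intro exI[of _ b']) (simp add: W.inv_mult_group W.m_assoc)
  qed
qed

lemma reflections_represented:
  assumes "g \<in> reflections C \<kappa>" shows "\<exists>b. represents g b"
  using assms represents_simple represents_conj_W unfolding reflections_def by blast

lemma emb_list_prod:
  assumes "list_all2 represents gs bs" "x \<in> \<Gamma>"
  shows "emb (list_prod W gs x) = aprod bs (emb x)"
  using assms
proof (induction rule: list_all2_induct)
  case Nil
  then show ?case by (simp add: W_one)
next
  case (Cons g gs b bs)
  have "set gs \<subseteq> carrier W" using Cons.hyps(2) by (auto simp: represents_def list_all2_conv_all_nth in_set_conv_nth)
  then have "list_prod W gs \<in> carrier W" by simp
  with Cons show ?case by (simp add: represents_def W_mult W_closed)
qed

text \<open>A Hurwitz move of affine roots is realised by one letter of the braid group, a change of sign by no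
  letter at all.\<close>

lemma hurwitz_transfer:
  assumes "hurwitz bs cs" "list_all2 represents gs bs"
  shows "\<exists>w\<in>braid_words (length gs). list_all2 represents (hurwitz_word W w gs) cs"
  using assms(1)
proof induction
  case start
  show ?case by (rule bexI[of _ "[]"]) (use assms(2) in simp_all)
next
  case (right xs b c ys)
  then obtain w where w: "w \<in> braid_words (length gs)" "list_all2 represents (hurwitz_word W w gs) (xs @ b # c # ys)" by blast
  then obtain us g h vs where s: "hurwitz_word W w gs = us @ g # h # vs" "length us = length xs"
    "list_all2 represents us xs" "represents g b" "represents h c" "list_all2 represents vs ys"
    by (auto simp: list_all2_append2 list_all2_Cons2)
  have "length gs = length (us @ g # h # vs)"
    using w(2) s(1) assms(2) hurwitz_length[OF right.hyps] by (metis list_all2_lengthD)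
  then have "length us + 1 \<in> {1..<length gs}" by simp
  then show ?case using s w(1) represents_conj(2)[OF s(5,4)]
    by (intro bexI[of _ "(length us + 1, True) # w"])
       (auto simp: hurwitz_letter_split(1) list_all2_appendI simp del: hurwitz_letter.simps)
next
  case (left xs b c ys)
  then obtain w where w: "w \<in> braid_words (length gs)" "list_all2 represents (hurwitz_word W w gs) (xs @ b # c # ys)" by blast
  then obtain us g h vs where s: "hurwitz_word W w gs = us @ g # h # vs" "length us = length xs"
    "list_all2 represents us xs" "represents g b" "represents h c" "list_all2 represents vs ys"
    by (auto simp: list_all2_append2 list_all2_Cons2)
  have "length gs = length (us @ g # h # vs)"
    using w(2) s(1) assms(2) hurwitz_length[OF left.hyps] by (metis list_all2_lengthD)
  then have "length us + 1 \<in> {1..<length gs}" by simp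
  then show ?case using s w(1) represents_conj(1)[OF s(4,5)]
    by (intro bexI[of _ "(length us + 1, False) # w"])
       (auto simp: hurwitz_letter_split(2) list_all2_appendI simp del: hurwitz_letter.simps)
next
  case (sign xs b ys)
  then obtain w where w: "w \<in> braid_words (length gs)" "list_all2 represents (hurwitz_word W w gs) (xs @ b # ys)" by blast
  then obtain us g vs where s: "hurwitz_word W w gs = us @ g # vs"
    "list_all2 represents us xs" "represents g b" "list_all2 represents vs ys"
    by (auto simp: list_all2_append2 list_all2_Cons2)
  then have "list_all2 represents (hurwitz_word W w gs) (xs @ aneg b # ys)"
    using represents_aneg by (simp add: list_all2_appendI)
  with w(1) show ?case by blast
qed

text \<open>Choose affine roots for the factors. The images of lattice vectors under \<open>emb\<close> include all \<open>(v, 0)\<close>, and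
  a product of affine reflections is determined by its values there (\<open>aprod_shift\<close>).\<close>

theorem factorization_to_standard:
  assumes gs: "gs \<in> factorizations W (reflections C \<kappa>) r (coxeter_element C \<kappa>)" and r: "r \<le> length (basis_list C)"
  shows "\<exists>w\<in>braid_words r. hurwitz_word W w gs = map (simple_reflection C \<kappa>) (basis_list C)"
proof -
  from gs have "length gs = r" "\<forall>g\<in>set gs. \<exists>b. represents g b" and prod: "list_prod W gs = coxeter_element C \<kappa>"
    using reflections_represented by (auto simp: factorizations_def)
  then obtain B where B: "\<And>g. g \<in> set gs \<Longrightarrow> represents g (B g)" by metis
  let ?bs = "map B gs"
  have rep: "list_all2 represents gs ?bs" using B by (simp add: list.rel_map list_all2_same)
  have std: "list_all2 represents (map (simple_reflection C \<kappa>) (basis_list C)) (map gen (basis_list C))"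
    using represents_simple by (simp add: list.rel_map list_all2_same)
  have "hurwitz ?bs (map gen (basis_list C))"
  proof (rule hurwitz_to_standard)
    show "set ?bs \<subseteq> aroots" using B by (auto simp: represents_def)
    show "length ?bs \<le> length (basis_list C)" using r \<open>length gs = r\<close> by simp
    fix v :: "vertex \<Rightarrow> int" and m :: int assume "\<And>a. a \<notin> star C \<Longrightarrow> v a = 0"
    then obtain x where x: "x \<in> \<Gamma>" "emb x = (v, 0)" using emb_surj by blast
    have "aprod ?bs (v, 0) = aprod (map gen (basis_list C)) (v, 0)"
      using emb_list_prod[OF rep x(1)] emb_list_prod[OF std x(1)] x(2) prod by (simp add: coxeter_element_def)
    then show "aprod ?bs (v, m) = aprod (map gen (basis_list C)) (v, m)"
      using aprod_shift by metis
  qed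
  from hurwitz_transfer[OF this rep] obtain w where w: "w \<in> braid_words r"
    "list_all2 represents (hurwitz_word W w gs) (map gen (basis_list C))" using \<open>length gs = r\<close> by blast
  then have "hurwitz_word W w gs = map (simple_reflection C \<kappa>) (basis_list C)"
    using represents_list_unique std by blast
  with w(1) show ?thesis by blast
qed

lemma factor_length_le:
  "factor_length W (reflections C \<kappa>) (coxeter_element C \<kappa>) \<le> length (basis_list C)"
proof -
  have "simple_reflection C \<kappa> a \<in> reflections C \<kappa>" if "a \<in> set (basis_list C)" for a
  proof -
    have "simple_reflection C \<kappa> a = \<one>\<^bsub>W\<^esub> \<otimes>\<^bsub>W\<^esub> simple_reflection C \<kappa> a \<otimes>\<^bsub>W\<^esub> inv\<^bsub>W\<^esub> \<one>\<^bsub>W\<^esub>"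
      using simple_reflection_W[OF that] by simp
    then show ?thesis unfolding reflections_def using that W.one_closed by blast
  qed
  then have "map (simple_reflection C \<kappa>) (basis_list C) \<in>
      factorizations W (reflections C \<kappa>) (length (basis_list C)) (coxeter_element C \<kappa>)"
    by (auto simp: factorizations_def coxeter_element_def)
  then show ?thesis unfolding factor_length_def by (intro Least_le) blast
qed

text \<open>All reduced factorizations lie in the orbit of the standard one.\<close>

theorem hurwitz_transitive:
  fixes r E
  defines "r \<equiv> factor_length W (reflections C \<kappa>) (coxeter_element C \<kappa>)"
    and "E \<equiv> reduced_factorizations W (reflections C \<kappa>) (coxeter_element C \<kappa>)"
  shows "transitive_action (braid_group r) E (hurwitz_action W E)"
proof -
  note hyp = hurwitz_action_reduced_factorizations[OF symbol scale]
  interpret group_action "braid_group r" E "hurwitz_action W E"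
    using hyp(4) unfolding r_def E_def .
  interpret B: group "braid_group r" by (rule group_braid_group)
  have E: "E = factorizations W (reflections C \<kappa>) r (coxeter_element C \<kappa>)"
    by (simp add: E_def r_def reduced_factorizations_def)
  let ?std = "map (simple_reflection C \<kappa>) (basis_list C)"
  have T: "reflections C \<kappa> \<subseteq> carrier W" by (rule hyp(2))
  have conj: "h \<otimes>\<^bsub>W\<^esub> g \<otimes>\<^bsub>W\<^esub> inv\<^bsub>W\<^esub> h \<in> reflections C \<kappa>" if "g \<in> reflections C \<kappa>" "h \<in> carrier W" for g h
  proof -
    from that(1) obtain k a where k: "k \<in> carrier W" "a \<in> set (basis_list C)"
      "g = k \<otimes>\<^bsub>W\<^esub> simple_reflection C \<kappa> a \<otimes>\<^bsub>W\<^esub> inv\<^bsub>W\<^esub> k" by (auto simp: reflections_def)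
    have "h \<otimes>\<^bsub>W\<^esub> g \<otimes>\<^bsub>W\<^esub> inv\<^bsub>W\<^esub> h = (h \<otimes>\<^bsub>W\<^esub> k) \<otimes>\<^bsub>W\<^esub> simple_reflection C \<kappa> a \<otimes>\<^bsub>W\<^esub> inv\<^bsub>W\<^esub> (h \<otimes>\<^bsub>W\<^esub> k)"
      using k that(2) simple_reflection_W[OF k(2)] by (simp add: W.m_assoc W.inv_mult_group)
    then show ?thesis unfolding reflections_def using k that(2) W.m_closed by blast
  qed
  have conj': "inv\<^bsub>W\<^esub> h \<otimes>\<^bsub>W\<^esub> g \<otimes>\<^bsub>W\<^esub> h \<in> reflections C \<kappa>" if "g \<in> reflections C \<kappa>" "h \<in> reflections C \<kappa>" for g h
    using conj[OF that(1), of "inv\<^bsub>W\<^esub> h"] that(2) T by auto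
  have to_std: "\<exists>A\<in>carrier (braid_group r). hurwitz_action W E A gs = ?std" if gs: "gs \<in> E" for gs
  proof -
    obtain w where w: "w \<in> braid_words r" "hurwitz_word W w gs = ?std"
      using factorization_to_standard[OF gs[unfolded E]] factor_length_le unfolding r_def by blast
    have "hurwitz_action W E (braid_rel r `` {w}) gs = ?std"
      unfolding E w(2)[symmetric] by (rule W.hurwitz_action_class[OF T conj' _ w(1) gs[unfolded E]]) (use conj T in auto)
    with w(1) show ?thesis using carrier_braid_group by blast
  qed
  show ?thesis
  proof
    fix gs hs assume "gs \<in> E" "hs \<in> E"
    then obtain A B where AB: "A \<in> carrier (braid_group r)" "hurwitz_action W E A gs = ?std"
        "B \<in> carrier (braid_group r)" "hurwitz_action W E B hs = ?std" using to_std by metis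
    have "hurwitz_action W E (inv\<^bsub>braid_group r\<^esub> B) ?std = hs"
      using orbit_sym_aux[OF AB(3) \<open>hs \<in> E\<close> AB(4)] .
    then have "hurwitz_action W E (inv\<^bsub>braid_group r\<^esub> B \<otimes>\<^bsub>braid_group r\<^esub> A) gs = hs"
      using composition_rule[OF \<open>gs \<in> E\<close> B.inv_closed[OF AB(3)] AB(1)] AB(2) by simp
    then show "\<exists>A\<in>carrier (braid_group r). hurwitz_action W E A gs = hs"
      using AB(1,3) by blast
  qed
qed

end

theorem corollary6p20:
  fixes C :: canonical_symbol and \<kappa> :: nat
  assumes "is_symbol C" and "admissible_scale C \<kappa>" and "non_tubular C"
  shows "transitive_action
     (braid_group (factor_length (reflection_group C \<kappa>) (reflections C \<kappa>) (coxeter_element C \<kappa>)))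
     (reduced_factorizations (reflection_group C \<kappa>) (reflections C \<kappa>) (coxeter_element C \<kappa>))
     (hurwitz_action (reflection_group C \<kappa>)
        (reduced_factorizations (reflection_group C \<kappa>) (reflections C \<kappa>) (coxeter_element C \<kappa>)))"
proof -
  interpret canonical C \<kappa> by unfold_locales (fact assms)+
  show ?thesis by (rule hurwitz_transitive)
qed

end
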